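(* Let $V$ be a vertex operator algebra of CFT type of rank $r$ and let $\ell$ be a complex number. Then $V^{[\ell]}$ is a vertex operator algebra of rank $r\ell$.
   Context: A vertex operator algebra is a $\mathbb{Z}$-graded vertex algebra $V=\bigoplus_{n\in\mathbb{Z}}V_{(n)}$ with finite-dimensional homogeneous subspaces, $V_{(n)}=0$ for $n$ sufficiently negative, and a conformal (Virasoro) vector $\omega$ whose modes $L(n)=\omega_{n+1}$ satisfy the Virasoro relations with central charge $r$ (the rank), $L(0)$ giving the grading and $Y(L(-1)v,x)=\frac{d}{dx}Y(v,x)$. It is of CFT type if $V_{(n)}=0$ for all $n<0$ and $V_{(0)}=\mathbb{C}\mathbf{1}$. Write $Y(a,x)=\sum_{n\in\mathbb{Z}}a_nx^{-n-1}$ and $D(a)=a_{-2}\mathbf{1}$. Put $\hat V=V\otimes\mathbb{C}[t,t^{-1}]$, $\hat D=D\otimes1+1\otimes\frac{d}{dt}$, and $g(V)=\hat V/\hat D\hat V$; write $a(m)$ for $a\otimes t^m+\hat D\hat V$. Then $g(V)$ is a Lie algebra with bracket $[a(m),b(n)]=\sum_{i\ge0}\binom{m}{i}(a_ib)(m+n-i)$, in which $\mathbf{1}(-1)$ is central. Let $g(V)^{+}$ be the subalgebra spanned by all $a(n)$ with $a\in V$, $n\ge0$. Let $I(V)=U(g(V))\otimes_{U(g(V)^{+})}\mathbb{C}$ be the $g(V)$-module induced from the trivial one-dimensional module, and $V^{[\ell]}=I(V)/(\mathbf{1}(-1)-\ell)I(V)$. Let $1\in V^{[\ell]}$ be the image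 of $1\otimes1$. $V^{[\ell]}$ carries a natural vertex algebra structure with vacuum $1$ and $Y(a(-1)1,z)=\sum_{n\in\mathbb{Z}}a(n)z^{-n-1}$ for $a\in V$; this is the underlying vertex algebra structure meant in the claim. *)

theory Defs
  imports "HOL-Algebra.Algebra" "HOL-Algebra.Algebraic_Closure_Type"
begin

section \<open>Complex vector spaces\<close>

text \<open>
  Complex vector spaces are modules in the sense of HOL-Algebra over the field of complex numbers.
  The multiplicative fields of the module record are only used for algebras; they are
  \<^const>\<open>undefined\<close> for mere vector spaces.
\<close>

abbreviation CC :: "complex ring" where
  "CC \<equiv> ring_of_type_algebra"

definition lin_span :: "(complex, 'v) module \<Rightarrow> 'v set \<Rightarrow> 'v set" where
  "lin_span V S = \<Inter>{H. submodule H CC V \<and> S \<subseteq> H}"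

text \<open>Sum of a family with finite support over an arbitrary index type.\<close>

definition fsum :: "(complex, 'v) module \<Rightarrow> ('i \<Rightarrow> 'v) \<Rightarrow> 'v" where
  "fsum V f = finsum V f {i. f i \<noteq> \<zero>\<^bsub>V\<^esub>}"

text \<open>The map \<open>x + M \<mapsto> f x + N\<close> induced on cosets, where \<open>N\<close> is a subspace of \<open>V\<close>.\<close>

definition coset_map :: "(complex, 'v) module \<Rightarrow> 'v set \<Rightarrow> ('u \<Rightarrow> 'v) \<Rightarrow> 'u set \<Rightarrow> 'v set" where
  "coset_map V N f A = (\<Union>x\<in>A. N +>\<^bsub>V\<^esub> f x)"

definition quot_module :: "(complex, 'v) module \<Rightarrow> 'v set \<Rightarrow> (complex, 'v set) module" where
  "quot_module V N =
    \<lparr>carrier = a_rcosets\<^bsub>V\<^esub> N, monoid.mult = undefined, monoid.one = undefined,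
     ring.zero = N, ring.add = set_add V,
     module.smult = (\<lambda>c. coset_map V N (\<lambda>x. c \<odot>\<^bsub>V\<^esub> x))\<rparr>"

definition complex_line :: "(complex, complex) module" where
  "complex_line =
    \<lparr>carrier = UNIV, monoid.mult = (*), monoid.one = 1,
     ring.zero = 0, ring.add = (+), module.smult = (*)\<rparr>"

definition delta :: "'x \<Rightarrow> 'x \<Rightarrow> complex" where
  "delta x = (\<lambda>y. if y = x then 1 else 0)"

text \<open>The vector space with basis \<^term>\<open>S\<close>; the basis vector of \<open>x\<close> is \<^term>\<open>delta x\<close>.\<close>

definition free_vs :: "'x set \<Rightarrow> (complex, 'x \<Rightarrow> complex) module" where
  "free_vs S =
    \<lparr>carrier = {p. finite {x. p x \<noteq> 0} \<and> {x. p x \<noteq> 0} \<subseteq> S},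
     monoid.mult = undefined, monoid.one = undefined,
     ring.zero = (\<lambda>x. 0), ring.add = (\<lambda>p q x. p x + q x), module.smult = (\<lambda>c p x. c * p x)\<rparr>"


section \<open>Vertex algebras and vertex operator algebras\<close>

text \<open>
  \<open>Y a n b\<close> is \<open>a\<^sub>n b\<close>, i.e. \<open>Y(a,x) = \<Sum>n. a\<^sub>n x\<^bsup>-n-1\<^esup>\<close>. The last axiom is the coefficient form
  (Borcherds identity) of the Jacobi identity; truncation makes both sums finite.
\<close>

locale vertex_algebra = module CC V for V :: "(complex, 'v) module" +
  fixes Y :: "'v \<Rightarrow> int \<Rightarrow> 'v \<Rightarrow> 'v" and vac :: 'v
  assumes Y_closed: "\<lbrakk>a \<in> carrier V; b \<in> carrier V\<rbrakk> \<Longrightarrow> Y a n b \<in> carrier V"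
    and Y_add_left: "\<lbrakk>a \<in> carrier V; a' \<in> carrier V; b \<in> carrier V\<rbrakk>
          \<Longrightarrow> Y (a \<oplus>\<^bsub>V\<^esub> a') n b = Y a n b \<oplus>\<^bsub>V\<^esub> Y a' n b"
    and Y_smult_left: "\<lbrakk>a \<in> carrier V; b \<in> carrier V\<rbrakk>
          \<Longrightarrow> Y (k \<odot>\<^bsub>V\<^esub> a) n b = k \<odot>\<^bsub>V\<^esub> Y a n b"
    and Y_add_right: "\<lbrakk>a \<in> carrier V; b \<in> carrier V; b' \<in> carrier V\<rbrakk>
          \<Longrightarrow> Y a n (b \<oplus>\<^bsub>V\<^esub> b') = Y a n b \<oplus>\<^bsub>V\<^esub> Y a n b'"
    and Y_smult_right: "\<lbrakk>a \<in> carrier V; b \<in> carrier V\<rbrakk>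
          \<Longrightarrow> Y a n (k \<odot>\<^bsub>V\<^esub> b) = k \<odot>\<^bsub>V\<^esub> Y a n b"
    and truncation: "\<lbrakk>a \<in> carrier V; b \<in> carrier V\<rbrakk> \<Longrightarrow> \<exists>N. \<forall>n\<ge>N. Y a n b = \<zero>\<^bsub>V\<^esub>"
    and vac_closed: "vac \<in> carrier V"
    and vacuum: "b \<in> carrier V \<Longrightarrow> Y vac n b = (if n = -1 then b else \<zero>\<^bsub>V\<^esub>)"
    and creation: "a \<in> carrier V \<Longrightarrow> n \<ge> 0 \<Longrightarrow> Y a n vac = \<zero>\<^bsub>V\<^esub>"
    and creation': "a \<in> carrier V \<Longrightarrow> Y a (-1) vac = a"
    and jacobi: "\<lbrakk>a \<in> carrier V; b \<in> carrier V; c \<in> carrier V\<rbrakk> \<Longrightarrow>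
          fsum V (\<lambda>i::nat. (of_int m gchoose i) \<odot>\<^bsub>V\<^esub> Y (Y a (l + int i) b) (m + n - int i) c) =
          fsum V (\<lambda>i::nat. ((-1) ^ i * (of_int l gchoose i)) \<odot>\<^bsub>V\<^esub>
            (Y a (m + l - int i) (Y b (n + int i) c) \<ominus>\<^bsub>V\<^esub>
             ((-1) powi l) \<odot>\<^bsub>V\<^esub> Y b (n + l - int i) (Y a (m + int i) c)))"

text \<open>
  \<open>gr n\<close> is the homogeneous subspace of weight \<open>n\<close>, \<open>\<omega>\<close> the conformal vector and \<open>r\<close> the rank.
  The Virasoro operator \<open>L(n)\<close> is \<open>Y \<omega> (n + 1)\<close>.
\<close>

locale vertex_operator_algebra = vertex_algebra V Y vac
  for V :: "(complex, 'v) module" and Y :: "'v \<Rightarrow> int \<Rightarrow> 'v \<Rightarrow> 'v" and vac :: 'v +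
  fixes gr :: "int \<Rightarrow> 'v set" and \<omega> :: 'v and r :: complex
  assumes gr_subspace: "submodule (gr n) CC V"
    and gr_direct_sum: "v \<in> carrier V \<Longrightarrow>
          \<exists>!f. (\<forall>n. f n \<in> gr n) \<and> finite {n. f n \<noteq> \<zero>\<^bsub>V\<^esub>} \<and> v = fsum V f"
    and gr_finite_dim: "\<exists>B. finite B \<and> B \<subseteq> gr n \<and> gr n = lin_span V B"
    and gr_bounded_below: "\<exists>N. \<forall>n<N. gr n = {\<zero>\<^bsub>V\<^esub>}"
    and gr_vac: "vac \<in> gr 0"
    and gr_Y: "\<lbrakk>a \<in> gr p; b \<in> gr q\<rbrakk> \<Longrightarrow> Y a n b \<in> gr (p + q - n - 1)"
    and conformal_closed: "\<omega> \<in> carrier V"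
    and virasoro: "v \<in> carrier V \<Longrightarrow>
          Y \<omega> (m + 1) (Y \<omega> (n + 1) v) \<ominus>\<^bsub>V\<^esub> Y \<omega> (n + 1) (Y \<omega> (m + 1) v) =
          of_int (m - n) \<odot>\<^bsub>V\<^esub> Y \<omega> (m + n + 1) v \<oplus>\<^bsub>V\<^esub>
          (if m + n = 0 then (of_int (m ^ 3 - m) / 12 * r) \<odot>\<^bsub>V\<^esub> v else \<zero>\<^bsub>V\<^esub>)"
    and L0_grading: "v \<in> gr n \<Longrightarrow> Y \<omega> 1 v = of_int n \<odot>\<^bsub>V\<^esub> v"
    and Lm1_derivative: "\<lbrakk>a \<in> carrier V; b \<in> carrier V\<rbrakk> \<Longrightarrow>
          Y (Y \<omega> 0 a) n b = (- of_int n) \<odot>\<^bsub>V\<^esub> Y a (n - 1) b"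

locale voa_cft_type = vertex_operator_algebra +
  assumes gr_negative: "n < 0 \<Longrightarrow> gr n = {\<zero>\<^bsub>V\<^esub>}"
    and gr_zero: "gr 0 = {c \<odot>\<^bsub>V\<^esub> vac | c. True}"


section \<open>Universal enveloping algebras and induced modules\<close>

text \<open>The free associative algebra on the set \<^term>\<open>S\<close>: the words over \<open>S\<close> form a basis.\<close>

definition free_alg :: "'g set \<Rightarrow> (complex, 'g list \<Rightarrow> complex) module" where
  "free_alg S = (free_vs (lists S))
    \<lparr>monoid.mult := (\<lambda>p q w. \<Sum>i\<le>length w. p (take i w) * q (drop i w)), monoid.one := delta []\<rparr>"

text \<open>
  A Lie algebra is given by its underlying vector space \<open>G\<close> and its bracket \<open>br\<close>. Its universal
  enveloping algebra is presented as the free associative algebra on the set \<^term>\<open>carrier G\<close>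
  modulo the relations making \<open>G \<rightarrow> U(G)\<close> linear (so that one obtains the tensor algebra)
  and the relations \<open>x y - y x = [x, y]\<close>.
\<close>

definition uea_ideal ::
  "(complex, 'g) module \<Rightarrow> ('g \<Rightarrow> 'g \<Rightarrow> 'g) \<Rightarrow> ('g list \<Rightarrow> complex) set" where
  "uea_ideal G br = (let F = free_alg (carrier G) in genideal F
    ({delta [x \<oplus>\<^bsub>G\<^esub> y] \<ominus>\<^bsub>F\<^esub> (delta [x] \<oplus>\<^bsub>F\<^esub> delta [y]) | x y. x \<in> carrier G \<and> y \<in> carrier G} \<union>
     {delta [c \<odot>\<^bsub>G\<^esub> x] \<ominus>\<^bsub>F\<^esub> c \<odot>\<^bsub>F\<^esub> delta [x] | c x. x \<in> carrier G} \<union>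
     {(delta [x] \<otimes>\<^bsub>F\<^esub> delta [y] \<ominus>\<^bsub>F\<^esub> delta [y] \<otimes>\<^bsub>F\<^esub> delta [x]) \<ominus>\<^bsub>F\<^esub> delta [br x y] | x y.
        x \<in> carrier G \<and> y \<in> carrier G}))"

definition uea ::
  "(complex, 'g) module \<Rightarrow> ('g \<Rightarrow> 'g \<Rightarrow> 'g) \<Rightarrow> (complex, ('g list \<Rightarrow> complex) set) module" where
  "uea G br = (let F = free_alg (carrier G); J = uea_ideal G br in
    \<lparr>carrier = carrier (F Quot J), monoid.mult = monoid.mult (F Quot J),
     monoid.one = monoid.one (F Quot J),
     ring.zero = ring.zero (F Quot J), ring.add = ring.add (F Quot J),
     module.smult = (\<lambda>c. coset_map F J (\<lambda>p. c \<odot>\<^bsub>F\<^esub> p))\<rparr>)"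

definition uea_emb ::
  "(complex, 'g) module \<Rightarrow> ('g \<Rightarrow> 'g \<Rightarrow> 'g) \<Rightarrow> 'g \<Rightarrow> ('g list \<Rightarrow> complex) set" where
  "uea_emb G br x = uea_ideal G br +>\<^bsub>free_alg (carrier G)\<^esub> delta [x]"

text \<open>
  For a Lie subalgebra with carrier \<open>P\<close>, the algebra homomorphism \<open>U(P) \<rightarrow> U(G)\<close> induced by the
  inclusion.
\<close>

definition uea_incl ::
  "(complex, 'g) module \<Rightarrow> ('g \<Rightarrow> 'g \<Rightarrow> 'g) \<Rightarrow> ('g list \<Rightarrow> complex) set \<Rightarrow> ('g list \<Rightarrow> complex) set" where
  "uea_incl G br = coset_map (free_alg (carrier G)) (uea_ideal G br) (\<lambda>p. p)"

text \<open>
  The action of an enveloping algebra on the trivial one-dimensional module: \<open>U(P)\<close> acts through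
  the algebra homomorphism to the complex numbers killing \<open>P\<close>, which takes the class of an element
  of the free algebra to its constant coefficient (all defining relations have constant
  coefficient \<open>0\<close>).
\<close>

definition uea_counit :: "('g list \<Rightarrow> complex) set \<Rightarrow> complex" where
  "uea_counit A = (THE c. \<exists>p\<in>A. c = p [])"

text \<open>
  The tensor product over an algebra with carrier \<open>A\<close> of a right module \<open>M\<close> (action \<open>ra\<close>) and a left
  module \<open>N\<close> (action \<open>la\<close>): the vector space with basis \<open>M \<times> N\<close> modulo bilinearity and
  \<open>(m a) \<otimes> n = m \<otimes> (a n)\<close>.
\<close>

definition tensor_rels :: "'a set \<Rightarrow> ('m \<Rightarrow> 'a \<Rightarrow> 'm) \<Rightarrow> ('a \<Rightarrow> 'n \<Rightarrow> 'n) \<Rightarrow>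
    (complex, 'm) module \<Rightarrow> (complex, 'n) module \<Rightarrow> ('m \<times> 'n \<Rightarrow> complex) set" where
  "tensor_rels A ra la M N = (let F = free_vs (carrier M \<times> carrier N) in lin_span F
    ({delta (m \<oplus>\<^bsub>M\<^esub> m', n) \<ominus>\<^bsub>F\<^esub> (delta (m, n) \<oplus>\<^bsub>F\<^esub> delta (m', n)) | m m' n.
        m \<in> carrier M \<and> m' \<in> carrier M \<and> n \<in> carrier N} \<union>
     {delta (m, n \<oplus>\<^bsub>N\<^esub> n') \<ominus>\<^bsub>F\<^esub> (delta (m, n) \<oplus>\<^bsub>F\<^esub> delta (m, n')) | m n n'.
        m \<in> carrier M \<and> n \<in> carrier N \<and> n' \<in> carrier N} \<union>
     {delta (c \<odot>\<^bsub>M\<^esub> m, n) \<ominus>\<^bsub>F\<^esub> c \<odot>\<^bsub>F\<^esub> delta (m, n) | c m n. m \<in> carrier M \<and> n \<in> carrier N} \<union>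
     {delta (m, c \<odot>\<^bsub>N\<^esub> n) \<ominus>\<^bsub>F\<^esub> c \<odot>\<^bsub>F\<^esub> delta (m, n) | c m n. m \<in> carrier M \<and> n \<in> carrier N} \<union>
     {delta (ra m a, n) \<ominus>\<^bsub>F\<^esub> delta (m, la a n) | m a n.
        m \<in> carrier M \<and> a \<in> A \<and> n \<in> carrier N}))"

text \<open>
  The \<open>G\<close>-module \<open>U(G) \<otimes>\<^bsub>U(P)\<^esub> \<complex>\<close> induced from the trivial one-dimensional module of the
  subalgebra \<open>P\<close>.
\<close>

definition ind_rels :: "(complex, 'g) module \<Rightarrow> ('g \<Rightarrow> 'g \<Rightarrow> 'g) \<Rightarrow> 'g set \<Rightarrow>
    (('g list \<Rightarrow> complex) set \<times> complex \<Rightarrow> complex) set" where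
  "ind_rels G br P = tensor_rels (carrier (uea (G\<lparr>carrier := P\<rparr>) br))
     (\<lambda>u h. u \<otimes>\<^bsub>uea G br\<^esub> uea_incl G br h) (\<lambda>h c. uea_counit h * c) (uea G br) complex_line"

definition ind_free :: "(complex, 'g) module \<Rightarrow> ('g \<Rightarrow> 'g \<Rightarrow> 'g) \<Rightarrow>
    (complex, ('g list \<Rightarrow> complex) set \<times> complex \<Rightarrow> complex) module" where
  "ind_free G br = free_vs (carrier (uea G br) \<times> carrier complex_line)"

definition ind_triv :: "(complex, 'g) module \<Rightarrow> ('g \<Rightarrow> 'g \<Rightarrow> 'g) \<Rightarrow> 'g set \<Rightarrow>
    (complex, (('g list \<Rightarrow> complex) set \<times> complex \<Rightarrow> complex) set) module" where
  "ind_triv G br P = quot_module (ind_free G br) (ind_rels G br P)"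

definition ind_gen :: "(complex, 'g) module \<Rightarrow> ('g \<Rightarrow> 'g \<Rightarrow> 'g) \<Rightarrow> 'g set \<Rightarrow>
    (('g list \<Rightarrow> complex) set \<times> complex \<Rightarrow> complex) set" where
  "ind_gen G br P = ind_rels G br P +>\<^bsub>ind_free G br\<^esub> delta (\<one>\<^bsub>uea G br\<^esub>, 1)"

text \<open>The action \<open>x (u \<otimes> c) = (x u) \<otimes> c\<close>, extended linearly.\<close>

definition ind_act :: "(complex, 'g) module \<Rightarrow> ('g \<Rightarrow> 'g \<Rightarrow> 'g) \<Rightarrow> 'g set \<Rightarrow> 'g \<Rightarrow>
    (('g list \<Rightarrow> complex) set \<times> complex \<Rightarrow> complex) set \<Rightarrow>
    (('g list \<Rightarrow> complex) set \<times> complex \<Rightarrow> complex) set" where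
  "ind_act G br P x = coset_map (ind_free G br) (ind_rels G br P)
     (\<lambda>T. fsum (ind_free G br)
        (\<lambda>(u, c). T (u, c) \<odot>\<^bsub>ind_free G br\<^esub> delta (uea_emb G br x \<otimes>\<^bsub>uea G br\<^esub> u, c)))"


section \<open>The Lie algebra \<open>g(V)\<close>\<close>

text \<open>
  \<open>V \<otimes> \<complex>[t, t\<^sup>-\<^sup>1]\<close> as the space of Laurent polynomials with coefficients in \<open>V\<close>; \<open>f n\<close> is the
  coefficient of \<open>t\<^sup>n\<close>.
\<close>

definition laurent :: "(complex, 'v) module \<Rightarrow> (complex, int \<Rightarrow> 'v) module" where
  "laurent V =
    \<lparr>carrier = {f. (\<forall>n. f n \<in> carrier V) \<and> finite {n. f n \<noteq> \<zero>\<^bsub>V\<^esub>}},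
     monoid.mult = undefined, monoid.one = undefined, ring.zero = (\<lambda>n. \<zero>\<^bsub>V\<^esub>),
     ring.add = (\<lambda>f g n. f n \<oplus>\<^bsub>V\<^esub> g n), module.smult = (\<lambda>c f n. c \<odot>\<^bsub>V\<^esub> f n)\<rparr>"

definition laurent_term :: "(complex, 'v) module \<Rightarrow> 'v \<Rightarrow> int \<Rightarrow> int \<Rightarrow> 'v" where
  "laurent_term V a m = (\<lambda>n. if n = m then a else \<zero>\<^bsub>V\<^esub>)"

text \<open>\<open>D \<otimes> 1 + 1 \<otimes> d/dt\<close>, where \<open>D a = a\<^bsub>-2\<^esub> vac\<close>.\<close>

definition hatD :: "(complex, 'v) module \<Rightarrow> ('v \<Rightarrow> int \<Rightarrow> 'v \<Rightarrow> 'v) \<Rightarrow> 'v \<Rightarrow>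
    (int \<Rightarrow> 'v) \<Rightarrow> int \<Rightarrow> 'v" where
  "hatD V Y vac f = (\<lambda>n. Y (f n) (-2) vac \<oplus>\<^bsub>V\<^esub> of_int (n + 1) \<odot>\<^bsub>V\<^esub> f (n + 1))"

definition hatD_image :: "(complex, 'v) module \<Rightarrow> ('v \<Rightarrow> int \<Rightarrow> 'v \<Rightarrow> 'v) \<Rightarrow> 'v \<Rightarrow>
    (int \<Rightarrow> 'v) set" where
  "hatD_image V Y vac = hatD V Y vac ` carrier (laurent V)"

definition gV :: "(complex, 'v) module \<Rightarrow> ('v \<Rightarrow> int \<Rightarrow> 'v \<Rightarrow> 'v) \<Rightarrow> 'v \<Rightarrow>
    (complex, (int \<Rightarrow> 'v) set) module" where
  "gV V Y vac = quot_module (laurent V) (hatD_image V Y vac)"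

text \<open>The element \<open>a(m)\<close> of \<open>g(V)\<close>.\<close>

definition gmode :: "(complex, 'v) module \<Rightarrow> ('v \<Rightarrow> int \<Rightarrow> 'v \<Rightarrow> 'v) \<Rightarrow> 'v \<Rightarrow>
    'v \<Rightarrow> int \<Rightarrow> (int \<Rightarrow> 'v) set" where
  "gmode V Y vac a m = hatD_image V Y vac +>\<^bsub>laurent V\<^esub> laurent_term V a m"

text \<open>
  The bilinear extension of
  \<open>(a \<otimes> t\<^sup>m, b \<otimes> t\<^sup>n) \<mapsto> \<Sum>i. (m choose i) (a\<^sub>i b) \<otimes> t\<^bsup>m+n-i\<^esup>\<close>, and the bracket it induces on the
  quotient.
\<close>

definition pre_bracket :: "(complex, 'v) module \<Rightarrow> ('v \<Rightarrow> int \<Rightarrow> 'v \<Rightarrow> 'v) \<Rightarrow>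
    (int \<Rightarrow> 'v) \<Rightarrow> (int \<Rightarrow> 'v) \<Rightarrow> int \<Rightarrow> 'v" where
  "pre_bracket V Y f g = fsum (laurent V) (\<lambda>(m :: int, n :: int, i :: nat).
     laurent_term V ((of_int m gchoose i) \<odot>\<^bsub>V\<^esub> Y (f m) (int i) (g n)) (m + n - int i))"

definition gV_bracket :: "(complex, 'v) module \<Rightarrow> ('v \<Rightarrow> int \<Rightarrow> 'v \<Rightarrow> 'v) \<Rightarrow> 'v \<Rightarrow>
    (int \<Rightarrow> 'v) set \<Rightarrow> (int \<Rightarrow> 'v) set \<Rightarrow> (int \<Rightarrow> 'v) set" where
  "gV_bracket V Y vac A B =
     (\<Union>f\<in>A. \<Union>g\<in>B. hatD_image V Y vac +>\<^bsub>laurent V\<^esub> pre_bracket V Y f g)"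

definition gV_plus :: "(complex, 'v) module \<Rightarrow> ('v \<Rightarrow> int \<Rightarrow> 'v \<Rightarrow> 'v) \<Rightarrow> 'v \<Rightarrow>
    (int \<Rightarrow> 'v) set set" where
  "gV_plus V Y vac = lin_span (gV V Y vac) {gmode V Y vac a n | a n. a \<in> carrier V \<and> n \<ge> 0}"


section \<open>The module \<open>V\<^bsup>[\<ell>]\<^esup>\<close>\<close>

type_synonym 'v ind_elt = "(((int \<Rightarrow> 'v) set list \<Rightarrow> complex) set \<times> complex \<Rightarrow> complex) set"

definition IV :: "(complex, 'v) module \<Rightarrow> ('v \<Rightarrow> int \<Rightarrow> 'v \<Rightarrow> 'v) \<Rightarrow> 'v \<Rightarrow>
    (complex, 'v ind_elt) module" where
  "IV V Y vac = ind_triv (gV V Y vac) (gV_bracket V Y vac) (gV_plus V Y vac)"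

definition IV_act :: "(complex, 'v) module \<Rightarrow> ('v \<Rightarrow> int \<Rightarrow> 'v \<Rightarrow> 'v) \<Rightarrow> 'v \<Rightarrow>
    (int \<Rightarrow> 'v) set \<Rightarrow> 'v ind_elt \<Rightarrow> 'v ind_elt" where
  "IV_act V Y vac = ind_act (gV V Y vac) (gV_bracket V Y vac) (gV_plus V Y vac)"

text \<open>The subspace \<open>(vac(-1) - \<ell>) I(V)\<close>.\<close>

definition level_rels :: "(complex, 'v) module \<Rightarrow> ('v \<Rightarrow> int \<Rightarrow> 'v \<Rightarrow> 'v) \<Rightarrow> 'v \<Rightarrow> complex \<Rightarrow>
    'v ind_elt set" where
  "level_rels V Y vac l =
     (\<lambda>w. IV_act V Y vac (gmode V Y vac vac (-1)) w \<ominus>\<^bsub>IV V Y vac\<^esub> l \<odot>\<^bsub>IV V Y vac\<^esub> w)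
       ` carrier (IV V Y vac)"

definition Vlevel :: "(complex, 'v) module \<Rightarrow> ('v \<Rightarrow> int \<Rightarrow> 'v \<Rightarrow> 'v) \<Rightarrow> 'v \<Rightarrow> complex \<Rightarrow>
    (complex, 'v ind_elt set) module" where
  "Vlevel V Y vac l = quot_module (IV V Y vac) (level_rels V Y vac l)"

definition Vlevel_act :: "(complex, 'v) module \<Rightarrow> ('v \<Rightarrow> int \<Rightarrow> 'v \<Rightarrow> 'v) \<Rightarrow> 'v \<Rightarrow> complex \<Rightarrow>
    (int \<Rightarrow> 'v) set \<Rightarrow> 'v ind_elt set \<Rightarrow> 'v ind_elt set" where
  "Vlevel_act V Y vac l x = coset_map (IV V Y vac) (level_rels V Y vac l) (IV_act V Y vac x)"

definition Vlevel_vac :: "(complex, 'v) module \<Rightarrow> ('v \<Rightarrow> int \<Rightarrow> 'v \<Rightarrow> 'v) \<Rightarrow> 'v \<Rightarrow> complex \<Rightarrow>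
    'v ind_elt set" where
  "Vlevel_vac V Y vac l = level_rels V Y vac l +>\<^bsub>IV V Y vac\<^esub>
     ind_gen (gV V Y vac) (gV_bracket V Y vac) (gV_plus V Y vac)"

text \<open>
  The natural vertex algebra structure: \<open>Y(a(-1)vac, z) = \<Sum>n. a(n) z\<^bsup>-n-1\<^esup>\<close> for all \<open>a\<close> in \<open>V\<close>.
  Since the elements \<open>a(-1)vac\<close> generate, it is unique on the carrier.
\<close>

definition natural_structure :: "(complex, 'v) module \<Rightarrow> ('v \<Rightarrow> int \<Rightarrow> 'v \<Rightarrow> 'v) \<Rightarrow> 'v \<Rightarrow> complex \<Rightarrow>
    ('v ind_elt set \<Rightarrow> int \<Rightarrow> 'v ind_elt set \<Rightarrow> 'v ind_elt set) \<Rightarrow> bool" where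
  "natural_structure V Y vac l Z \<longleftrightarrow>
     vertex_algebra (Vlevel V Y vac l) Z (Vlevel_vac V Y vac l) \<and>
     (\<forall>a\<in>carrier V. \<forall>n. \<forall>w\<in>carrier (Vlevel V Y vac l).
        Z (Vlevel_act V Y vac l (gmode V Y vac a (-1)) (Vlevel_vac V Y vac l)) n w =
        Vlevel_act V Y vac l (gmode V Y vac a n) w)"

end

theory Submission
  imports Defs "HOL-Library.Poly_Mapping"
begin

text \<open>
  The module \<open>W = V\<^bsup>[\<ell>]\<^esup>\<close> is generated from one vector \<open>\<Omega>\<close> by the operators \<open>a(n)\<close>, which kill \<open>\<Omega>\<close> for
  \<open>n \<ge> 0\<close> and satisfy \<open>[a(m), b(n)] = \<Sum>i. (m choose i) (a\<^sub>i b)(m + n - i)\<close>, while \<open>vac(-1)\<close> acts as the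
  scalar \<open>\<ell>\<close>. These facts (locale \<open>vacuum_module\<close>, lemma \<open>Vlevel_vacuum_module\<close>) carry the whole
  argument; the tensor product that defines \<open>W\<close> does not reappear after them.

  \<^bold>\<open>The vertex algebra.\<close> The series \<open>a(z) = \<Sum>n. a(n) z\<^bsup>-n-1\<^esup>\<close> are fields on \<open>W\<close>. They are pairwise local
  because \<open>a\<^sub>i b = 0\<close> for large \<open>i\<close>, they are translation covariant for \<open>\<omega>(0)\<close> because
  \<open>[\<omega>(0), a(n)] = (\<omega>\<^sub>0 a)(n) = -n a(n - 1)\<close>, and \<open>a(z)\<Omega>\<close> has no negative powers of \<open>z\<close>. Such a system of
  fields generates a vertex algebra (locale \<open>generating_fields\<close>). The \<open>k\<close>-th product of two local fields
  is again local to every field local to both (\<open>Dong\<close>), and a covariant field that is local to all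
  generated ones is determined by the vector it creates from \<open>\<Omega>\<close> (\<open>Goddard_uniqueness\<close>); hence
  a vector created by a generated field determines how this field acts on all vectors so created. The vector \<open>u\<^sub>k v\<close> is created
  by the \<open>k\<close>-th product of the fields of \<open>u\<close> and \<open>v\<close>, and uniqueness turns this into the Borcherds
  identity at \<open>m = 0\<close>. As both sides of that identity satisfy
  \<open>F(l + 1, m, n) = F(l, m + 1, n) - F(l, m, n + 1)\<close> and vanish for large \<open>l\<close> by locality, it follows for
  all \<open>l, m, n\<close> (\<open>state_field_Borcherds\<close>).

  \<^bold>\<open>The conformal vector.\<close> The vector \<open>\<omega>(-1)\<Omega>\<close> has the modes \<open>\<omega>(n)\<close>. In \<open>V\<close> one has \<open>\<omega>\<^sub>1 \<omega> = 2 \<omega>\<close>,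
  \<open>\<omega>\<^sub>2 \<omega> = 0\<close>, \<open>\<omega>\<^sub>3 \<omega> = (r/2) vac\<close> and \<open>\<omega>\<^sub>i \<omega> = 0\<close> for \<open>i > 3\<close>, so the commutator formula gives the Virasoro
  relations; the central term is \<open>(m + 1 choose 3) (r/2) vac(m + n - 1)\<close>, and since \<open>vac(-1) = \<ell>\<close> the rank
  is \<open>r \<ell>\<close> (\<open>W_virasoro\<close>).

  \<^bold>\<open>The grading.\<close> By \<open>modeW_wt\<close> the operator \<open>a(n)\<close> with \<open>a\<close> of weight \<open>p\<close> changes the eigenvalue of
  \<open>L(0) = \<omega>(1)\<close> by \<open>p - n - 1\<close>. As \<open>V\<close> is of CFT type, \<open>g(V)\<close> is spanned by \<open>g(V)\<^sup>+\<close>, the central element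
  \<open>vac(-1)\<close> and the modes \<open>a(-1 - k)\<close> with \<open>k \<ge> 0\<close> and \<open>a\<close> in a basis of some \<open>V\<^sub>(\<^sub>p\<^sub>)\<close>, \<open>p \<ge> 1\<close>
  (\<open>GV_generated\<close>). Moving elements of \<open>g(V)\<^sup>+\<close> to the right, where they kill \<open>\<Omega>\<close>, one finds that words in
  these last modes applied to \<open>\<Omega>\<close> span \<open>W\<close> (\<open>W_spanned\<close>). Each letter raises the weight by
  \<open>p + k \<ge> 1\<close>, so there are finitely many words of each weight and none of negative weight
  (\<open>words_finite\<close>, \<open>wt_eq_word_part\<close>).

  \<^bold>\<open>Calculation in carriers.\<close> Every complex module embeds linearly, with a linear retraction, into a
  space of finitely supported functions (\<open>coord\<close>, \<open>uncoord\<close>). Identities between finite sums are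
  checked after this embedding, and the field calculus is carried out on total vector spaces and
  transported back to the carrier of \<open>W\<close>.
\<close>

section \<open>Binomial sums and the Borcherds expression of two fields\<close>

definition evzero :: "(nat \<Rightarrow> 'w::zero) \<Rightarrow> bool" where
  "evzero g \<longleftrightarrow> (\<exists>I. \<forall>i\<ge>I. g i = 0)"

lemma evzD: "evzero g \<Longrightarrow> \<exists>I. \<forall>i\<ge>I. g i = 0"
  by (simp add: evzero_def)

lemma evzero_common: "evzero g \<Longrightarrow> evzero h \<Longrightarrow> \<exists>I. (\<forall>i\<ge>I. g i = 0) \<and> (\<forall>i\<ge>I. h i = 0)"
  unfolding evzero_def by (metis (full_types) le_trans linorder_le_cases)

lemma evzero_add: "evzero g \<Longrightarrow> evzero h \<Longrightarrow> evzero (\<lambda>i. g i + h i :: 'w::ab_group_add)"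
  and evzero_diff: "evzero g \<Longrightarrow> evzero h \<Longrightarrow> evzero (\<lambda>i. g i - h i :: 'w::ab_group_add)"
  using evzero_common[of g h] by (force simp: evzero_def)+

lemma evzero_Suc: "evzero g \<Longrightarrow> evzero (\<lambda>i. g (Suc i))"
  unfolding evzero_def by (meson le_Suc_eq)

locale complex_space = vector_space scale
  for scale :: "complex \<Rightarrow> 'w::ab_group_add \<Rightarrow> 'w"  (infixr \<open>*s\<close> 75)
begin

text \<open>
  Both sides of the Borcherds identity are sums of this form. \<open>Sum_any\<close> makes the sum total, with
  the value \<open>0\<close> when infinitely many terms survive; laws such as additivity therefore ask for sequences
  that are eventually zero.
\<close>

definition binsum :: "int \<Rightarrow> (nat \<Rightarrow> 'w) \<Rightarrow> 'w" where
  "binsum m g = Sum_any (\<lambda>i. (of_int m gchoose i) *s g i)"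

lemma binsum_eq_sum:
  assumes "\<forall>i\<ge>I. g i = 0"
  shows "binsum m g = (\<Sum>i<I. (of_int m gchoose i) *s g i)"
  unfolding binsum_def
proof (rule Sum_any.expand_superset)
  show "{a. (of_int m gchoose a) *s g a \<noteq> 0} \<subseteq> {..<I}"
    using assms by (auto simp: not_le[symmetric])
qed simp

lemma binsum_zero [simp]: "binsum m (\<lambda>i. 0) = 0"
  by (simp add: binsum_def)

lemma binsum_0 [simp]: "binsum 0 g = g 0"
proof -
  have "{a. ((0::complex) gchoose a) *s g a \<noteq> 0} \<subseteq> {0}"
    by (auto simp: gbinomial_0_left)
  then have "binsum 0 g = (\<Sum>i\<in>{0}. ((0::complex) gchoose i) *s g i)"
    unfolding binsum_def of_int_0 by (intro Sum_any.expand_superset) auto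
  then show ?thesis by simp
qed

lemma binsum_add:
  assumes "evzero g" "evzero h"
  shows "binsum m (\<lambda>i. g i + h i) = binsum m g + binsum m h"
proof -
  obtain I where I: "\<forall>i\<ge>I. g i = 0" "\<forall>i\<ge>I. h i = 0" using evzero_common[OF assms] by auto
  then have "\<forall>i\<ge>I. g i + h i = 0" by simp
  from binsum_eq_sum[OF this] binsum_eq_sum[OF I(1)] binsum_eq_sum[OF I(2)] show ?thesis
    by (simp add: sum.distrib scale_right_distrib)
qed

lemma binsum_diff:
  assumes "evzero g" "evzero h"
  shows "binsum m (\<lambda>i. g i - h i) = binsum m g - binsum m h"
proof -
  obtain I where I: "\<forall>i\<ge>I. g i = 0" "\<forall>i\<ge>I. h i = 0" using evzero_common[OF assms] by auto
  then have "\<forall>i\<ge>I. g i - h i = 0" by simp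
  from binsum_eq_sum[OF this] binsum_eq_sum[OF I(1)] binsum_eq_sum[OF I(2)] show ?thesis
    by (simp add: sum_subtractf scale_right_diff_distrib)
qed

definition lin :: "('w \<Rightarrow> 'w) \<Rightarrow> bool" where
  "lin f \<longleftrightarrow> (\<forall>x y. f (x + y) = f x + f y) \<and> (\<forall>c x. f (c *s x) = c *s f x)"

lemma lin_add: "lin f \<Longrightarrow> f (x + y) = f x + f y"
  and lin_scale: "lin f \<Longrightarrow> f (c *s x) = c *s f x"
  by (auto simp: lin_def)

lemma lin_0: "lin f \<Longrightarrow> f 0 = 0"
  using lin_scale[of f 0 0] by simp

lemma lin_neg: "lin f \<Longrightarrow> f (- x) = - f x"
  using lin_scale[of f "-1" x] by simp

lemma lin_diff: "lin f \<Longrightarrow> f (x - y) = f x - f y"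
  using lin_add[of f x "- y"] by (simp add: lin_neg)

lemma lin_sum: "lin f \<Longrightarrow> f (sum g I) = (\<Sum>i\<in>I. f (g i))"
  by (induction I rule: infinite_finite_induct) (auto simp: lin_0 lin_add)

lemma lin_compose: "lin f \<Longrightarrow> lin g \<Longrightarrow> lin (\<lambda>x. f (g x))"
  by (simp add: lin_def)

lemma lin_scale_op: "lin ((*s) c)"
  by (simp add: lin_def scale_right_distrib mult.commute)

lemma binsum_lin:
  assumes "lin f" "evzero g"
  shows "f (binsum m g) = binsum m (\<lambda>i. f (g i))"
proof -
  obtain I where I: "\<forall>i\<ge>I. g i = 0" using assms evzD by blast
  then have "\<forall>i\<ge>I. f (g i) = 0" by (simp add: lin_0 assms)
  from binsum_eq_sum[OF this] binsum_eq_sum[OF I] show ?thesis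
    by (simp add: lin_sum lin_scale assms)
qed

lemma binsum_scale: "evzero g \<Longrightarrow> binsum m (\<lambda>i. c *s g i) = c *s binsum m g"
  using binsum_lin[OF lin_scale_op] by simp

text \<open>
  Pascal's rule, applied to each coefficient.
\<close>

lemma binsum_Suc:
  assumes "evzero g"
  shows "binsum (m + 1) g = binsum m g + binsum m (\<lambda>i. g (Suc i))"
proof -
  obtain I where I: "\<forall>i\<ge>I. g i = 0" using assms evzD by blast
  then have I1: "\<forall>i\<ge>Suc I. g i = 0" and I2: "\<forall>i\<ge>I. g (Suc i) = 0" by auto
  have *: "((of_int (m + 1) :: complex) gchoose Suc i) = (of_int m gchoose Suc i) + (of_int m gchoose i)" for i
    by (simp add: gbinomial_Suc_Suc)
  have "binsum (m + 1) g = (\<Sum>i<Suc I. (of_int (m+1) gchoose i) *s g i)"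
    by (rule binsum_eq_sum[OF I1])
  also have "\<dots> = g 0 + (\<Sum>i<I. (of_int (m+1) gchoose Suc i) *s g (Suc i))"
    by (subst sum.lessThan_Suc_shift) simp
  also have "\<dots> = g 0 + (\<Sum>i<I. (of_int m gchoose Suc i) *s g (Suc i))
      + (\<Sum>i<I. (of_int m gchoose i) *s g (Suc i))"
    unfolding * by (simp add: scale_left_distrib sum.distrib add_ac)
  also have "g 0 + (\<Sum>i<I. (of_int m gchoose Suc i) *s g (Suc i))
      = (\<Sum>i<Suc I. (of_int m gchoose i) *s g i)"
    by (subst sum.lessThan_Suc_shift) simp
  also have "\<dots> = binsum m g" by (rule binsum_eq_sum[OF I1, symmetric])
  also have "(\<Sum>i<I. (of_int m gchoose i) *s g (Suc i)) = binsum m (\<lambda>i. g (Suc i))"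
    by (rule binsum_eq_sum[OF I2, symmetric])
  finally show ?thesis .
qed

lemma binsum_1: "evzero g \<Longrightarrow> binsum 1 g = g 0 + g 1"
  using binsum_Suc[of g 0] by simp

text \<open>
  Since \<open>(i + 1) (l choose i + 1) = (l - i) (l choose i)\<close>, shifting the summation index turns the left
  side into the right one.
\<close>

lemma binsum_absorb:
  assumes "evzero g"
  shows "binsum l (\<lambda>i. of_nat i *s g i) = binsum l (\<lambda>i. (of_int l - of_nat i) *s g (Suc i))"
proof -
  obtain I where I: "\<forall>i\<ge>I. g i = 0" using assms evzD by blast
  then have I1: "\<forall>i\<ge>Suc I. of_nat i *s g i = 0"
    and I2: "\<forall>i\<ge>I. (of_int l - of_nat i) *s g (Suc i) = 0" by auto
  have *: "((of_int l :: complex) gchoose Suc i) * of_nat (Suc i) = (of_int l gchoose i) * (of_int l - of_nat i)"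
    for i :: nat
    using gbinomial_mult_1[of "of_int l :: complex" i] by (simp add: algebra_simps)
  have "binsum l (\<lambda>i. of_nat i *s g i) = (\<Sum>i<Suc I. (of_int l gchoose i) *s of_nat i *s g i)"
    by (rule binsum_eq_sum[OF I1])
  also have "\<dots> = (\<Sum>i<I. ((of_int l gchoose Suc i) * of_nat (Suc i)) *s g (Suc i))"
    by (subst sum.lessThan_Suc_shift) (simp del: of_nat_Suc)
  also have "\<dots> = (\<Sum>i<I. (of_int l gchoose i) *s (of_int l - of_nat i) *s g (Suc i))"
    by (simp only: * scale_scale)
  also have "\<dots> = binsum l (\<lambda>i. (of_int l - of_nat i) *s g (Suc i))"
    by (rule binsum_eq_sum[OF I2, symmetric])
  finally show ?thesis .
qed

definition quantum_field :: "(int \<Rightarrow> 'w \<Rightarrow> 'w) \<Rightarrow> bool" where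
  "quantum_field A \<longleftrightarrow> (\<forall>n. lin (A n)) \<and> (\<forall>w. \<exists>N. \<forall>n\<ge>N. A n w = 0)"

lemma qf_lin: "quantum_field A \<Longrightarrow> lin (A n)"
  by (simp add: quantum_field_def)

lemma qf_trunc: "quantum_field A \<Longrightarrow> \<exists>N. \<forall>n\<ge>N. A n w = 0"
  by (simp add: quantum_field_def)

lemma qf_evzero:
  assumes "quantum_field B" "\<And>i. lin (f i)"
  shows "evzero (\<lambda>i::nat. f i (B (n + int i) w))"
proof -
  obtain N where N: "\<forall>k\<ge>N. B k w = 0" using qf_trunc[OF assms(1)] by blast
  have "\<forall>i\<ge>nat (N - n). f i (B (n + int i) w) = 0"
    using N by (auto simp: lin_0[OF assms(2)])
  then show ?thesis by (auto simp: evzero_def)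
qed

text \<open>
  With \<open>A(x) = \<Sum>n. A\<^sub>n x\<^bsup>-n-1\<^esup>\<close>, this is the double residue of \<open>x\<^sup>m y\<^sup>n\<close> times
  \<open>(x - y)\<^sup>l A(x) B(y) - (x - y)\<^sup>l B(y) A(x)\<close>, where the power of \<open>x - y\<close> is expanded for \<open>\<bar>x\<bar> > \<bar>y\<bar>\<close> in the
  first term and for \<open>\<bar>y\<bar> > \<bar>x\<bar>\<close> in the second. At \<open>l = 0\<close> it is the commutator, at \<open>m = 0\<close> the \<open>l\<close>-th
  product of fields.
\<close>

definition borcherds :: "(int \<Rightarrow> 'w \<Rightarrow> 'w) \<Rightarrow> (int \<Rightarrow> 'w \<Rightarrow> 'w) \<Rightarrow> int \<Rightarrow> int \<Rightarrow> int \<Rightarrow> 'w \<Rightarrow> 'w" where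
  "borcherds A B l m n w = binsum l (\<lambda>i. (-1) ^ i *s A (m + l - int i) (B (n + int i) w))
     - ((-1) powi l) *s binsum l (\<lambda>i. (-1) ^ i *s B (n + l - int i) (A (m + int i) w))"

lemma borcherds_0: "borcherds A B 0 m n w = A m (B n w) - B n (A m w)"
  by (simp add: borcherds_def)

lemma borcherds_evzero:
  assumes "quantum_field A" "quantum_field B"
  shows "evzero (\<lambda>i. (-1) ^ i *s A (k - int i) (B (n + int i) w))"
  by (rule qf_evzero[OF assms(2), of "\<lambda>i x. (-1) ^ i *s A (k - int i) x"])
     (rule lin_compose[OF lin_scale_op qf_lin[OF assms(1)]])

lemma altsum_rec:
  assumes "evzero (\<lambda>i. (-1) ^ i *s h i)"
  shows "binsum (l + 1) (\<lambda>i. (-1) ^ i *s h i) =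
    binsum l (\<lambda>i. (-1) ^ i *s h i) - binsum l (\<lambda>i. (-1) ^ i *s h (Suc i))"
proof -
  have e: "evzero (\<lambda>i. (-1) ^ i *s h (Suc i))"
    using evzero_Suc[OF assms] by (simp add: evzero_def)
  show ?thesis
    using binsum_Suc[OF assms, of l] binsum_scale[OF e, of l "-1"] by (simp)
qed

text \<open>
  One more factor \<open>x - y\<close> raises the exponent of \<open>x\<close> or, with the opposite sign, that of \<open>y\<close>. In terms of
  coefficients this is Pascal's rule. Locality, its consequences and the Borcherds identity are all
  obtained by iterating this recursion.
\<close>

lemma borcherds_rec:
  assumes A: "quantum_field A" and B: "quantum_field B"
  shows "borcherds A B (l + 1) m n w = borcherds A B l (m + 1) n w - borcherds A B l m (n + 1) w"
proof -
  have 1: "binsum (l + 1) (\<lambda>i. (-1) ^ i *s A (m + (l + 1) - int i) (B (n + int i) w)) =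
     binsum l (\<lambda>i. (-1) ^ i *s A (m + (l + 1) - int i) (B (n + int i) w))
     - binsum l (\<lambda>i. (-1) ^ i *s A (m + (l + 1) - int (Suc i)) (B (n + int (Suc i)) w))"
    by (rule altsum_rec[OF borcherds_evzero[OF A B]])
  have 2: "binsum (l + 1) (\<lambda>i. (-1) ^ i *s B (n + (l + 1) - int i) (A (m + int i) w)) =
     binsum l (\<lambda>i. (-1) ^ i *s B (n + (l + 1) - int i) (A (m + int i) w))
     - binsum l (\<lambda>i. (-1) ^ i *s B (n + (l + 1) - int (Suc i)) (A (m + int (Suc i)) w))"
    by (rule altsum_rec[OF borcherds_evzero[OF B A]])
  have p: "(-1::complex) powi (l + 1) = - ((-1) powi l)"
    by (simp add: power_int_add)
  show ?thesis
    unfolding borcherds_def 1 2 p by (simp add: algebra_simps scale_right_diff_distrib)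
qed

text \<open>
  For an exponent \<open>N \<ge> 0\<close> the two expansions of \<open>(x - y)\<^sup>N\<close> agree, so that the condition reads
  \<open>(x - y)\<^sup>N [A(x), B(y)] = 0\<close>.
\<close>

definition mutually_local :: "(int \<Rightarrow> 'w \<Rightarrow> 'w) \<Rightarrow> (int \<Rightarrow> 'w \<Rightarrow> 'w) \<Rightarrow> bool" where
  "mutually_local A B \<longleftrightarrow> (\<exists>N. \<forall>m n w. borcherds A B (int N) m n w = 0)"

lemma borcherds_ge:
  assumes "quantum_field A" "quantum_field B" "\<forall>m n w. borcherds A B N m n w = 0" "N \<le> k"
  shows "borcherds A B k m n w = 0"
  using assms(4)
proof (induction k arbitrary: m n w rule: int_ge_induct)
  case base then show ?case using assms by simp
next
  case (step k) then show ?case using borcherds_rec[OF assms(1,2)] by simp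
qed

lemma borcherds_swap:
  assumes A: "quantum_field A" and B: "quantum_field B"
  shows "borcherds B A (int N) n m w = - ((-1) ^ N *s borcherds A B (int N) m n w)"
proof (induction N arbitrary: m n)
  case 0 show ?case by (simp add: borcherds_0)
next
  case (Suc N)
  have "borcherds B A (int N + 1) n m w = borcherds B A (int N) (n+1) m w - borcherds B A (int N) n (m+1) w"
    by (rule borcherds_rec[OF B A])
  also have "\<dots> = (-1) ^ N *s (borcherds A B (int N) (m+1) n w - borcherds A B (int N) m (n+1) w)"
    by (simp add: Suc scale_right_diff_distrib)
  also have "\<dots> = (-1) ^ N *s borcherds A B (int N + 1) m n w"
    by (simp add: borcherds_rec[OF A B])
  finally show ?case by (simp add: add_ac)
qed

lemma mutually_local_sym:
  assumes "quantum_field A" "quantum_field B" "mutually_local A B"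
  shows "mutually_local B A"
  using assms(3) unfolding mutually_local_def by (auto simp: borcherds_swap[OF assms(1,2)])

lemma mutually_local_common:
  assumes "quantum_field A" "quantum_field B" "quantum_field C"
    "mutually_local A B" "mutually_local A C" "mutually_local B C"
  obtains N where "\<And>m n w. borcherds A B (int N) m n w = 0" "\<And>m n w. borcherds A C (int N) m n w = 0"
    "\<And>m n w. borcherds B C (int N) m n w = 0"
proof -
  obtain N1 N2 N3 where N: "\<forall>m n w. borcherds A B (int N1) m n w = 0" "\<forall>m n w. borcherds A C (int N2) m n w = 0"
    "\<forall>m n w. borcherds B C (int N3) m n w = 0"
    using assms unfolding mutually_local_def by metis
  show thesis
    by (rule that[of "max N1 (max N2 N3)"])
       (auto intro!: borcherds_ge[OF _ _ N(1)] borcherds_ge[OF _ _ N(2)] borcherds_ge[OF _ _ N(3)] assms)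
qed

lemma borcherds_lin:
  assumes A: "quantum_field A" and B: "quantum_field B"
  shows "lin (borcherds A B l m n)"
proof -
  note e = borcherds_evzero[OF A B] borcherds_evzero[OF B A]
  have "borcherds A B l m n (x + y) = borcherds A B l m n x + borcherds A B l m n y" for x y
    unfolding borcherds_def lin_add[OF qf_lin[OF A]] lin_add[OF qf_lin[OF B]] scale_right_distrib
    by (simp add: binsum_add e scale_right_distrib algebra_simps)
  moreover have "borcherds A B l m n (c *s x) = c *s borcherds A B l m n x" for c x
  proof -
    have *: "(-1) ^ i *s c *s z = c *s (-1) ^ i *s z" for i :: nat and z
      by (simp add: mult.commute)
    show ?thesis
      unfolding borcherds_def lin_scale[OF qf_lin[OF A]] lin_scale[OF qf_lin[OF B]] *
      by (simp only: binsum_scale e scale_right_diff_distrib scale_left_commute[of "(-1) powi l" c])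
  qed
  ultimately show ?thesis by (simp add: lin_def)
qed

text \<open>
  The point is truncation: only finitely many of the vectors \<open>A (m + i) w\<close> are nonzero, so the modes of
  \<open>B\<close> kill all of them from a common index on.
\<close>

lemma borcherds_qf:
  assumes A: "quantum_field A" and B: "quantum_field B"
  shows "quantum_field (borcherds A B l m)"
proof -
  have "\<exists>N. \<forall>n\<ge>N. borcherds A B l m n w = 0" for w
  proof -
    obtain N1 where N1: "\<forall>n\<ge>N1. B n w = 0" using qf_trunc[OF B] by blast
    obtain I where I: "\<forall>n\<ge>I. A n w = 0" using qf_trunc[OF A] by blast
    define J where "J = nat (I - m)"
    have "\<exists>M. \<forall>i<J'. \<forall>n\<ge>M. B n (A (m + int i) w) = 0" for J'
    proof (induction J')
      case 0 show ?case by simp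
    next
      case (Suc J')
      then obtain M where M: "\<forall>i<J'. \<forall>n\<ge>M. B n (A (m + int i) w) = 0" by blast
      obtain M' where "\<forall>n\<ge>M'. B n (A (m + int J') w) = 0" using qf_trunc[OF B] by blast
      with M show ?case by (intro exI[of _ "max M M'"]) (auto simp: less_Suc_eq)
    qed
    then obtain M where M: "\<forall>i<J. \<forall>n\<ge>M. B n (A (m + int i) w) = 0" by blast
    have "borcherds A B l m n w = 0" if n: "n \<ge> max N1 (M + int J - l)" for n
    proof -
      have "B (n + int i) w = 0" for i using N1 n by auto
      moreover have "B (n + l - int i) (A (m + int i) w) = 0" for i
      proof (cases "i < J")
        case True then show ?thesis using M n by auto
      next
        case False then have "A (m + int i) w = 0" using I by (auto simp: J_def)
        then show ?thesis by (simp add: lin_0[OF qf_lin[OF B]])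
      qed
      ultimately show ?thesis by (simp add: borcherds_def lin_0[OF qf_lin[OF A]])
    qed
    then show ?thesis by blast
  qed
  then show ?thesis using borcherds_lin[OF A B] by (simp add: quantum_field_def)
qed

definition field_prod :: "(int \<Rightarrow> 'w \<Rightarrow> 'w) \<Rightarrow> int \<Rightarrow> (int \<Rightarrow> 'w \<Rightarrow> 'w) \<Rightarrow> int \<Rightarrow> 'w \<Rightarrow> 'w" where
  "field_prod A k B = borcherds A B k 0"

lemma field_prod_qf: "quantum_field A \<Longrightarrow> quantum_field B \<Longrightarrow> quantum_field (field_prod A k B)"
  unfolding field_prod_def by (rule borcherds_qf)

section \<open>Dong's lemma\<close>

text \<open>
  A family of vectors indexed by \<open>m, n, p\<close> stands for the formal series whose residue against
  \<open>x\<^sup>m y\<^sup>n z\<^sup>p\<close> it lists. The difference operators are multiplication by \<open>x - y\<close> (for two indices), by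
  \<open>x - z\<close> and by \<open>y - z\<close>.
\<close>

definition shift_diff :: "(int \<Rightarrow> int \<Rightarrow> 'w) \<Rightarrow> int \<Rightarrow> int \<Rightarrow> 'w" where
  "shift_diff f = (\<lambda>m n. f (m + 1) n - f m (n + 1))"

definition shift_diff13 :: "(int \<Rightarrow> int \<Rightarrow> int \<Rightarrow> 'w) \<Rightarrow> int \<Rightarrow> int \<Rightarrow> int \<Rightarrow> 'w" where
  "shift_diff13 f = (\<lambda>m n p. f (m + 1) n p - f m n (p + 1))"

definition shift_diff23 :: "(int \<Rightarrow> int \<Rightarrow> int \<Rightarrow> 'w) \<Rightarrow> int \<Rightarrow> int \<Rightarrow> int \<Rightarrow> 'w" where
  "shift_diff23 f = (\<lambda>m n p. f m (n + 1) p - f m n (p + 1))"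

lemma shift_diff_comm: "shift_diff13 (shift_diff23 f) = shift_diff23 (shift_diff13 f)"
  by (simp add: shift_diff13_def shift_diff23_def algebra_simps)

lemma shift_diff_pow_comm1: "(shift_diff13 ^^ s) (shift_diff23 f) = shift_diff23 ((shift_diff13 ^^ s) f)"
  by (induction s) (simp_all add: shift_diff_comm)

lemma shift_diff_pow_comm: "(shift_diff13 ^^ s) ((shift_diff23 ^^ t) f) = (shift_diff23 ^^ t) ((shift_diff13 ^^ s) f)"
  by (induction t) (simp_all add: shift_diff_pow_comm1)

lemma shift_diff13_pow_diff:
  "(shift_diff13 ^^ s) (\<lambda>m n p. f m n p - g m n p) = (\<lambda>m n p. (shift_diff13 ^^ s) f m n p - (shift_diff13 ^^ s) g m n p)"
  by (induction s) (simp_all add: shift_diff13_def algebra_simps)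

lemma shift_diff23_pow_diff:
  "(shift_diff23 ^^ s) (\<lambda>m n p. f m n p - g m n p) = (\<lambda>m n p. (shift_diff23 ^^ s) f m n p - (shift_diff23 ^^ s) g m n p)"
  by (induction s) (simp_all add: shift_diff23_def algebra_simps)

lemma shift_diff13_pow_add:
  "(shift_diff13 ^^ s) (\<lambda>m n p. f m n p + g m n p) = (\<lambda>m n p. (shift_diff13 ^^ s) f m n p + (shift_diff13 ^^ s) g m n p)"
  by (induction s) (simp_all add: shift_diff13_def algebra_simps)

lemma shift_diff23_pow_add:
  "(shift_diff23 ^^ s) (\<lambda>m n p. f m n p + g m n p) = (\<lambda>m n p. (shift_diff23 ^^ s) f m n p + (shift_diff23 ^^ s) g m n p)"
  by (induction s) (simp_all add: shift_diff23_def algebra_simps)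

lemma shift_diff13_pow_scale:
  "(shift_diff13 ^^ s) (\<lambda>m n p. c *s f m n p) = (\<lambda>m n p. c *s (shift_diff13 ^^ s) f m n p)"
  by (induction s) (simp_all add: shift_diff13_def scale_right_diff_distrib)

lemma shift_diff23_pow_scale:
  "(shift_diff23 ^^ s) (\<lambda>m n p. c *s f m n p) = (\<lambda>m n p. c *s (shift_diff23 ^^ s) f m n p)"
  by (induction s) (simp_all add: shift_diff23_def scale_right_diff_distrib)

lemma shift_diff13_pow_zero: "(shift_diff13 ^^ s) (\<lambda>m n p. 0) = (\<lambda>m n p. 0)"
  by (induction s) (simp_all add: shift_diff13_def)

lemma shift_diff23_pow_zero: "(shift_diff23 ^^ s) (\<lambda>m n p. 0) = (\<lambda>m n p. 0)"
  by (induction s) (simp_all add: shift_diff23_def)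

lemma shift_diff23_pow_slice: "(shift_diff23 ^^ s) f m = (shift_diff ^^ s) (f m)"
  by (induction s) (simp_all add: shift_diff23_def shift_diff_def)

definition swap12 :: "(int \<Rightarrow> int \<Rightarrow> int \<Rightarrow> 'w) \<Rightarrow> int \<Rightarrow> int \<Rightarrow> int \<Rightarrow> 'w" where
  "swap12 f = (\<lambda>m n p. f n m p)"

lemma shift_diff13_pow_swap: "(shift_diff13 ^^ s) (swap12 f) = swap12 ((shift_diff23 ^^ s) f)"
  by (induction s) (simp_all add: swap12_def shift_diff13_def shift_diff23_def)

lemma shift_diff23_pow_swap: "(shift_diff23 ^^ s) (swap12 f) = swap12 ((shift_diff13 ^^ s) f)"
  by (induction s) (simp_all add: swap12_def shift_diff13_def shift_diff23_def)

text \<open>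
  The series is bounded in \<open>y\<close> for each power of \<open>z\<close>. This makes multiplication by the power
  \<open>(x - y)\<^sup>l\<close>, expanded for \<open>\<bar>x\<bar> > \<bar>y\<bar>\<close>, well defined also for negative \<open>l\<close>.
\<close>

definition bounded_second :: "(int \<Rightarrow> int \<Rightarrow> int \<Rightarrow> 'w) \<Rightarrow> bool" where
  "bounded_second f \<longleftrightarrow> (\<forall>p. \<exists>I. \<forall>n\<ge>I. \<forall>m. f m n p = 0)"

definition times_power :: "int \<Rightarrow> (int \<Rightarrow> int \<Rightarrow> int \<Rightarrow> 'w) \<Rightarrow> int \<Rightarrow> int \<Rightarrow> int \<Rightarrow> 'w" where
  "times_power l f = (\<lambda>m n p. binsum l (\<lambda>i. (-1) ^ i *s f (m + l - int i) (n + int i) p))"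

lemma bounded_second_evzero:
  assumes "bounded_second f"
  shows "evzero (\<lambda>i. (-1) ^ i *s f (k - int i) (n + int i) p)"
proof -
  obtain I where "\<forall>n\<ge>I. \<forall>m. f m n p = 0" using assms unfolding bounded_second_def by blast
  then have "\<forall>i\<ge>nat (I - n). (-1) ^ i *s f (k - int i) (n + int i) p = 0" by auto
  then show ?thesis by (auto simp: evzero_def)
qed

lemma bounded_second_shift_diff13: assumes "bounded_second f" shows "bounded_second (shift_diff13 f)"
  unfolding bounded_second_def
proof
  fix p
  obtain I J where "\<forall>n\<ge>I. \<forall>m. f m n p = 0" "\<forall>n\<ge>J. \<forall>m. f m n (p+1) = 0"
    using assms unfolding bounded_second_def by metis
  then show "\<exists>I. \<forall>n\<ge>I. \<forall>m. shift_diff13 f m n p = 0"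
    by (intro exI[of _ "max I J"]) (auto simp: shift_diff13_def)
qed

lemma bounded_second_shift_diff23: assumes "bounded_second f" shows "bounded_second (shift_diff23 f)"
  unfolding bounded_second_def
proof
  fix p
  obtain I J where "\<forall>n\<ge>I. \<forall>m. f m n p = 0" "\<forall>n\<ge>J. \<forall>m. f m n (p+1) = 0"
    using assms unfolding bounded_second_def by metis
  then show "\<exists>I. \<forall>n\<ge>I. \<forall>m. shift_diff23 f m n p = 0"
    by (intro exI[of _ "max I J"]) (auto simp: shift_diff23_def)
qed

lemma times_power_shift_diff13: assumes "bounded_second f" shows "shift_diff13 (times_power l f) = times_power l (shift_diff13 f)"
  using bounded_second_evzero[OF assms]
  by (simp add: shift_diff13_def times_power_def scale_right_diff_distrib binsum_diff algebra_simps fun_eq_iff)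

lemma times_power_shift_diff23: assumes "bounded_second f" shows "shift_diff23 (times_power l f) = times_power l (shift_diff23 f)"
proof (intro ext)
  fix m n p
  from binsum_diff[OF bounded_second_evzero[OF assms, of "m + l" "n + 1" p] bounded_second_evzero[OF assms, of "m + l" n "p + 1"]]
  show "shift_diff23 (times_power l f) m n p = times_power l (shift_diff23 f) m n p"
    by (simp add: shift_diff23_def times_power_def scale_right_diff_distrib add_ac)
qed

lemma times_power_shift_diff13_pow: "bounded_second f \<Longrightarrow> (shift_diff13 ^^ s) (times_power l f) = times_power l ((shift_diff13 ^^ s) f) \<and> bounded_second ((shift_diff13 ^^ s) f)"
  by (induction s) (auto simp: times_power_shift_diff13 bounded_second_shift_diff13)

lemma times_power_shift_diff23_pow: "bounded_second f \<Longrightarrow> (shift_diff23 ^^ s) (times_power l f) = times_power l ((shift_diff23 ^^ s) f) \<and> bounded_second ((shift_diff23 ^^ s) f)"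
  by (induction s) (auto simp: times_power_shift_diff23 bounded_second_shift_diff23)

lemma times_power_zero: "times_power l (\<lambda>m n p. 0) = (\<lambda>m n p. 0)"
  by (simp add: times_power_def)

text \<open>
  The coefficients of \<open>[A(x) B(y), C(z)] w\<close>.
\<close>

definition comm_with where
  "comm_with A B C w = (\<lambda>m n p :: int. A m (B n (C p w)) - C p (A m (B n w)) :: 'w)"

lemma comm_with_bounded_second:
  assumes A: "quantum_field A" and B: "quantum_field B" and C: "quantum_field C"
  shows "bounded_second (comm_with A B C w)"
  unfolding bounded_second_def
proof
  fix p
  obtain I J where "\<forall>n\<ge>I. B n (C p w) = 0" "\<forall>n\<ge>J. B n w = 0"
    using qf_trunc[OF B] by metis
  then show "\<exists>I. \<forall>n\<ge>I. \<forall>m. comm_with A B C w m n p = 0"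
    by (intro exI[of _ "max I J"]) (auto simp: comm_with_def lin_0[OF qf_lin[OF A]] lin_0[OF qf_lin[OF C]])
qed

text \<open>
  Write \<open>[A B, C] = A [B, C] + [A, C] B\<close>. A power of \<open>y - z\<close> kills the first term, and a power of \<open>x - z\<close>
  kills the second.
\<close>

lemma comm_with_killed:
  assumes A: "quantum_field A" and B: "quantum_field B" and C: "quantum_field C"
    and AC: "\<And>m n w. borcherds A C (int N) m n w = 0" and BC: "\<And>m n w. borcherds B C (int N) m n w = 0"
  shows "(shift_diff13 ^^ N) ((shift_diff23 ^^ N) (comm_with A B C w)) = (\<lambda>m n p. 0)"
proof -
  define u1 where "u1 k = (\<lambda>m n p. A m (borcherds B C (int k) n p w))" for k
  define u2 where "u2 k = (\<lambda>m n p. borcherds A C (int k) m p (B n w))" for k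
  have d: "comm_with A B C w = (\<lambda>m n p. u1 0 m n p + u2 0 m n p)"
    by (simp add: comm_with_def u1_def u2_def borcherds_0 lin_diff[OF qf_lin[OF A]])
  have 1: "(shift_diff23 ^^ k) (u1 0) = u1 k" for k
  proof (induction k)
    case (Suc k) then show ?case
      by (simp add: shift_diff23_def u1_def lin_diff[OF qf_lin[OF A]] borcherds_rec[OF B C, of "int k", unfolded add.commute[of _ 1]] add.commute)
  qed simp
  have 2: "(shift_diff13 ^^ k) (u2 0) = u2 k" for k
    by (induction k)
       (simp_all add: shift_diff13_def u2_def borcherds_rec[OF A C, of "int _", symmetric] add_ac)
  have z1: "u1 N = (\<lambda>m n p. 0)" by (simp add: u1_def BC lin_0[OF qf_lin[OF A]])
  have z2: "u2 N = (\<lambda>m n p. 0)" by (simp add: u2_def AC)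
  have "(shift_diff13 ^^ N) ((shift_diff23 ^^ N) (comm_with A B C w)) =
     (\<lambda>m n p. (shift_diff13 ^^ N) ((shift_diff23 ^^ N) (u1 0)) m n p + (shift_diff23 ^^ N) ((shift_diff13 ^^ N) (u2 0)) m n p)"
    by (simp add: d shift_diff23_pow_add shift_diff13_pow_add shift_diff_pow_comm)
  also have "\<dots> = (\<lambda>m n p. 0)" by (simp add: 1 2 z1 z2 shift_diff13_pow_zero shift_diff23_pow_zero)
  finally show ?thesis .
qed

lemma borcherds_pow:
  assumes A: "quantum_field A" and B: "quantum_field B"
  shows "(shift_diff ^^ k) (\<lambda>m n. borcherds A B 0 m n w) = (\<lambda>m n. borcherds A B (int k) m n w)"
  by (induction k) (simp_all add: shift_diff_def borcherds_rec[OF A B, of "int _", symmetric] add_ac)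

text \<open>
  Let \<open>E\<^sub>l\<close> be the series \<open>[(x - y)\<^sup>l A(x) B(y) - (x - y)\<^sup>l B(y) A(x), C(z)]\<close>, with the two expansions of
  \<open>(x - y)\<^sup>l\<close>. It vanishes for \<open>l \<ge> N\<close> by locality of \<open>A\<close> and \<open>B\<close>, and for every \<open>l\<close> it is killed by
  \<open>(x - z)\<^sup>N (y - z)\<^sup>N\<close> by locality with \<open>C\<close>. Now \<open>y - z = (x - z) - (x - y)\<close>, so a large power of \<open>y - z\<close>
  expands into terms each of which contains enough factors \<open>x - z\<close> or enough factors \<open>x - y\<close>. Hence a
  power of \<open>y - z\<close> alone kills \<open>E\<^sub>k\<close>, in particular its residue in \<open>x\<close>, which is the commutator of the
  \<open>k\<close>-th product with \<open>C\<close>.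
\<close>

theorem Dong:
  assumes A: "quantum_field A" and B: "quantum_field B" and C: "quantum_field C"
    and loc: "mutually_local A B" "mutually_local A C" "mutually_local B C"
  shows "mutually_local (field_prod A k B) C"
proof -
  obtain N where AB: "\<And>m n w. borcherds A B (int N) m n w = 0" and AC: "\<And>m n w. borcherds A C (int N) m n w = 0"
    and BC: "\<And>m n w. borcherds B C (int N) m n w = 0"
    using mutually_local_common[OF A B C loc] by blast
  define E where "E w l = (\<lambda>m n p. borcherds A B l m n (C p w) - C p (borcherds A B l m n w))" for w l
  have E_rec: "shift_diff23 (E w l) = (\<lambda>m n p. shift_diff13 (E w l) m n p - E w (l + 1) m n p)" for w l
    unfolding shift_diff23_def shift_diff13_def E_def borcherds_rec[OF A B] lin_diff[OF qf_lin[OF C]]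
    by (simp add: algebra_simps)
  have E_large: "E w l = (\<lambda>m n p. 0)" if "l \<ge> int N" for w l
    using borcherds_ge[OF A B _ that] AB by (simp add: E_def lin_0[OF qf_lin[OF C]])
  have E_split: "E w l = (\<lambda>m n p. times_power l (comm_with A B C w) m n p
      - ((-1) powi l) *s swap12 (times_power l (comm_with B A C w)) m n p)" for w l
  proof -
    have sc: "C p (c *s x) = c *s C p x" for p c x by (rule lin_scale[OF qf_lin[OF C]])
    have *: "C p (binsum l (\<lambda>i. (-1) ^ i *s A (m + l - int i) (B (n + int i) w)))
       = binsum l (\<lambda>i. (-1) ^ i *s C p (A (m + l - int i) (B (n + int i) w)))" 
      if "quantum_field A" "quantum_field B" for A B m n p
      by (subst binsum_lin[OF qf_lin[OF C] borcherds_evzero[OF that]]) (simp add: sc)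
    have e: "evzero (\<lambda>i. (-1) ^ i *s C p (A (m + l - int i) (B (n + int i) w)))"
      if "quantum_field A" "quantum_field B" for A B m n p
      by (rule qf_evzero[OF that(2), of "\<lambda>i x. (-1) ^ i *s C p (A (m + l - int i) x)"])
         (rule lin_compose[OF lin_scale_op lin_compose[OF qf_lin[OF C] qf_lin[OF that(1)]]])
    show ?thesis
      by (simp add: E_def times_power_def comm_with_def swap12_def borcherds_def lin_diff[OF qf_lin[OF C]] sc
          *[OF A B] *[OF B A] scale_right_diff_distrib binsum_diff[OF borcherds_evzero e] A B fun_eq_iff)
  qed
  have killed: "(shift_diff13 ^^ N) ((shift_diff23 ^^ N) (E w l)) = (\<lambda>m n p. 0)" for w l
  proof -
    have r: "(shift_diff13 ^^ N) ((shift_diff23 ^^ N) (times_power l (comm_with A B C w))) = (\<lambda>m n p. 0)"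
      using times_power_shift_diff13_pow times_power_shift_diff23_pow comm_with_bounded_second[OF A B C] comm_with_killed[OF A B C AC BC]
      by (metis times_power_zero)
    have "(shift_diff23 ^^ N) ((shift_diff13 ^^ N) (times_power l (comm_with B A C w))) = (\<lambda>m n p. 0)"
      using times_power_shift_diff13_pow times_power_shift_diff23_pow comm_with_bounded_second[OF B A C] comm_with_killed[OF B A C BC AC]
      by (metis times_power_zero shift_diff_pow_comm)
    then have s: "(shift_diff13 ^^ N) ((shift_diff23 ^^ N) (swap12 (times_power l (comm_with B A C w)))) = (\<lambda>m n p. 0)"
      by (simp add: shift_diff13_pow_swap shift_diff23_pow_swap) (simp add: swap12_def)
    show ?thesis
      by (simp add: E_split shift_diff23_pow_diff shift_diff13_pow_diff shift_diff23_pow_scale shift_diff13_pow_scale r s)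
  qed
  (* Each of the t extra factors y - z either adds a factor x - z (s grows) or a factor x - y
    (l grows). Once t is used up, s + l is at least 2 N, so that s or l is at least N. *)
  have main: "(shift_diff23 ^^ (t + N)) ((shift_diff13 ^^ s) (E w l)) = (\<lambda>m n p. 0)"
    if "int t + int s + l \<ge> 2 * int N" for t s l w
    using that
  proof (induction t arbitrary: s l)
    case 0
    show ?case
    proof (cases "l \<ge> int N")
      case True then show ?thesis by (simp add: E_large shift_diff13_pow_zero shift_diff23_pow_zero)
    next
      case False
      with 0 have "s = (s - N) + N" by simp
      then obtain s' where "s = s' + N" by blast
      then have "(shift_diff23 ^^ N) ((shift_diff13 ^^ s) (E w l)) = (shift_diff13 ^^ s') ((shift_diff13 ^^ N) ((shift_diff23 ^^ N) (E w l)))"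
        by (simp add: funpow_add shift_diff_pow_comm)
      then show ?thesis by (simp add: killed shift_diff13_pow_zero)
    qed
  next
    case (Suc t)
    have "(shift_diff23 ^^ (Suc t + N)) ((shift_diff13 ^^ s) (E w l)) = (shift_diff23 ^^ (t + N)) ((shift_diff13 ^^ s) (shift_diff23 (E w l)))"
      by (simp add: funpow_swap1 shift_diff_pow_comm1)
    also have "\<dots> = (\<lambda>m n p. (shift_diff23 ^^ (t + N)) ((shift_diff13 ^^ Suc s) (E w l)) m n p
       - (shift_diff23 ^^ (t + N)) ((shift_diff13 ^^ s) (E w (l+1))) m n p)"
      by (simp only: E_rec shift_diff13_pow_diff shift_diff23_pow_diff funpow_Suc_right o_apply)
    also have "\<dots> = (\<lambda>m n p. 0)" using Suc.IH[of "Suc s" l] Suc.IH[of s "l+1"] Suc.prems by simp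
    finally show ?case .
  qed
  define M where "M = nat (2 * int N - k) + N"
  have "borcherds (field_prod A k B) C (int M) n p w = 0" for n p w
  proof -
    have "(\<lambda>n p. borcherds (field_prod A k B) C 0 n p w) = E w k 0"
      by (simp add: borcherds_0 E_def field_prod_def fun_eq_iff)
    then have "borcherds (field_prod A k B) C (int M) n p w = (shift_diff ^^ M) (E w k 0) n p"
      using borcherds_pow[OF field_prod_qf[OF A B] C] by metis
    also have "\<dots> = (shift_diff23 ^^ M) (E w k) 0 n p" by (simp add: shift_diff23_pow_slice)
    also have "\<dots> = 0" using main[of "nat (2 * int N - k)" 0 k w] by (simp add: M_def)
    finally show ?thesis .
  qed
  then show ?thesis by (auto simp: mutually_local_def)
qed

section \<open>Vertex algebras generated by local fields\<close>

definition translation_covariant :: "('w \<Rightarrow> 'w) \<Rightarrow> (int \<Rightarrow> 'w \<Rightarrow> 'w) \<Rightarrow> bool" where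
  "translation_covariant D A \<longleftrightarrow> (\<forall>n w. D (A n w) - A n (D w) = (- of_int n) *s A (n - 1) w)"

lemma translation_covariant_eq:
  "translation_covariant D A \<Longrightarrow> D (A n w) = A n (D w) - of_int n *s A (n - 1) w"
  by (simp add: translation_covariant_def diff_eq_eq)

text \<open>
  The coefficients \<open>(x - y)\<^sup>k\<close> are killed by \<open>d/dx + d/dy\<close>. Coefficientwise: the derivation produces the
  terms \<open>(k - i) g (i + 1) - i g i\<close>, and their binomial sum vanishes by \<open>binsum_absorb\<close>.
\<close>

lemma field_prod_translation_covariant:
  assumes D: "lin D" and A: "quantum_field A" "translation_covariant D A"
    and B: "quantum_field B" "translation_covariant D B"
  shows "translation_covariant D (field_prod A k B)"
proof -
  have Dsum: "D (binsum k (\<lambda>i. (-1) ^ i *s A (p - int i) (B (n + int i) w)))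
     = binsum k (\<lambda>i. (-1) ^ i *s D (A (p - int i) (B (n + int i) w)))"
    if "quantum_field A" "quantum_field B" for A B p n w
    by (subst binsum_lin[OF D borcherds_evzero[OF that]]) (simp add: lin_scale[OF D])
  have comm: "D (A p (B q w)) = A p (B q (D w)) - of_int p *s A (p - 1) (B q w) - of_int q *s A p (B (q - 1) w)"
    if "quantum_field A" "translation_covariant D A" "translation_covariant D B" for A B p q w
    by (simp add: translation_covariant_eq[OF that(2)] translation_covariant_eq[OF that(3)]
        lin_diff[OF qf_lin[OF that(1)]] lin_scale[OF qf_lin[OF that(1)]])
  show ?thesis
    unfolding translation_covariant_def field_prod_def
  proof (intro allI)
    fix n w
    define g where "g i = (-1) ^ i *s A (k - int i) (B (n - 1 + int i) w)" for i
    define h where "h i = (-1) ^ i *s B (n + k - 1 - int i) (A (int i) w)" for i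
    define h' where "h' i = (-1) ^ i *s B (n + k - int i) (A (-1 + int i) w)" for i
    have eg: "evzero g" and eh': "evzero h'" and eh: "evzero h"
      unfolding g_def h'_def h_def using borcherds_evzero[OF A(1) B(1)]
        borcherds_evzero[OF B(1) A(1), of "n + k" "-1"]
        borcherds_evzero[OF B(1) A(1), of "n + k - 1" 0] by simp_all
    have evm: "evzero (\<lambda>i. f i *s x i)" if "evzero x" for f and x :: "nat \<Rightarrow> 'w"
      using that by (auto simp: evzero_def)
    have 1: "(-1) ^ i *s D (A (k - int i) (B (n + int i) w)) =
       (-1) ^ i *s A (k - int i) (B (n + int i) (D w)) + ((of_int k - of_nat i) *s g (Suc i) - of_nat i *s g i)
        - of_int n *s g i" for i
    proof -
      have "k - int (Suc i) = k - int i - 1" "n - 1 + int (Suc i) = n + int i" "n - 1 + int i = n + int i - 1" by auto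
      then show ?thesis
        unfolding g_def comm[OF A B(2)] by (simp add: scale_right_diff_distrib scale_left_distrib scale_left_diff_distrib algebra_simps)
    qed
    have 2: "(-1) ^ i *s D (B (n + k - int i) (A (int i) w)) =
       (-1) ^ i *s B (n + k - int i) (A (int i) (D w)) + ((of_int k - of_nat i) *s h' (Suc i) - of_nat i *s h' i)
        - of_int n *s h i" for i
    proof -
      have "n + k - int (Suc i) = n + k - int i - 1" "-1 + int (Suc i) = int i" "-1 + int i = int i - 1"
        "n + k - 1 - int i = n + k - int i - 1" by auto
      then show ?thesis
        unfolding h_def h'_def comm[OF B A(2)] by (simp add: scale_right_diff_distrib scale_left_distrib scale_left_diff_distrib algebra_simps)
    qed
    have s1: "D (binsum k (\<lambda>i. (-1) ^ i *s A (k - int i) (B (n + int i) w)))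
       = binsum k (\<lambda>i. (-1) ^ i *s A (k - int i) (B (n + int i) (D w))) - of_int n *s binsum k g"
      unfolding Dsum[OF A(1) B(1)] 1
      using binsum_absorb[OF eg, of k]
      by (simp add: binsum_diff binsum_add binsum_scale evzero_Suc eg evm borcherds_evzero A B evzero_add evzero_diff)
    have s2: "D (binsum k (\<lambda>i. (-1) ^ i *s B (n + k - int i) (A (int i) w)))
       = binsum k (\<lambda>i. (-1) ^ i *s B (n + k - int i) (A (int i) (D w))) - of_int n *s binsum k h"
      unfolding Dsum[OF B(1) A(1), of "n + k" 0, unfolded add_0] 2
      using binsum_absorb[OF eh', of k] borcherds_evzero[OF B(1) A(1), of "n + k" 0 "D w"]
      by (simp add: binsum_diff binsum_add binsum_scale evzero_Suc eh eh' evm evzero_add evzero_diff)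
    have "D (borcherds A B k 0 n w) = borcherds A B k 0 n (D w) - of_int n *s borcherds A B k 0 (n - 1) w"
    proof -
      have b: "borcherds A B k 0 n w = binsum k (\<lambda>i. (-1) ^ i *s A (k - int i) (B (n + int i) w))
         - (-1) powi k *s binsum k (\<lambda>i. (-1) ^ i *s B (n + k - int i) (A (int i) w))" for n w
        by (simp add: borcherds_def)
      have b': "borcherds A B k 0 (n - 1) w = binsum k g - (-1) powi k *s binsum k h"
        by (simp add: borcherds_def g_def[abs_def] h_def[abs_def] algebra_simps)
      show ?thesis
        unfolding b' unfolding b lin_diff[OF D] lin_scale[OF D] s1 s2
        by (simp add: scale_right_diff_distrib mult.commute)
    qed
    then show "D (borcherds A B k 0 n w) - borcherds A B k 0 n (D w) = (- of_int n) *s borcherds A B k 0 (n - 1) w"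
      by simp
  qed
qed

lemma borcherds_add_left:
  assumes "quantum_field A" "quantum_field B" "quantum_field C"
  shows "borcherds (\<lambda>n w. A n w + B n w) C l m n w = borcherds A C l m n w + borcherds B C l m n w"
  by (simp add: borcherds_def scale_right_distrib lin_add[OF qf_lin[OF assms(3)]] binsum_add borcherds_evzero assms)

lemma borcherds_scale_left:
  assumes "quantum_field A" "quantum_field C"
  shows "borcherds (\<lambda>n w. c *s A n w) C l m n w = c *s borcherds A C l m n w"
proof -
  have *: "(-1) ^ i *s c *s z = c *s (-1) ^ i *s z" for i :: nat and z
    by (simp add: mult.commute)
  show ?thesis
    unfolding borcherds_def lin_scale[OF qf_lin[OF assms(2)]] *
    by (simp only: binsum_scale borcherds_evzero assms scale_right_diff_distrib scale_left_commute[of "(-1) powi l" c])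
qed

definition id_field :: "int \<Rightarrow> 'w \<Rightarrow> 'w" where
  "id_field = (\<lambda>n w. if n = -1 then w else 0)"

lemma binsum_mem:
  assumes "subspace S" "\<And>i. g i \<in> S"
  shows "binsum m g \<in> S"
  unfolding binsum_def Sum_any.expand_set
  by (intro subspace_sum subspace_scale assms)

end

locale generating_fields = complex_space scale
  for scale :: "complex \<Rightarrow> 'w::ab_group_add \<Rightarrow> 'w"  (infixr \<open>*s\<close> 75) +
  fixes G :: "(int \<Rightarrow> 'w \<Rightarrow> 'w) set" and \<Omega> :: 'w and D :: "'w \<Rightarrow> 'w"
  assumes G_field: "A \<in> G \<Longrightarrow> quantum_field A"
    and G_local: "A \<in> G \<Longrightarrow> B \<in> G \<Longrightarrow> mutually_local A B"
    and G_cov: "A \<in> G \<Longrightarrow> translation_covariant D A"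
    and G_vac: "A \<in> G \<Longrightarrow> n \<ge> 0 \<Longrightarrow> A n \<Omega> = 0"
    and D_lin: "lin D" and D_vac: "D \<Omega> = 0"
begin

text \<open>
  In a product only the right factor may be an arbitrary generated field. Locality can then be proved
  by induction on this factor, and the generated fields still create every vector that is reached from
  \<open>\<Omega>\<close> by modes of generators.
\<close>

inductive generated :: "(int \<Rightarrow> 'w \<Rightarrow> 'w) \<Rightarrow> bool" where
  generated_id: "generated id_field"
| generated_prod: "A \<in> G \<Longrightarrow> generated B \<Longrightarrow> generated (field_prod A k B)"
| generated_add: "generated A \<Longrightarrow> generated B \<Longrightarrow> generated (\<lambda>n w. A n w + B n w)"
| generated_scale: "generated A \<Longrightarrow> generated (\<lambda>n w. c *s A n w)"

definition creative :: "(int \<Rightarrow> 'w \<Rightarrow> 'w) \<Rightarrow> bool" where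
  "creative A \<longleftrightarrow> quantum_field A \<and> translation_covariant D A \<and> (\<forall>n\<ge>0. A n \<Omega> = 0)"

lemma G_creative: "A \<in> G \<Longrightarrow> creative A"
  by (simp add: creative_def G_field G_cov G_vac)

lemma field_prod_creative:
  assumes "creative A" "creative B"
  shows "creative (field_prod A k B)"
proof -
  have "field_prod A k B n \<Omega> = 0" if "n \<ge> 0" for n
    using assms that by (simp add: creative_def field_prod_def borcherds_def lin_0 qf_lin)
  then show ?thesis using assms field_prod_qf field_prod_translation_covariant D_lin by (simp add: creative_def)
qed

lemma field_prod_state:
  assumes "creative A" "creative B"
  shows "field_prod A k B (-1) \<Omega> = A k (B (-1) \<Omega>)"
proof -
  have q: "quantum_field A" "quantum_field B" using assms by (auto simp: creative_def)
  have "binsum k (\<lambda>i. (-1) ^ i *s A (k - int i) (B (-1 + int i) \<Omega>)) = A k (B (-1) \<Omega>)"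
    by (subst binsum_eq_sum[of 1]) (use assms in \<open>auto simp: creative_def lin_0 qf_lin\<close>)
  then show ?thesis using assms by (simp add: field_prod_def borcherds_def creative_def lin_0[OF qf_lin[OF q(2)]])
qed

lemma generated_creative: "generated A \<Longrightarrow> creative A"
proof (induction rule: generated.induct)
  case generated_id
  have "translation_covariant D id_field"
    using lin_0[OF D_lin] by (auto simp: translation_covariant_def id_field_def)
  moreover have "\<exists>N. \<forall>n\<ge>N. id_field n w = 0" for w
    by (rule exI[of _ 0]) (simp add: id_field_def)
  ultimately show ?case
    by (simp add: creative_def quantum_field_def lin_def) (simp add: id_field_def)
next
  case (generated_prod A B k)
  then show ?case by (simp add: field_prod_creative G_creative)
next
  case (generated_add A B)
  have "\<exists>N. \<forall>n\<ge>N. A n w + B n w = 0" for w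
  proof -
    obtain N M where "\<forall>n\<ge>N. A n w = 0" "\<forall>n\<ge>M. B n w = 0"
      using generated_add unfolding creative_def quantum_field_def by metis
    then show ?thesis by (intro exI[of _ "max N M"]) simp
  qed
  moreover have "translation_covariant D (\<lambda>n w. A n w + B n w)"
    unfolding translation_covariant_def
  proof (intro allI)
    fix n w
    have "D (A n w + B n w) - (A n (D w) + B n (D w)) = (D (A n w) - A n (D w)) + (D (B n w) - B n (D w))"
      by (simp add: lin_add[OF D_lin])
    also have "\<dots> = (- of_int n) *s (A (n - 1) w + B (n - 1) w)"
      using generated_add unfolding creative_def translation_covariant_def by (simp only: scale_right_distrib)
    finally show "D (A n w + B n w) - (A n (D w) + B n (D w)) = (- of_int n) *s (A (n - 1) w + B (n - 1) w)" .
  qed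
  ultimately show ?case using generated_add
    by (simp add: creative_def quantum_field_def lin_def scale_right_distrib add_ac)
next
  case (generated_scale A c)
  have "translation_covariant D (\<lambda>n w. c *s A n w)"
    unfolding translation_covariant_def
  proof (intro allI)
    fix n w
    have "D (c *s A n w) - c *s A n (D w) = c *s (D (A n w) - A n (D w))"
      by (simp add: lin_scale[OF D_lin] scale_right_diff_distrib)
    also have "\<dots> = (- of_int n) *s c *s A (n - 1) w"
      using generated_scale unfolding creative_def translation_covariant_def by (simp only: scale_left_commute)
    finally show "D (c *s A n w) - c *s A n (D w) = (- of_int n) *s c *s A (n - 1) w" .
  qed
  moreover have "\<exists>N. \<forall>n\<ge>N. c *s A n w = 0" for w
    using generated_scale unfolding creative_def quantum_field_def by (metis scale_zero_right)
  ultimately show ?case using generated_scale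
    by (simp add: creative_def quantum_field_def lin_def scale_right_distrib mult.commute)
qed

lemma creative_qf: "creative A \<Longrightarrow> quantum_field A"
  by (simp add: creative_def)

lemmas generated_qf = creative_qf[OF generated_creative]

text \<open>
  The set \<open>\<C>\<close> is first taken to be \<open>G\<close> and then \<open>G\<close> together with all generated fields. It contains \<open>G\<close>
  because Dong's lemma for the product \<open>A\<^sub>k B\<close> and \<open>C\<close> also asks that \<open>A\<close> and \<open>B\<close> be local to each other;
  the induction hypothesis for \<open>C = A\<close> supplies this.
\<close>

lemma generated_local_aux:
  assumes "G \<subseteq> \<C>" "\<And>C. C \<in> \<C> \<Longrightarrow> quantum_field C"
    and GC: "\<And>A C. A \<in> G \<Longrightarrow> C \<in> \<C> \<Longrightarrow> mutually_local A C"
    and B: "generated B"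
  shows "C \<in> \<C> \<Longrightarrow> mutually_local B C"
  using B
proof (induction arbitrary: C rule: generated.induct)
  case generated_id
  then show ?case
    unfolding mutually_local_def
    by (intro exI[of _ 0]) (simp add: borcherds_0 id_field_def lin_0[OF qf_lin] assms(2))
next
  case (generated_prod A B k)
  have "mutually_local A B"
    using generated_prod assms(1) by (blast intro: mutually_local_sym[OF generated_qf G_field])
  then show ?case
    by (rule Dong[OF G_field[OF generated_prod(1)] generated_qf[OF generated_prod(2)] assms(2)[OF generated_prod.prems] _
        GC[OF generated_prod(1) generated_prod.prems] generated_prod.IH[OF generated_prod.prems]])
next
  case (generated_add A B)
  note C = assms(2)[OF generated_add.prems]
  obtain N M where "\<forall>m n w. borcherds A C (int N) m n w = 0" "\<forall>m n w. borcherds B C (int M) m n w = 0"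
    using generated_add unfolding mutually_local_def by metis
  then have "borcherds A C (int (max N M)) m n w = 0 \<and> borcherds B C (int (max N M)) m n w = 0" for m n w
    using borcherds_ge[OF generated_qf[OF generated_add(1)] C, of "int N" "int (max N M)"]
      borcherds_ge[OF generated_qf[OF generated_add(2)] C, of "int M" "int (max N M)"] by auto
  then show ?case
    unfolding mutually_local_def
    by (intro exI[of _ "max N M"]) (simp add: borcherds_add_left generated_qf generated_add C)
next
  case (generated_scale A c)
  note C = assms(2)[OF generated_scale.prems]
  obtain N where "\<forall>m n w. borcherds A C (int N) m n w = 0"
    using generated_scale unfolding mutually_local_def by metis
  then show ?case
    unfolding mutually_local_def by (auto simp: borcherds_scale_left generated_qf generated_scale C)
qed

lemma G_generated_local:
  assumes "A \<in> G" "generated B" shows "mutually_local A B"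
  by (rule mutually_local_sym[OF generated_qf[OF assms(2)] G_field[OF assms(1)]
        generated_local_aux[OF order_refl G_field G_local assms(2,1)]])

lemma generated_local:
  assumes "generated A" "generated B" shows "mutually_local A B"
proof (rule generated_local_aux[of "G \<union> Collect generated"])
  show "quantum_field C" if "C \<in> G \<union> Collect generated" for C
    using that G_field generated_qf by blast
  show "mutually_local A C" if "A \<in> G" "C \<in> G \<union> Collect generated" for A C
    using that G_local G_generated_local by blast
qed (use assms in auto)

text \<open>
  Covariance determines \<open>P(z)\<Omega>\<close> by its constant term, since \<open>D\<close> applied to one coefficient is a nonzero
  multiple of the next. Thus \<open>P(z)\<Omega> = Q(z)\<Omega>\<close>. By locality
  \<open>(x - y)\<^sup>K P(x) B(y)\<Omega> = (x - y)\<^sup>K B(y) P(x)\<Omega>\<close>, and the same holds for \<open>Q\<close>, so the left sides agree; as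
  \<open>B(y)\<Omega>\<close> has no negative powers of \<open>y\<close>, setting \<open>y = 0\<close> gives \<open>x\<^sup>K P(x) b = x\<^sup>K Q(x) b\<close> for
  \<open>b = B (-1) \<Omega>\<close>.
\<close>

theorem Goddard_uniqueness:
  assumes P: "creative P" "\<And>B. generated B \<Longrightarrow> mutually_local P B"
    and Q: "creative Q" "\<And>B. generated B \<Longrightarrow> mutually_local Q B"
    and eq: "P (-1) \<Omega> = Q (-1) \<Omega>" and B: "generated B"
  shows "P n (B (-1) \<Omega>) = Q n (B (-1) \<Omega>)"
proof -
  have neg: "P (- 1 - int j) \<Omega> = Q (- 1 - int j) \<Omega>" for j
  proof (induction j)
    case 0 show ?case using eq by simp
  next
    case (Suc j)
    have *: "of_int (1 + int j) *s A (- 1 - int (Suc j)) \<Omega> = D (A (- 1 - int j) \<Omega>)" if "creative A" for A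
    proof -
      have "D (A (- 1 - int j) \<Omega>) - A (- 1 - int j) (D \<Omega>) = (- of_int (- 1 - int j)) *s A (- 1 - int j - 1) \<Omega>"
        using that unfolding creative_def translation_covariant_def by blast
      moreover have "A (- 1 - int j) (D \<Omega>) = 0"
        using that by (simp add: D_vac lin_0 qf_lin creative_qf)
      moreover have "- 1 - int j - 1 = - 1 - int (Suc j)" by simp
      ultimately show ?thesis by simp
    qed
    have "of_int (1 + int j) \<noteq> (0::complex)" unfolding of_int_eq_0_iff by simp
    with *[OF P(1)] *[OF Q(1)] Suc show ?case using scale_left_imp_eq by metis
  qed
  have vac: "P m \<Omega> = Q m \<Omega>" for m
  proof (cases "m \<ge> 0")
    case True then show ?thesis using P(1) Q(1) by (simp add: creative_def)
  next
    case False then show ?thesis using neg[of "nat (- 1 - m)"] by simp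
  qed
  obtain N where N: "\<forall>m n w. borcherds P B (int N) m n w = 0" using P(2)[OF B] unfolding mutually_local_def by blast
  obtain M where M: "\<forall>m n w. borcherds Q B (int M) m n w = 0" using Q(2)[OF B] unfolding mutually_local_def by blast
  define K where "K = int (max N M)"
  have Bq: "quantum_field B" "creative B" using B generated_qf generated_creative by auto
  have K0: "borcherds P B K m n w = 0" "borcherds Q B K m n w = 0" for m n w
    using borcherds_ge[OF creative_qf[OF P(1)] Bq(1) N, of K] borcherds_ge[OF creative_qf[OF Q(1)] Bq(1) M, of K]
    by (auto simp: K_def)
  have *: "A (m + K) (B (-1) \<Omega>) = ((-1) powi K) *s binsum K (\<lambda>i. (-1) ^ i *s B (-1 + K - int i) (A (m + int i) \<Omega>))"
    if "creative A" "borcherds A B K m (-1) \<Omega> = 0" for A m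
  proof -
    have "binsum K (\<lambda>i. (-1) ^ i *s A (m + K - int i) (B (-1 + int i) \<Omega>)) = A (m + K) (B (-1) \<Omega>)"
      by (subst binsum_eq_sum[of 1]) (use Bq that(1) in \<open>auto simp: creative_def lin_0 qf_lin\<close>)
    then show ?thesis using that(2) by (simp add: borcherds_def)
  qed
  have "P (n - K + K) (B (-1) \<Omega>) = Q (n - K + K) (B (-1) \<Omega>)"
    unfolding *[OF P(1) K0(1)] *[OF Q(1) K0(2)] vac ..
  then show ?thesis by simp
qed

definition states :: "'w set" where
  "states = {A (-1) \<Omega> | A. generated A}"

text \<open>
  Several generated fields may create the same vector \<open>b\<close>. They agree on all states by uniqueness, but
  possibly not outside, which is why a field is chosen and why later statements are about states.
\<close>

definition state_field :: "'w \<Rightarrow> int \<Rightarrow> 'w \<Rightarrow> 'w" where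
  "state_field b = (SOME A. generated A \<and> A (-1) \<Omega> = b)"

lemma state_field: assumes "b \<in> states" shows "generated (state_field b)" "state_field b (-1) \<Omega> = b"
proof -
  have "\<exists>A. generated A \<and> A (-1) \<Omega> = b" using assms by (auto simp: states_def)
  then have "generated (state_field b) \<and> state_field b (-1) \<Omega> = b"
    unfolding state_field_def by (rule someI_ex)
  then show "generated (state_field b)" "state_field b (-1) \<Omega> = b" by auto
qed

text \<open>
  Locality to the generated fields is what one knows of a generator and of a product of two generated
  fields, and these are the fields \<open>P\<close> for which the lemma serves.
\<close>

lemma state_field_unique:
  assumes "creative P" "\<And>B. generated B \<Longrightarrow> mutually_local P B" "P (-1) \<Omega> \<in> states" "c \<in> states"
  shows "state_field (P (-1) \<Omega>) n c = P n c"
  using Goddard_uniqueness[OF generated_creative[OF state_field(1)[OF assms(3)]] generated_local[OF state_field(1)[OF assms(3)]] assms(1,2) state_field(2)[OF assms(3)]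
      state_field(1)[OF assms(4)], of n] unfolding state_field(2)[OF assms(4)] .

lemma state_mem: "generated A \<Longrightarrow> A (-1) \<Omega> \<in> states"
  by (auto simp: states_def)

lemma state_field_eq_generated: "generated A \<Longrightarrow> c \<in> states \<Longrightarrow> state_field (A (-1) \<Omega>) n c = A n c"
  by (rule state_field_unique[OF generated_creative generated_local state_mem])

lemma states_subspace: "subspace states"
proof (rule subspaceI)
  show "0 \<in> states" using state_mem[OF generated_scale[OF generated_id, of 0]] by simp
next
  fix x y assume "x \<in> states" "y \<in> states"
  then obtain A B where "generated A" "generated B" "x = A (-1) \<Omega>" "y = B (-1) \<Omega>" by (auto simp: states_def)
  then show "x + y \<in> states" using state_mem[OF generated_add] by blast
next
  fix c x assume "x \<in> states"
  then obtain A where "generated A" "x = A (-1) \<Omega>" by (auto simp: states_def)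
  then show "c *s x \<in> states" using state_mem[OF generated_scale] by blast
qed

lemma vac_state: "\<Omega> \<in> states"
  using state_mem[OF generated_id] by (simp add: id_field_def)

lemma G_states:
  assumes "A \<in> G" "b \<in> states" shows "A n b \<in> states"
proof -
  obtain B where B: "generated B" "b = B (-1) \<Omega>" using assms by (auto simp: states_def)
  then have "A n b = field_prod A n B (-1) \<Omega>"
    by (simp add: field_prod_state[OF G_creative[OF assms(1)] generated_creative])
  then show ?thesis using state_mem[OF generated_prod[OF assms(1) B(1)]] by simp
qed

text \<open>
  The subspace of states is invariant under the generators by \<open>field_prod_state\<close>, hence under all
  iterated products of their modes.
\<close>

lemma generated_states: "generated A \<Longrightarrow> b \<in> states \<Longrightarrow> A n b \<in> states"
proof (induction arbitrary: n b rule: generated.induct)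
  case generated_id then show ?case by (simp add: id_field_def subspace_0[OF states_subspace])
next
  case (generated_prod A B k)
  have "binsum k (\<lambda>i. (-1) ^ i *s A (0 + k - int i) (B (n + int i) b)) \<in> states"
    by (rule binsum_mem[OF states_subspace], rule subspace_scale[OF states_subspace])
       (rule G_states[OF generated_prod(1) generated_prod.IH[OF generated_prod.prems]])
  moreover have "binsum k (\<lambda>i. (-1) ^ i *s B (n + k - int i) (A (0 + int i) b)) \<in> states"
    by (rule binsum_mem[OF states_subspace], rule subspace_scale[OF states_subspace])
       (rule generated_prod.IH[OF G_states[OF generated_prod(1) generated_prod.prems]])
  ultimately show ?case
    unfolding field_prod_def borcherds_def by (simp only: subspace_diff[OF states_subspace] subspace_scale[OF states_subspace])
next
  case generated_add then show ?case by (simp add: subspace_add[OF states_subspace])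
next
  case generated_scale then show ?case by (simp add: subspace_scale[OF states_subspace])
qed

lemma G_state: "A \<in> G \<Longrightarrow> A (-1) \<Omega> \<in> states"
  using G_states vac_state by blast

lemma state_field_G: "A \<in> G \<Longrightarrow> c \<in> states \<Longrightarrow> state_field (A (-1) \<Omega>) n c = A n c"
  by (rule state_field_unique[OF G_creative G_generated_local G_state])

lemma state_field_closed: "a \<in> states \<Longrightarrow> b \<in> states \<Longrightarrow> state_field a n b \<in> states"
  using generated_states state_field by blast

lemma state_field_add_left:
  assumes "a \<in> states" "a' \<in> states" "b \<in> states"
  shows "state_field (a + a') n b = state_field a n b + state_field a' n b"
  using state_field_eq_generated[OF generated_add[OF state_field(1)[OF assms(1)] state_field(1)[OF assms(2)]] assms(3)] by (simp add: state_field(2) assms)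

lemma state_field_scale_left:
  assumes "a \<in> states" "b \<in> states"
  shows "state_field (c *s a) n b = c *s state_field a n b"
  using state_field_eq_generated[OF generated_scale[OF state_field(1)[OF assms(1)]] assms(2)] by (simp add: state_field(2) assms)

lemma state_field_zero: "c \<in> states \<Longrightarrow> state_field 0 n c = 0"
  using state_field_scale_left[OF vac_state, of c 0] by simp

lemma state_field_qf: "a \<in> states \<Longrightarrow> quantum_field (state_field a)"
  using state_field generated_qf by blast

lemma state_field_vacuum: "b \<in> states \<Longrightarrow> state_field \<Omega> n b = (if n = -1 then b else 0)"
  using state_field_eq_generated[OF generated_id, of b n] by (simp add: id_field_def)

lemma state_field_creation: "a \<in> states \<Longrightarrow> n \<ge> 0 \<Longrightarrow> state_field a n \<Omega> = 0"
  using generated_creative[OF state_field(1)] by (simp add: creative_def)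

lemma state_field_translation:
  "a \<in> states \<Longrightarrow> D (state_field a n b) - state_field a n (D b) = (- of_int n) *s state_field a (n - 1) b"
  using generated_creative[OF state_field(1)] by (simp add: creative_def translation_covariant_def)

text \<open>
  The \<open>k\<close>-th product of the fields of \<open>a\<close> and \<open>b\<close> creates the vector \<open>a\<^sub>k b\<close>, and it is local to all
  generated fields by Dong's lemma; uniqueness identifies it with the field of \<open>a\<^sub>k b\<close>.
\<close>

lemma state_field_iterate:
  assumes "a \<in> states" "b \<in> states" "c \<in> states"
  shows "state_field (state_field a k b) n c = borcherds (state_field a) (state_field b) k 0 n c"
proof -
  note F = state_field(1)[OF assms(1)] state_field(1)[OF assms(2)]
  have s: "field_prod (state_field a) k (state_field b) (-1) \<Omega> = state_field a k b"
    using field_prod_state[OF generated_creative[OF F(1)] generated_creative[OF F(2)]] state_field(2)[OF assms(2)] by simp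
  have "state_field (field_prod (state_field a) k (state_field b) (-1) \<Omega>) n c = field_prod (state_field a) k (state_field b) n c"
  proof (rule state_field_unique)
    show "creative (field_prod (state_field a) k (state_field b))" by (rule field_prod_creative[OF generated_creative[OF F(1)] generated_creative[OF F(2)]])
    show "mutually_local (field_prod (state_field a) k (state_field b)) B" if "generated B" for B
      by (rule Dong[OF generated_qf[OF F(1)] generated_qf[OF F(2)] generated_qf[OF that] generated_local[OF F] generated_local[OF F(1) that] generated_local[OF F(2) that]])
    show "field_prod (state_field a) k (state_field b) (-1) \<Omega> \<in> states" unfolding s by (rule state_field_closed[OF assms(1,2)])
  qed (rule assms)
  then show ?thesis unfolding s by (simp add: field_prod_def)
qed

text \<open>
  Both sides satisfy the recursion of \<open>borcherds_rec\<close>. They agree at \<open>m = 0\<close>, by \<open>state_field_iterate\<close>, and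
  for \<open>l \<ge> K\<close>, where both vanish. If they agree for \<open>l + 1\<close>, then by the recursion their difference at
  \<open>l\<close> depends on \<open>m\<close> and \<open>n\<close> only through \<open>m + n\<close>, so that agreement at \<open>m = 0\<close> spreads to all \<open>m\<close>.
\<close>

theorem state_field_Borcherds:
  assumes a: "a \<in> states" and b: "b \<in> states" and c: "c \<in> states"
  shows "binsum m (\<lambda>i. state_field (state_field a (l + int i) b) (m + n - int i) c) = borcherds (state_field a) (state_field b) l m n c"
proof -
  define L where "L l m n = binsum m (\<lambda>i. state_field (state_field a (l + int i) b) (m + n - int i) c)" for l m n
  note q = state_field_qf[OF a] state_field_qf[OF b]
  obtain N where N: "\<forall>k\<ge>N. state_field a k b = 0" using qf_trunc[OF q(1)] by blast
  obtain M where M: "\<forall>m n w. borcherds (state_field a) (state_field b) (int M) m n w = 0"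
    using generated_local[OF state_field(1)[OF a] state_field(1)[OF b]] unfolding mutually_local_def by blast
  have ev: "evzero (\<lambda>i. state_field (state_field a (l + int i) b) (k - int i) c)" for l k
    unfolding evzero_def by (rule exI[of _ "nat (N - l)"]) (auto simp: N state_field_zero c)
  have L_rec: "L l (m + 1) n = L l m (n + 1) + L (l + 1) m n" for l m n
    using binsum_Suc[OF ev[of l "m + 1 + n"], of m] by (simp add: L_def algebra_simps)
  have L_0: "L l 0 n = borcherds (state_field a) (state_field b) l 0 n c" for l n
    by (simp add: L_def state_field_iterate a b c)
  define K where "K = max N (int M)"
  have large: "L l m n = borcherds (state_field a) (state_field b) l m n c" if "l \<ge> K" for l m n
  proof -
    have "L l m n = 0" unfolding L_def using N that by (simp add: K_def state_field_zero c)
    moreover have "borcherds (state_field a) (state_field b) l m n c = 0" by (rule borcherds_ge[OF q M]) (use that in \<open>simp add: K_def\<close>)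
    ultimately show ?thesis by simp
  qed
  have "L (K - int j) m n = borcherds (state_field a) (state_field b) (K - int j) m n c" for j m n
  proof (induction j arbitrary: m n)
    case 0 show ?case by (rule large) simp
  next
    case (Suc j)
    define l where "l = K - int (Suc j)"
    have IH: "L (l + 1) m n = borcherds (state_field a) (state_field b) (l + 1) m n c" for m n
      using Suc by (simp add: l_def)
    have step: "L l (m + 1) n - borcherds (state_field a) (state_field b) l (m + 1) n c = L l m (n + 1) - borcherds (state_field a) (state_field b) l m (n + 1) c" for m n
      using L_rec[of l m n] borcherds_rec[OF q, of l m n c] IH[of m n] by (simp add: algebra_simps)
    have "\<forall>n. L l m n = borcherds (state_field a) (state_field b) l m n c"
    proof (induction m rule: int_induct[where k = 0])
      case base show ?case by (simp add: L_0)
    next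
      case (step1 m) then show ?case using step[of m] by simp
    next
      case (step2 m)
      show ?case
      proof
        fix n show "L l (m - 1) n = borcherds (state_field a) (state_field b) l (m - 1) n c"
          using step[of "m - 1" "n - 1"] step2 by simp
      qed
    qed
    then show ?case by (simp add: l_def)
  qed
  note down = this
  have "L l m n = borcherds (state_field a) (state_field b) l m n c"
  proof (cases "l \<ge> K")
    case False
    then have "K - int (nat (K - l)) = l" by simp
    with down[of "nat (K - l)" m n] show ?thesis by simp
  qed (rule large)
  then show ?thesis unfolding L_def .
qed

lemma states_induct:
  assumes "b \<in> states" "\<Omega> \<in> S" "subspace S" "\<And>A n b. A \<in> G \<Longrightarrow> b \<in> S \<Longrightarrow> A n b \<in> S"
  shows "b \<in> S"
proof -
  have "generated A \<Longrightarrow> A (-1) \<Omega> \<in> S" for A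
  proof (induction rule: generated.induct)
    case generated_id then show ?case using assms by (simp add: id_field_def)
  next
    case generated_prod then show ?case using assms by (simp add: field_prod_state G_creative generated_creative)
  next
    case generated_add then show ?case by (simp add: subspace_add[OF assms(3)])
  next
    case generated_scale then show ?case by (simp add: subspace_scale[OF assms(3)])
  qed
  then show ?thesis using assms(1) by (auto simp: states_def)
qed

end

section \<open>Coordinates on complex modules\<close>

lemma CC_simps [simp]:
  "carrier CC = UNIV" "\<one>\<^bsub>CC\<^esub> = 1" "\<zero>\<^bsub>CC\<^esub> = 0" "x \<otimes>\<^bsub>CC\<^esub> y = x * y" "x \<oplus>\<^bsub>CC\<^esub> y = x + y"
  by (simp_all add: ring_of_type_algebra_def)

definition pscale :: "complex \<Rightarrow> ('x \<Rightarrow>\<^sub>0 complex) \<Rightarrow> ('x \<Rightarrow>\<^sub>0 complex)" where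
  "pscale c p = Poly_Mapping.map ((*) c) p"

lemma lookup_pscale [simp]: "Poly_Mapping.lookup (pscale c p) x = c * Poly_Mapping.lookup p x"
  unfolding pscale_def by transfer (simp add: when_def)

global_interpretation pm: complex_space pscale
  by unfold_locales (auto intro!: poly_mapping_eqI simp: lookup_add algebra_simps)

text \<open>
  Extend a basis of \<open>K\<close> to a basis of the whole space and send the basis vectors in \<open>K\<close> to \<open>0\<close>.
\<close>

lemma complement_projection:
  fixes K :: "('x \<Rightarrow>\<^sub>0 complex) set"
  assumes K: "pm.subspace K"
  shows "\<exists>\<rho>. pm.lin \<rho> \<and> (\<forall>k\<in>K. \<rho> k = 0) \<and> (\<forall>p. \<rho> p - p \<in> K)"
proof -
  obtain B0 where B0: "B0 \<subseteq> K" "pm.independent B0" "K \<subseteq> pm.span B0"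
    using pm.maximal_independent_subset by blast
  obtain B where B: "B0 \<subseteq> B" "pm.independent B" "UNIV \<subseteq> pm.span B"
    using pm.maximal_independent_subset_extend[of B0 UNIV] B0 by auto
  interpret pp: vector_space_pair pscale "pscale :: complex \<Rightarrow> ('x \<Rightarrow>\<^sub>0 complex) \<Rightarrow> _" ..
  obtain \<rho> where \<rho>: "Vector_Spaces.linear pscale pscale \<rho>" "\<forall>x\<in>B. \<rho> x = (if x \<in> B0 then 0 else x)"
    using pp.linear_independent_extend[OF B(2), of "\<lambda>x. if x \<in> B0 then 0 else x"] by blast
  interpret l: Vector_Spaces.linear pscale pscale \<rho> by (rule \<rho>(1))
  have lin: "pm.lin \<rho>" by (simp add: pm.lin_def l.add l.scale)
  have "pm.span B \<subseteq> {p. \<rho> p - p \<in> K}"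
  proof (rule pm.span_minimal)
    show "B \<subseteq> {p. \<rho> p - p \<in> K}"
      using \<rho>(2) B0(1) pm.subspace_neg[OF K] pm.subspace_0[OF K] by auto
    show "pm.subspace {p. \<rho> p - p \<in> K}"
    proof (rule pm.subspaceI)
      show "0 \<in> {p. \<rho> p - p \<in> K}" by (simp add: l.zero pm.subspace_0[OF K])
    next
      fix x y assume "x \<in> {p. \<rho> p - p \<in> K}" "y \<in> {p. \<rho> p - p \<in> K}"
      then have "(\<rho> x - x) + (\<rho> y - y) \<in> K" using pm.subspace_add[OF K] by blast
      then show "x + y \<in> {p. \<rho> p - p \<in> K}" by (simp add: l.add algebra_simps)
    next
      fix c x assume "x \<in> {p. \<rho> p - p \<in> K}"
      then have "pscale c (\<rho> x - x) \<in> K" using pm.subspace_scale[OF K] by blast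
      then show "pscale c x \<in> {p. \<rho> p - p \<in> K}" by (simp add: l.scale pm.scale_right_diff_distrib)
    qed
  qed
  moreover have "pm.span B0 \<subseteq> {p. \<rho> p = 0}"
  proof (rule pm.span_minimal)
    show "B0 \<subseteq> {p. \<rho> p = 0}" using \<rho>(2) B(1) by auto
    show "pm.subspace {p. \<rho> p = 0}" by (rule pm.subspaceI) (auto simp: l.zero l.add l.scale)
  qed
  ultimately show ?thesis using lin B B0 by blast
qed

locale complex_module = module CC M for M :: "(complex, 'v) module" (structure)
begin

lemma smult_cl [simp, intro]: "x \<in> carrier M \<Longrightarrow> c \<odot> x \<in> carrier M"
  by simp

lemma smult_l_distr': "x \<in> carrier M \<Longrightarrow> (a + b) \<odot> x = a \<odot> x \<oplus> b \<odot> x"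
  using smult_l_distr[of a b x] by simp

lemma smult_assoc': "x \<in> carrier M \<Longrightarrow> (a * b) \<odot> x = a \<odot> (b \<odot> x)"
  using smult_assoc1[of a b x] by simp

lemma smult_1 [simp]: "x \<in> carrier M \<Longrightarrow> 1 \<odot> x = x"
  using smult_one[of x] by simp

lemma smult_0 [simp]: "x \<in> carrier M \<Longrightarrow> 0 \<odot> x = \<zero>"
  using smult_l_null[of x] by simp

lemma smult_minus1: "x \<in> carrier M \<Longrightarrow> (-1) \<odot> x = \<ominus> x"
  using smult_l_distr'[of x "-1" 1] by (simp add: M.minus_equality)

lemma submodI:
  assumes "H \<subseteq> carrier M" "\<zero> \<in> H" "\<And>a b. a \<in> H \<Longrightarrow> b \<in> H \<Longrightarrow> a \<oplus> b \<in> H"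
    "\<And>c x. x \<in> H \<Longrightarrow> c \<odot> x \<in> H"
  shows "submodule H CC M"
proof (rule submoduleI)
  show "\<ominus> a \<in> H" if "a \<in> H" for a
    using assms(4)[OF that, of "-1"] smult_minus1[of a] that assms(1) by auto
qed (use assms in auto)

lemma submodD:
  assumes "submodule H CC M"
  shows "H \<subseteq> carrier M" "\<zero> \<in> H" "\<And>a b. a \<in> H \<Longrightarrow> b \<in> H \<Longrightarrow> a \<oplus> b \<in> H"
    "\<And>c x. x \<in> H \<Longrightarrow> c \<odot> x \<in> H" "\<And>a. a \<in> H \<Longrightarrow> \<ominus> a \<in> H"
    "\<And>a b. a \<in> H \<Longrightarrow> b \<in> H \<Longrightarrow> a \<ominus> b \<in> H"
  using submoduleE[OF assms] subgroup.one_closed[OF submodule.axioms(1)[OF assms]]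
  by (auto simp: a_minus_def)

lemma submod_abelian_subgroup:
  assumes "submodule H CC M" shows "abelian_subgroup H M"
  by (rule abelian_subgroupI3[OF additive_subgroupI[OF submodule.axioms(1)[OF assms]]]) (rule M.abelian_group_axioms)

lemma fsum_closed: "(\<And>i. f i \<in> carrier M) \<Longrightarrow> fsum M f \<in> carrier M"
  by (simp add: fsum_def)

lemma additive_fsum:
  assumes f: "\<And>i. f i \<in> carrier M" and fin: "finite {i. f i \<noteq> \<zero>}"
    and h0: "h \<zero> = (0::'b::comm_monoid_add)"
    and add: "\<And>x y. x \<in> carrier M \<Longrightarrow> y \<in> carrier M \<Longrightarrow> h (x \<oplus> y) = h x + h y"
  shows "h (fsum M f) = Sum_any (\<lambda>i. h (f i))"
proof -
  have "h (finsum M f A) = (\<Sum>i\<in>A. h (f i))" if "finite A" for A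
    using that by (induction rule: finite_induct) (auto simp: h0 add f)
  then have "h (fsum M f) = (\<Sum>i\<in>{i. f i \<noteq> \<zero>}. h (f i))"
    using fin by (simp add: fsum_def)
  also have "\<dots> = Sum_any (\<lambda>i. h (f i))"
    by (rule Sum_any.expand_superset[symmetric]) (use fin in \<open>auto simp: h0\<close>)
  finally show ?thesis .
qed

text \<open>
  Formal linear combinations of elements of the module are evaluated to actual ones. Keys outside the
  carrier are dropped, which makes the map total, linear and carrier-valued.
\<close>

definition evalp :: "('v \<Rightarrow>\<^sub>0 complex) \<Rightarrow> 'v" where
  "evalp p = finsum M (\<lambda>v. Poly_Mapping.lookup p v \<odot> v) (Poly_Mapping.keys p \<inter> carrier M)"

lemma evalp_superset:
  assumes "finite A" "Poly_Mapping.keys p \<inter> carrier M \<subseteq> A" "A \<subseteq> carrier M"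
  shows "evalp p = finsum M (\<lambda>v. Poly_Mapping.lookup p v \<odot> v) A"
  unfolding evalp_def
  by (rule M.add.finprod_mono_neutral_cong_left) (use assms in \<open>auto simp: in_keys_iff\<close>)

lemma evalp_closed: "evalp p \<in> carrier M"
  by (auto simp: evalp_def intro!: M.finsum_closed)

lemma evalp_add: "evalp (p + q) = evalp p \<oplus> evalp q"
proof -
  let ?A = "(Poly_Mapping.keys p \<union> Poly_Mapping.keys q) \<inter> carrier M"
  have "evalp (p + q) = finsum M (\<lambda>v. Poly_Mapping.lookup (p + q) v \<odot> v) ?A"
    by (rule evalp_superset) (use keys_add[of p q] in auto)
  also have "\<dots> = finsum M (\<lambda>v. Poly_Mapping.lookup p v \<odot> v \<oplus> Poly_Mapping.lookup q v \<odot> v) ?A"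
    by (rule M.finsum_cong') (auto simp: lookup_add smult_l_distr')
  also have "\<dots> = finsum M (\<lambda>v. Poly_Mapping.lookup p v \<odot> v) ?A \<oplus> finsum M (\<lambda>v. Poly_Mapping.lookup q v \<odot> v) ?A"
    by (rule M.finsum_addf) auto
  also have "finsum M (\<lambda>v. Poly_Mapping.lookup p v \<odot> v) ?A = evalp p"
    by (rule evalp_superset[symmetric]) auto
  also have "finsum M (\<lambda>v. Poly_Mapping.lookup q v \<odot> v) ?A = evalp q"
    by (rule evalp_superset[symmetric]) auto
  finally show ?thesis .
qed

lemma evalp_scale: "evalp (pscale c p) = c \<odot> evalp p"
proof -
  let ?A = "Poly_Mapping.keys p \<inter> carrier M"
  have "evalp (pscale c p) = finsum M (\<lambda>v. Poly_Mapping.lookup (pscale c p) v \<odot> v) ?A"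
    by (rule evalp_superset) (auto simp: in_keys_iff)
  also have "\<dots> = finsum M (\<lambda>v. c \<odot> (Poly_Mapping.lookup p v \<odot> v)) ?A"
    by (rule M.finsum_cong') (auto simp: smult_assoc')
  also have "\<dots> = c \<odot> evalp p"
    unfolding evalp_def by (rule finsum_smult_ldistr[symmetric]) auto
  finally show ?thesis .
qed

lemma evalp_single: "x \<in> carrier M \<Longrightarrow> evalp (Poly_Mapping.single x 1) = x"
  by (subst evalp_superset[of "{x}"]) (auto simp: M.finsum_insert)

text \<open>
  The map \<open>\<phi>\<close> is linear and injective on the carrier, with the linear map \<open>\<theta>\<close> as a left inverse. The
  purpose is to move calculations in a module with a carrier into a type that is a vector space as a
  whole, where the simplifier and the linear algebra of total spaces apply.
\<close>

definition is_coord :: "('v \<Rightarrow> ('v \<Rightarrow>\<^sub>0 complex)) \<Rightarrow> (('v \<Rightarrow>\<^sub>0 complex) \<Rightarrow> 'v) \<Rightarrow> bool" where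
  "is_coord \<phi> \<theta> \<longleftrightarrow> (\<forall>p. \<theta> p \<in> carrier M) \<and> (\<forall>p q. \<theta> (p + q) = \<theta> p \<oplus> \<theta> q) \<and> (\<forall>c p. \<theta> (pscale c p) = c \<odot> \<theta> p) \<and>
     (\<forall>x\<in>carrier M. \<theta> (\<phi> x) = x) \<and> (\<forall>x\<in>carrier M. \<forall>y\<in>carrier M. \<phi> (x \<oplus> y) = \<phi> x + \<phi> y) \<and>
     (\<forall>c. \<forall>x\<in>carrier M. \<phi> (c \<odot> x) = pscale c (\<phi> x))"

text \<open>
  Evaluation of formal linear combinations is a surjection from a space of finitely supported functions,
  and a projection along its kernel gives a linear section.
\<close>

lemma ex_coord: "\<exists>\<phi> \<theta>. is_coord \<phi> \<theta>"
proof -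
  define K where "K = {p. evalp p = \<zero>}"
  have e0: "evalp 0 = \<zero>" using evalp_scale[of 0 0] evalp_closed by simp
  have K: "pm.subspace K"
    by (rule pm.subspaceI) (auto simp: K_def e0 evalp_add evalp_scale)
  from complement_projection[OF K] obtain \<rho> where
    \<rho>: "pm.lin \<rho>" "\<And>k. k \<in> K \<Longrightarrow> \<rho> k = 0" "\<And>p. \<rho> p - p \<in> K" by blast
  let ?\<phi> = "\<lambda>x. \<rho> (Poly_Mapping.single x 1)"
  have e: "evalp (\<rho> p) = evalp p" for p
  proof -
    have "evalp (\<rho> p) = evalp ((\<rho> p - p) + p)" by simp
    also have "\<dots> = evalp p" unfolding evalp_add using \<rho>(3)[of p] by (simp add: K_def evalp_closed)
    finally show ?thesis .
  qed
  have eqK: "\<rho> p = \<rho> q" if "evalp p = evalp q" for p q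
  proof -
    have "evalp (p + pscale (-1) q) = \<zero>"
      unfolding evalp_add evalp_scale that by (simp add: smult_minus1 evalp_closed M.r_neg)
    then have "\<rho> (p + pscale (-1) q) = 0" by (intro \<rho>(2)) (simp add: K_def)
    then show ?thesis by (simp add: pm.lin_diff[OF \<rho>(1)])
  qed
  have 1: "?\<phi> (x \<oplus> y) = ?\<phi> x + ?\<phi> y" if "x \<in> carrier M" "y \<in> carrier M" for x y
    using eqK[of "Poly_Mapping.single (x \<oplus> y) 1" "Poly_Mapping.single x 1 + Poly_Mapping.single y 1"] that
    by (simp add: evalp_add evalp_single pm.lin_add[OF \<rho>(1)])
  have 2: "?\<phi> (c \<odot> x) = pscale c (?\<phi> x)" if "x \<in> carrier M" for c x
    using eqK[of "Poly_Mapping.single (c \<odot> x) 1" "pscale c (Poly_Mapping.single x 1)"] that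
    by (simp add: evalp_scale evalp_single pm.lin_scale[OF \<rho>(1)])
  show ?thesis
    by (rule exI[of _ ?\<phi>], rule exI[of _ evalp])
       (simp add: is_coord_def evalp_closed evalp_add evalp_scale e evalp_single 1 2)
qed

definition coord :: "'v \<Rightarrow> ('v \<Rightarrow>\<^sub>0 complex)" where
  "coord = (SOME \<phi>. \<exists>\<theta>. is_coord \<phi> \<theta>)"

definition uncoord :: "('v \<Rightarrow>\<^sub>0 complex) \<Rightarrow> 'v" where
  "uncoord = (SOME \<theta>. is_coord coord \<theta>)"

lemma coord_uncoord: "is_coord coord uncoord"
proof -
  have "\<exists>\<theta>. is_coord coord \<theta>" unfolding coord_def by (rule someI_ex[OF ex_coord])
  then show ?thesis unfolding uncoord_def by (rule someI_ex)
qed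

lemma uncoord_closed [simp]: "uncoord p \<in> carrier M"
  and uncoord_add: "uncoord (p + q) = uncoord p \<oplus> uncoord q"
  and uncoord_scale: "uncoord (pscale c p) = c \<odot> uncoord p"
  and uncoord_coord [simp]: "x \<in> carrier M \<Longrightarrow> uncoord (coord x) = x"
  and coord_add: "x \<in> carrier M \<Longrightarrow> y \<in> carrier M \<Longrightarrow> coord (x \<oplus> y) = coord x + coord y"
  and coord_scale: "x \<in> carrier M \<Longrightarrow> coord (c \<odot> x) = pscale c (coord x)"
  using coord_uncoord by (auto simp: is_coord_def)

lemma coord_zero [simp]: "coord \<zero> = 0"
  using coord_scale[of \<zero> 0] by simp

lemma coord_neg: "x \<in> carrier M \<Longrightarrow> coord (\<ominus> x) = - coord x"
  using coord_scale[of x "-1"] by (simp add: smult_minus1)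

lemma coord_minus: "x \<in> carrier M \<Longrightarrow> y \<in> carrier M \<Longrightarrow> coord (x \<ominus> y) = coord x - coord y"
  by (simp add: a_minus_def coord_add coord_neg)

lemma coord_eq_iff: "x \<in> carrier M \<Longrightarrow> y \<in> carrier M \<Longrightarrow> coord x = coord y \<longleftrightarrow> x = y"
  by (metis uncoord_coord)

lemma coord_eq_0_iff: "x \<in> carrier M \<Longrightarrow> coord x = 0 \<longleftrightarrow> x = \<zero>"
  using coord_eq_iff[of x \<zero>] by simp

lemmas coord_simps = coord_add coord_scale coord_neg coord_minus

lemma coord_fsum:
  assumes "\<And>i. f i \<in> carrier M" "finite {i. f i \<noteq> \<zero>}"
  shows "coord (fsum M f) = Sum_any (\<lambda>i. coord (f i))"
  by (rule additive_fsum) (use assms in \<open>auto simp: coord_add\<close>)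

lemma lin_span_submodule: assumes "S \<subseteq> carrier M" shows "submodule (lin_span M S) CC M"
proof (rule submodI)
  show "lin_span M S \<subseteq> carrier M"
    unfolding lin_span_def using carrier_is_submodule assms by blast
  show "\<zero> \<in> lin_span M S" unfolding lin_span_def using submodD(2) by blast
  show "a \<oplus> b \<in> lin_span M S" if "a \<in> lin_span M S" "b \<in> lin_span M S" for a b
    using that unfolding lin_span_def by (auto dest: submodD(3))
  show "c \<odot> a \<in> lin_span M S" if "a \<in> lin_span M S" for a c
    using that unfolding lin_span_def by (auto dest: submodD(4))
qed

lemma lin_span_mono: "S \<subseteq> T \<Longrightarrow> lin_span M S \<subseteq> lin_span M T"
  by (auto simp: lin_span_def)

end

lemma lin_span_superset: "S \<subseteq> lin_span M S"
  by (auto simp: lin_span_def)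

lemma lin_span_minimal: "submodule H CC M \<Longrightarrow> S \<subseteq> H \<Longrightarrow> lin_span M S \<subseteq> H"
  by (auto simp: lin_span_def)

section \<open>Linear maps\<close>

definition mlinear :: "(complex, 'u) module \<Rightarrow> (complex, 'v) module \<Rightarrow> ('u \<Rightarrow> 'v) \<Rightarrow> bool" where
  "mlinear U M f \<longleftrightarrow> (\<forall>x\<in>carrier U. f x \<in> carrier M) \<and>
     (\<forall>x\<in>carrier U. \<forall>y\<in>carrier U. f (x \<oplus>\<^bsub>U\<^esub> y) = f x \<oplus>\<^bsub>M\<^esub> f y) \<and>
     (\<forall>c. \<forall>x\<in>carrier U. f (c \<odot>\<^bsub>U\<^esub> x) = c \<odot>\<^bsub>M\<^esub> f x)"

lemma mlinearD:
  assumes "mlinear U M f"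
  shows "x \<in> carrier U \<Longrightarrow> f x \<in> carrier M"
    "x \<in> carrier U \<Longrightarrow> y \<in> carrier U \<Longrightarrow> f (x \<oplus>\<^bsub>U\<^esub> y) = f x \<oplus>\<^bsub>M\<^esub> f y"
    "x \<in> carrier U \<Longrightarrow> f (c \<odot>\<^bsub>U\<^esub> x) = c \<odot>\<^bsub>M\<^esub> f x"
  using assms by (auto simp: mlinear_def)

lemma mlinear_zero: assumes "complex_module U" "complex_module M" "mlinear U M f" shows "f \<zero>\<^bsub>U\<^esub> = \<zero>\<^bsub>M\<^esub>"
proof -
  interpret U: complex_module U by fact
  interpret M: complex_module M by fact
  show ?thesis using mlinearD(3)[OF assms(3), of "\<zero>\<^bsub>U\<^esub>" 0] mlinearD(1)[OF assms(3), of "\<zero>\<^bsub>U\<^esub>"] by simp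
qed

lemma mlinear_neg: assumes "complex_module U" "complex_module M" "mlinear U M f" "x \<in> carrier U" shows "f (\<ominus>\<^bsub>U\<^esub> x) = \<ominus>\<^bsub>M\<^esub> f x"
proof -
  interpret U: complex_module U by fact
  interpret M: complex_module M by fact
  show ?thesis using mlinearD(3)[OF assms(3,4), of "-1"] mlinearD(1)[OF assms(3,4)] assms
    by (simp add: U.smult_minus1 M.smult_minus1)
qed

lemma mlinear_minus:
  assumes "complex_module U" "complex_module M" "mlinear U M f" "x \<in> carrier U" "y \<in> carrier U"
  shows "f (x \<ominus>\<^bsub>U\<^esub> y) = f x \<ominus>\<^bsub>M\<^esub> f y"
proof -
  interpret U: complex_module U by fact
  show ?thesis using assms mlinearD(2)[OF assms(3,4), of "\<ominus>\<^bsub>U\<^esub> y"] by (simp add: a_minus_def mlinear_neg)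
qed

lemma mlinear_vimage:
  assumes "complex_module U" "complex_module M" "mlinear U M f" "submodule H CC M"
  shows "submodule {x \<in> carrier U. f x \<in> H} CC U"
proof -
  interpret U: complex_module U by fact
  interpret M: complex_module M by fact
  note H = M.submodD[OF assms(4)]
  show ?thesis
    by (rule U.submodI) (auto simp: mlinear_zero[OF assms(1-3)] H mlinearD[OF assms(3)])
qed

lemma mlinear_image:
  assumes "complex_module U" "complex_module M" "mlinear U M f" "submodule H CC U"
  shows "submodule (f ` H) CC M"
proof -
  interpret U: complex_module U by fact
  interpret M: complex_module M by fact
  note H = U.submodD[OF assms(4)]
  show ?thesis
  proof (rule M.submodI)
    show "f ` H \<subseteq> carrier M" using H(1) mlinearD(1)[OF assms(3)] by auto
    show "\<zero>\<^bsub>M\<^esub> \<in> f ` H" using H(2) mlinear_zero[OF assms(1-3)] by force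
    show "a \<oplus>\<^bsub>M\<^esub> b \<in> f ` H" if "a \<in> f ` H" "b \<in> f ` H" for a b
      using that H(1,3) mlinearD(2)[OF assms(3)] by (smt (verit, best) imageE imageI subsetD)
    show "c \<odot>\<^bsub>M\<^esub> x \<in> f ` H" if "x \<in> f ` H" for c x
      using that H(1,4) mlinearD(3)[OF assms(3)] by (smt (verit, best) imageE imageI subsetD)
  qed
qed

lemma mlinear_span:
  assumes "complex_module U" "complex_module M" "mlinear U M f" "submodule H CC M" "S \<subseteq> carrier U" "\<And>x. x \<in> S \<Longrightarrow> f x \<in> H"
    "x \<in> lin_span U S"
  shows "f x \<in> H"
  using lin_span_minimal[OF mlinear_vimage[OF assms(1-4)], of S] assms(5,6,7) by blast

lemma id_mlinear: "mlinear M M (\<lambda>x. x)"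
  by (simp add: mlinear_def)

lemma mlinear_compose: "mlinear U M f \<Longrightarrow> mlinear M N g \<Longrightarrow> mlinear U N (\<lambda>x. g (f x))"
  by (auto simp: mlinear_def)

lemma mlinear_diff:
  assumes "complex_module M" "mlinear U M f" "mlinear U M g"
  shows "mlinear U M (\<lambda>x. f x \<ominus>\<^bsub>M\<^esub> g x)"
proof -
  interpret M: complex_module M by fact
  show ?thesis
    unfolding mlinear_def
  proof (intro conjI ballI allI)
    fix x y c assume x: "x \<in> carrier U" and y: "y \<in> carrier U"
    note c = mlinearD(1)[OF assms(2) x] mlinearD(1)[OF assms(3) x] mlinearD(1)[OF assms(2) y] mlinearD(1)[OF assms(3) y]
    have "M.coord (f (x \<oplus>\<^bsub>U\<^esub> y) \<ominus>\<^bsub>M\<^esub> g (x \<oplus>\<^bsub>U\<^esub> y)) = M.coord (f x \<ominus>\<^bsub>M\<^esub> g x \<oplus>\<^bsub>M\<^esub> (f y \<ominus>\<^bsub>M\<^esub> g y))"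
      using c by (simp add: mlinearD(2)[OF assms(2) x y] mlinearD(2)[OF assms(3) x y] M.coord_simps)
    then show "f (x \<oplus>\<^bsub>U\<^esub> y) \<ominus>\<^bsub>M\<^esub> g (x \<oplus>\<^bsub>U\<^esub> y) = f x \<ominus>\<^bsub>M\<^esub> g x \<oplus>\<^bsub>M\<^esub> (f y \<ominus>\<^bsub>M\<^esub> g y)"
      using c by (subst (asm) M.coord_eq_iff) (auto simp: mlinearD(2)[OF assms(2) x y] mlinearD(2)[OF assms(3) x y])
  next
    fix x c assume x: "x \<in> carrier U"
    note c = mlinearD(1)[OF assms(2) x] mlinearD(1)[OF assms(3) x]
    show "f x \<ominus>\<^bsub>M\<^esub> g x \<in> carrier M" using c by simp
    have "M.coord (f (c \<odot>\<^bsub>U\<^esub> x) \<ominus>\<^bsub>M\<^esub> g (c \<odot>\<^bsub>U\<^esub> x)) = M.coord (c \<odot>\<^bsub>M\<^esub> (f x \<ominus>\<^bsub>M\<^esub> g x))"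
      using c by (simp add: mlinearD(3)[OF assms(2) x] mlinearD(3)[OF assms(3) x] M.coord_simps pm.scale_right_diff_distrib)
    then show "f (c \<odot>\<^bsub>U\<^esub> x) \<ominus>\<^bsub>M\<^esub> g (c \<odot>\<^bsub>U\<^esub> x) = c \<odot>\<^bsub>M\<^esub> (f x \<ominus>\<^bsub>M\<^esub> g x)"
      using c by (subst (asm) M.coord_eq_iff) (auto simp: mlinearD(3)[OF assms(2) x] mlinearD(3)[OF assms(3) x])
  qed
qed

lemma mlinear_smult:
  assumes "complex_module M" "mlinear U M f"
  shows "mlinear U M (\<lambda>x. c \<odot>\<^bsub>M\<^esub> f x)"
proof -
  interpret M: complex_module M by fact
  show ?thesis
    using assms(2) by (auto simp: mlinear_def M.smult_r_distr M.smult_assoc'[symmetric] mult.commute)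
qed

lemma mlinear_equalizer:
  assumes "complex_module U" "complex_module M" "mlinear U M f" "mlinear U M g"
  shows "submodule {x \<in> carrier U. f x = g x} CC U"
proof -
  interpret U: complex_module U by fact
  show ?thesis
    by (rule U.submodI) (auto simp: mlinear_zero[OF assms(1,2,3)] mlinear_zero[OF assms(1,2,4)] mlinearD[OF assms(3)] mlinearD[OF assms(4)])
qed

text \<open>
  Linearity of a map on a quotient is inherited from the composite with the surjection \<open>q\<close>.
\<close>

lemma mlinear_descend:
  assumes U: "complex_module U" and q: "mlinear U Q q" "carrier Q = q ` carrier U"
    and h: "mlinear U M h" "\<And>x. x \<in> carrier U \<Longrightarrow> f (q x) = h x"
  shows "mlinear Q M f"
proof -
  interpret U: complex_module U by (rule U)
  have "f (q x \<oplus>\<^bsub>Q\<^esub> q y) = h x \<oplus>\<^bsub>M\<^esub> h y" if "x \<in> carrier U" "y \<in> carrier U" for x y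
    using h(2)[OF U.M.add.m_closed[OF that]] by (simp add: mlinearD(2)[OF q(1) that] mlinearD(2)[OF h(1) that])
  moreover have "f (c \<odot>\<^bsub>Q\<^esub> q x) = c \<odot>\<^bsub>M\<^esub> h x" if "x \<in> carrier U" for c x
    using h(2)[OF U.smult_cl[OF that]] by (simp add: mlinearD(3)[OF q(1) that] mlinearD(3)[OF h(1) that])
  ultimately show ?thesis
    unfolding mlinear_def q(2) by (auto simp: h(2) mlinearD(1)[OF h(1)])
qed

section \<open>Sums of families\<close>

lemma (in complex_module) submod_fsum:
  assumes H: "submodule H CC M" and f: "\<And>i. f i \<in> H"
  shows "fsum M f \<in> H"
proof -
  have "finsum M f A \<in> H" if "finite A" for A
    using that
  proof (induction rule: finite_induct)
    case empty show ?case using submodD(2)[OF H] by simp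
  next
    case (insert a A)
    have "f \<in> A \<rightarrow> carrier M" "f a \<in> carrier M" using f submodD(1)[OF H] by auto
    then have "finsum M f (insert a A) = f a \<oplus> finsum M f A"
      by (rule M.finsum_insert[OF insert(1,2)])
    then show ?case using submodD(3)[OF H f insert(3)] by simp
  qed
  moreover have "finsum M f A = \<zero>" if "infinite A" for A
    using that by (rule M.finsum_infinite)
  ultimately show ?thesis unfolding fsum_def using submodD(2)[OF H] by (cases "finite {i. f i \<noteq> \<zero>}") auto
qed

lemma additive_Sum_any:
  assumes "finite {i. f i \<noteq> 0}" "h 0 = 0" "\<And>x y. h (x + y) = h x + h y"
  shows "h (Sum_any f) = Sum_any (\<lambda>i. h (f i))"
proof -
  have "h (sum f A) = (\<Sum>i\<in>A. h (f i))" if "finite A" for A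
    using that by (induction rule: finite_induct) (auto simp: assms)
  then have "h (Sum_any f) = (\<Sum>i\<in>{i. f i \<noteq> 0}. h (f i))" using assms(1) by (simp add: Sum_any.expand_set)
  also have "\<dots> = Sum_any (\<lambda>i. h (f i))"
    by (rule Sum_any.expand_superset[symmetric]) (use assms in auto)
  finally show ?thesis .
qed

lemma (in complex_module) fsum_add:
  assumes f: "\<And>i. f i \<in> carrier M" "finite {i. f i \<noteq> \<zero>}" and g: "\<And>i. g i \<in> carrier M" "finite {i. g i \<noteq> \<zero>}"
  shows "fsum M (\<lambda>i. f i \<oplus> g i) = fsum M f \<oplus> fsum M g" and "finite {i. f i \<oplus> g i \<noteq> \<zero>}"
proof -
  show fin: "finite {i. f i \<oplus> g i \<noteq> \<zero>}"
    by (rule finite_subset[OF _ finite_UnI[OF f(2) g(2)]]) auto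
  have c: "{i. coord (f i) \<noteq> 0} = {i. f i \<noteq> \<zero>}" "{i. coord (g i) \<noteq> 0} = {i. g i \<noteq> \<zero>}"
    using f(1) g(1) by (auto simp: coord_eq_0_iff)
  have "coord (fsum M (\<lambda>i. f i \<oplus> g i)) = Sum_any (\<lambda>i. coord (f i) + coord (g i))"
    using coord_fsum[OF _ fin] f(1) g(1) by (simp add: coord_add)
  also have "\<dots> = coord (fsum M f \<oplus> fsum M g)"
    using Sum_any.distrib[of "\<lambda>i. coord (f i)" "\<lambda>i. coord (g i)"] f g
    by (simp add: c coord_add fsum_closed coord_fsum)
  finally show "fsum M (\<lambda>i. f i \<oplus> g i) = fsum M f \<oplus> fsum M g"
    using f(1) g(1) by (subst (asm) coord_eq_iff) (auto intro!: fsum_closed)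
qed

lemma (in complex_module) fsum_smult:
  assumes f: "\<And>i. f i \<in> carrier M" "finite {i. f i \<noteq> \<zero>}"
  shows "fsum M (\<lambda>i. c \<odot> f i) = c \<odot> fsum M f" and "finite {i. c \<odot> f i \<noteq> \<zero>}"
proof -
  show fin: "finite {i. c \<odot> f i \<noteq> \<zero>}"
    by (rule finite_subset[OF _ f(2)]) auto
  have cz: "{i. coord (f i) \<noteq> 0} = {i. f i \<noteq> \<zero>}"
    using f(1) by (auto simp: coord_eq_0_iff)
  have "coord (fsum M (\<lambda>i. c \<odot> f i)) = Sum_any (\<lambda>i. pscale c (coord (f i)))"
    using coord_fsum[OF _ fin] f(1) by (simp add: coord_scale)
  also have "\<dots> = pscale c (Sum_any (\<lambda>i. coord (f i)))"
    by (rule additive_Sum_any[symmetric]) (use f in \<open>simp_all add: cz pm.scale_right_distrib\<close>)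
  also have "\<dots> = coord (c \<odot> fsum M f)"
    using f by (simp add: coord_scale fsum_closed coord_fsum)
  finally show "fsum M (\<lambda>i. c \<odot> f i) = c \<odot> fsum M f"
    using f(1) by (subst (asm) coord_eq_iff) (auto intro!: fsum_closed)
qed

lemma (in complex_module) fsum_delta:
  assumes "x \<in> carrier M"
  shows "fsum M (\<lambda>k. if k = n then x else \<zero>) = x" and "finite {k. (if k = n then x else \<zero>) \<noteq> \<zero>}"
proof -
  show fin: "finite {k. (if k = n then x else \<zero>) \<noteq> \<zero>}"
    by (rule finite_subset[of _ "{n}"]) auto
  have "coord (fsum M (\<lambda>k. if k = n then x else \<zero>)) = Sum_any (\<lambda>k. coord (if k = n then x else \<zero>))"
    by (rule coord_fsum[OF _ fin]) (use assms in simp)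
  also have "\<dots> = Sum_any (\<lambda>k. if k = n then coord x else 0)" by (rule Sum_any.cong) simp
  also have "\<dots> = coord x" by simp
  finally show "fsum M (\<lambda>k. if k = n then x else \<zero>) = x"
    using assms by (subst (asm) coord_eq_iff) (auto intro!: fsum_closed)
qed

text \<open>
  The finite sums with one summand in each \<open>H n\<close> form a submodule that contains every \<open>H n\<close>.
\<close>

lemma (in complex_module) lin_span_family:
  fixes H :: "'i \<Rightarrow> 'v set"
  assumes H: "\<And>n. submodule (H n) CC M" and w: "w \<in> lin_span M (\<Union>n. H n)"
  shows "\<exists>f. (\<forall>n. f n \<in> H n) \<and> finite {n. f n \<noteq> \<zero>} \<and> w = fsum M f"
proof -
  let ?S = "{w. \<exists>f. (\<forall>n. f n \<in> H n) \<and> finite {n. f n \<noteq> \<zero>} \<and> w = fsum M f}"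
  note HD = submodD[OF H]
  have cl: "f i \<in> carrier M" if "\<forall>n. f n \<in> H n" for f i using HD(1) that by blast
  have "submodule ?S CC M"
  proof (rule submodI)
    show "?S \<subseteq> carrier M" using cl fsum_closed by blast
    have "fsum M (\<lambda>n::'i. \<zero>) = \<zero>" by (simp add: fsum_def)
    then show "\<zero> \<in> ?S" using HD(2) by (intro CollectI exI[of _ "\<lambda>n. \<zero>"]) simp
  next
    fix u v assume "u \<in> ?S" "v \<in> ?S"
    then obtain f g where f: "\<forall>n. f n \<in> H n" "finite {n. f n \<noteq> \<zero>}" "u = fsum M f"
      and g: "\<forall>n. g n \<in> H n" "finite {n. g n \<noteq> \<zero>}" "v = fsum M g" by blast
    note fg = fsum_add[OF cl[OF f(1)] f(2) cl[OF g(1)] g(2)]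
    have "\<forall>n. f n \<oplus> g n \<in> H n" using f(1) g(1) HD(3) by blast
    then show "u \<oplus> v \<in> ?S"
      by (intro CollectI exI[of _ "\<lambda>i. f i \<oplus> g i"]) (simp only: fg f(3) g(3) simp_thms)
  next
    fix c u assume "u \<in> ?S"
    then obtain f where f: "\<forall>n. f n \<in> H n" "finite {n. f n \<noteq> \<zero>}" "u = fsum M f" by blast
    note fg = fsum_smult[OF cl[OF f(1)] f(2), of c]
    have "\<forall>n. c \<odot> f n \<in> H n" using f(1) HD(4) by blast
    then show "c \<odot> u \<in> ?S"
      by (intro CollectI exI[of _ "\<lambda>i. c \<odot> f i"]) (simp only: fg f(3) simp_thms)
  qed
  moreover have "(\<Union>n. H n) \<subseteq> ?S"
  proof
    fix x assume "x \<in> (\<Union>n. H n)"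
    then obtain n where n: "x \<in> H n" by blast
    then have x: "x \<in> carrier M" using HD(1) by blast
    show "x \<in> ?S"
      by (intro CollectI exI[of _ "\<lambda>k. if k = n then x else \<zero>"])
         (use fsum_delta[OF x, of n] n HD(2) in auto)
  qed
  ultimately have "lin_span M (\<Union>n. H n) \<subseteq> ?S" by (rule lin_span_minimal)
  then show ?thesis using w by blast
qed

section \<open>Quotients\<close>

lemma coset_map_coset:
  assumes "abelian_subgroup N1 U" "x \<in> carrier U"
    "\<And>y. y \<in> N1 +>\<^bsub>U\<^esub> x \<Longrightarrow> N +>\<^bsub>M\<^esub> f y = N +>\<^bsub>M\<^esub> f x"
  shows "coset_map M N f (N1 +>\<^bsub>U\<^esub> x) = N +>\<^bsub>M\<^esub> f x"
  using abelian_subgroup.a_rcos_self[OF assms(1,2)] assms(3) unfolding coset_map_def by blast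

locale quotient = complex_module M for M :: "(complex, 'v) module" (structure) +
  fixes N
  assumes N: "submodule N CC M"
begin

sublocale abelian_subgroup N M
  by (rule submod_abelian_subgroup[OF N])

definition cl where "cl x = N +> x"

lemma cl_in: "x \<in> carrier M \<Longrightarrow> y \<in> cl x \<Longrightarrow> y \<in> carrier M \<and> cl y = cl x"
  using M.a_r_coset_subset_G[OF a_subset, of x] M.a_repr_independence[OF _ _ a_subgroup, of y x]
  unfolding cl_def by blast

lemma cl_eq_iff:
  assumes x: "x \<in> carrier M" and y: "y \<in> carrier M"
  shows "cl x = cl y \<longleftrightarrow> x \<ominus> y \<in> N"
proof
  assume "cl x = cl y"
  then have "x \<in> N +> y" using a_rcos_self[OF x] by (simp add: cl_def)
  then obtain h where h: "h \<in> N" "x = h \<oplus> y" by (auto simp: a_r_coset_def')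
  then have "x \<ominus> y = h" using y a_subset by (auto simp: a_minus_def M.a_assoc M.r_neg)
  then show "x \<ominus> y \<in> N" using h by simp
next
  assume *: "x \<ominus> y \<in> N"
  have "(x \<ominus> y) \<oplus> y = x" using x y by (simp add: a_minus_def M.a_assoc M.l_neg)
  then have "x \<in> N +> y" using M.a_rcosI[OF * a_subset y] by simp
  then show "cl x = cl y" using cl_in[OF y] by (simp add: cl_def)
qed

lemma quot_carrier: "carrier (quot_module M N) = cl ` carrier M"
  by (auto simp: quot_module_def A_RCOSETS_def' cl_def)

lemma quot_add: "x \<in> carrier M \<Longrightarrow> y \<in> carrier M \<Longrightarrow> cl x \<oplus>\<^bsub>quot_module M N\<^esub> cl y = cl (x \<oplus> y)"
  by (simp add: quot_module_def cl_def a_rcos_sum)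

lemma quot_zero: "\<zero>\<^bsub>quot_module M N\<^esub> = cl \<zero>"
  by (simp add: quot_module_def cl_def M.a_coset_add_zero a_subset)

lemma quot_smult:
  assumes "x \<in> carrier M" shows "c \<odot>\<^bsub>quot_module M N\<^esub> cl x = cl (c \<odot> x)"
proof -
  have "coset_map M N (\<lambda>x. c \<odot> x) (N +> x) = N +> (c \<odot> x)"
  proof (rule coset_map_coset[OF abelian_subgroup_axioms assms])
    fix y assume "y \<in> N +> x"
    then have y: "y \<in> carrier M" "y \<ominus> x \<in> N" using cl_in[OF assms, of y] cl_eq_iff[of y x] assms by (auto simp: cl_def)
    have "c \<odot> y \<ominus> c \<odot> x = c \<odot> (y \<ominus> x)"
      using y(1) assms by (simp add: a_minus_def smult_r_distr smult_r_minus)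
    then have "c \<odot> y \<ominus> c \<odot> x \<in> N" using submodD(4)[OF N y(2)] by simp
    then show "N +> c \<odot> y = N +> c \<odot> x" using cl_eq_iff[of "c \<odot> y" "c \<odot> x"] y assms by (simp add: cl_def)
  qed
  then show ?thesis by (simp add: quot_module_def cl_def)
qed

lemma quot_complex_module: "complex_module (quot_module M N)"
proof -
  let ?Q = "quot_module M N"
  have ab: "abelian_group ?Q"
  proof (rule abelian_groupI)
    fix x assume "x \<in> carrier ?Q"
    then obtain a where a: "a \<in> carrier M" "x = cl a" by (auto simp: quot_carrier)
    then have "cl (\<ominus> a) \<oplus>\<^bsub>?Q\<^esub> x = \<zero>\<^bsub>?Q\<^esub>" by (simp add: quot_add quot_zero M.l_neg)
    then show "\<exists>y\<in>carrier ?Q. y \<oplus>\<^bsub>?Q\<^esub> x = \<zero>\<^bsub>?Q\<^esub>" using a by (auto simp: quot_carrier)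
  qed (auto simp: quot_carrier quot_zero quot_add M.a_ac)
  show ?thesis
    unfolding complex_module_def
    by (rule moduleI) (auto simp: ab cring_from_type_algebra quot_carrier quot_add quot_smult
        smult_l_distr' smult_r_distr smult_assoc')
qed

lemma cl_mlinear: "mlinear M (quot_module M N) cl"
  by (auto simp: mlinear_def quot_carrier quot_add quot_smult)

end

text \<open>
  As \<open>f\<close> maps \<open>N1\<close> into \<open>N\<close>, it sends a coset of \<open>N1\<close> into a single coset of \<open>N\<close>, so the union that
  defines \<open>coset_map\<close> is that coset.
\<close>

lemma coset_map_mlinear:
  assumes Q1: "quotient U N1" and Q2: "quotient M N" and f: "mlinear U M f" and sub: "\<And>x. x \<in> N1 \<Longrightarrow> f x \<in> N"
  shows "mlinear (quot_module U N1) (quot_module M N) (coset_map M N f)"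
    "x \<in> carrier U \<Longrightarrow> coset_map M N f (quotient.cl U N1 x) = quotient.cl M N (f x)"
proof -
  interpret U: quotient U N1 by fact
  interpret M: quotient M N by fact
  have eq: "coset_map M N f (U.cl x) = M.cl (f x)" if x: "x \<in> carrier U" for x
    unfolding U.cl_def M.cl_def
  proof (rule coset_map_coset[OF U.abelian_subgroup_axioms x])
    fix y assume "y \<in> N1 +>\<^bsub>U\<^esub> x"
    then have y: "y \<in> carrier U" "y \<ominus>\<^bsub>U\<^esub> x \<in> N1"
      using U.cl_in[OF x, of y] U.cl_eq_iff[of y x] x by (auto simp: U.cl_def)
    have "f y \<ominus>\<^bsub>M\<^esub> f x \<in> N"
      using sub[OF y(2)] mlinear_minus[OF U.complex_module_axioms M.complex_module_axioms f y(1) x] by simp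
    then show "N +>\<^bsub>M\<^esub> f y = N +>\<^bsub>M\<^esub> f x"
      using M.cl_eq_iff[of "f y" "f x"] y x mlinearD(1)[OF f] by (simp add: M.cl_def)
  qed
  then show "x \<in> carrier U \<Longrightarrow> coset_map M N f (U.cl x) = M.cl (f x)" .
  show "mlinear (quot_module U N1) (quot_module M N) (coset_map M N f)"
    by (auto simp: mlinear_def U.quot_carrier M.quot_carrier eq mlinearD[OF f] U.quot_add M.quot_add U.quot_smult M.quot_smult)
qed

section \<open>Free vector spaces\<close>

lemma free_vs_simps [simp]:
  "p \<oplus>\<^bsub>free_vs S\<^esub> q = (\<lambda>x. p x + q x)" "\<zero>\<^bsub>free_vs S\<^esub> = (\<lambda>x. 0)" "c \<odot>\<^bsub>free_vs S\<^esub> p = (\<lambda>x. c * p x)"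
  by (simp_all add: free_vs_def)

lemma free_vs_carrier: "p \<in> carrier (free_vs S) \<longleftrightarrow> finite {x. p x \<noteq> 0} \<and> {x. p x \<noteq> 0} \<subseteq> S"
  by (simp add: free_vs_def)

lemma free_vs_complex_module: "complex_module (free_vs S)"
proof -
  have add: "(\<lambda>x. p x + q x) \<in> carrier (free_vs S)" if "p \<in> carrier (free_vs S)" "q \<in> carrier (free_vs S)" for p q
  proof -
    have "{x. p x + q x \<noteq> 0} \<subseteq> {x. p x \<noteq> 0} \<union> {x. q x \<noteq> 0}" by auto
    then show ?thesis using that unfolding free_vs_carrier by (metis (no_types, lifting) Un_least finite_UnI finite_subset order_trans)
  qed
  have sc: "(\<lambda>x. c * p x) \<in> carrier (free_vs S)" if "p \<in> carrier (free_vs S)" for p c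
    using that unfolding free_vs_carrier by (auto intro: finite_subset)
  have "abelian_group (free_vs S)"
  proof (rule abelian_groupI)
    fix p assume p: "p \<in> carrier (free_vs S)"
    show "\<exists>q\<in>carrier (free_vs S). q \<oplus>\<^bsub>free_vs S\<^esub> p = \<zero>\<^bsub>free_vs S\<^esub>"
      by (rule bexI[OF _ sc[OF p, of "-1"]]) simp
  qed (auto simp: add algebra_simps, auto simp: free_vs_carrier)
  then show ?thesis
    unfolding complex_module_def
    by (intro moduleI) (auto simp: cring_from_type_algebra sc algebra_simps)
qed

lemma delta_carrier [simp]: "delta x \<in> carrier (free_vs S) \<longleftrightarrow> x \<in> S"
  by (auto simp: free_vs_carrier delta_def)

lemma free_vs_submodule_all:
  assumes H: "submodule H CC (free_vs S)" and d: "\<And>x. x \<in> S \<Longrightarrow> delta x \<in> H"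
    and p: "p \<in> carrier (free_vs S)"
  shows "p \<in> H"
proof -
  interpret complex_module "free_vs S" by (rule free_vs_complex_module)
  have "\<forall>p. {x. p x \<noteq> (0::complex)} \<subseteq> A \<longrightarrow> p \<in> H" if "finite A" "A \<subseteq> S" for A
    using that
  proof (induction A rule: finite_induct)
    case empty
    have "p \<in> H" if "\<forall>x. p x = (0::complex)" for p
    proof -
      have "p = (\<lambda>x. 0)" using that by auto
      then show ?thesis using submodD(2)[OF H] by simp
    qed
    then show ?case by auto
  next
    case (insert a A)
    show ?case
    proof (intro allI impI)
      fix p :: "'a \<Rightarrow> complex" assume p: "{x. p x \<noteq> 0} \<subseteq> insert a A"
      define q where "q = p(a := 0)"
      have "{x. q x \<noteq> 0} \<subseteq> A" using p by (auto simp: q_def)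
      then have "q \<in> H" using insert by blast
      moreover have "(\<lambda>x. p a * delta a x) \<in> H"
        using submodD(4)[OF H d[of a], of "p a"] insert by simp
      ultimately have "(\<lambda>x. q x + p a * delta a x) \<in> H" using submodD(3)[OF H] by simp
      moreover have "(\<lambda>x. q x + p a * delta a x) = p" by (auto simp: q_def delta_def)
      ultimately show "p \<in> H" by simp
    qed
  qed
  then show ?thesis using p unfolding free_vs_carrier by blast
qed

text \<open>
  A map between bases extends linearly. The action on the induced module is given by this formula.
\<close>

lemma free_map:
  assumes g: "\<And>x. x \<in> S \<Longrightarrow> g x \<in> T"
  defines "L \<equiv> \<lambda>p. fsum (free_vs T) (\<lambda>x. p x \<odot>\<^bsub>free_vs T\<^esub> delta (g x))"
  shows "mlinear (free_vs S) (free_vs T) L" "x \<in> S \<Longrightarrow> L (delta x) = delta (g x)"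
proof -
  interpret T: complex_module "free_vs T" by (rule free_vs_complex_module)
  have cl: "(\<lambda>y. p x * delta (g x) y) \<in> carrier (free_vs T)" if "p \<in> carrier (free_vs S)" for p x
    using that g[of x] unfolding free_vs_carrier by (auto simp: delta_def)
  have fin: "finite {x. (\<lambda>y. p x * delta (g x) y) \<noteq> (\<lambda>x. 0)}" if "p \<in> carrier (free_vs S)" for p
    by (rule finite_subset[of _ "{x. p x \<noteq> 0}"]) (use that in \<open>auto simp: free_vs_carrier\<close>)
  have ev: "L p y = Sum_any (\<lambda>x. p x * delta (g x) y)" if "p \<in> carrier (free_vs S)" for p y
    unfolding L_def using T.additive_fsum[of "\<lambda>x. p x \<odot>\<^bsub>free_vs T\<^esub> delta (g x)" "\<lambda>f. f y"] cl[OF that] fin[OF that]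
    by simp
  have finy: "finite {x. p x * delta (g x) y \<noteq> 0}" if "p \<in> carrier (free_vs S)" for p y
    by (rule finite_subset[of _ "{x. p x \<noteq> 0}"]) (use that in \<open>auto simp: free_vs_carrier\<close>)
  interpret S: complex_module "free_vs S" by (rule free_vs_complex_module)
  have Lc: "L p \<in> carrier (free_vs T)" if "p \<in> carrier (free_vs S)" for p
    unfolding L_def by (rule T.fsum_closed) (use cl[OF that] in simp)
  show "mlinear (free_vs S) (free_vs T) L"
    unfolding mlinear_def
  proof (intro conjI ballI allI)
    fix p q assume p: "p \<in> carrier (free_vs S)" and q: "q \<in> carrier (free_vs S)"
    show "L (p \<oplus>\<^bsub>free_vs S\<^esub> q) = L p \<oplus>\<^bsub>free_vs T\<^esub> L q"
    proof
      fix y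
      have "L (p \<oplus>\<^bsub>free_vs S\<^esub> q) y = Sum_any (\<lambda>x. p x * delta (g x) y + q x * delta (g x) y)"
        by (subst ev) (use p q S.add.m_closed[OF p q] in \<open>simp_all add: algebra_simps\<close>)
      also have "\<dots> = L p y + L q y"
        by (simp only: Sum_any.distrib[OF finy[OF p] finy[OF q]] ev[OF p] ev[OF q])
      finally show "L (p \<oplus>\<^bsub>free_vs S\<^esub> q) y = (L p \<oplus>\<^bsub>free_vs T\<^esub> L q) y" by simp
    qed
  next
    fix p c assume p: "p \<in> carrier (free_vs S)"
    show "L (c \<odot>\<^bsub>free_vs S\<^esub> p) = c \<odot>\<^bsub>free_vs T\<^esub> L p"
    proof
      fix y
      have "L (c \<odot>\<^bsub>free_vs S\<^esub> p) y = Sum_any (\<lambda>x. c * (p x * delta (g x) y))"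
        by (subst ev) (use p S.smult_cl[OF p, of c] in \<open>simp_all add: algebra_simps\<close>)
      also have "\<dots> = c * L p y"
        by (simp only: Sum_any_right_distrib[OF finy[OF p]] ev[OF p])
      finally show "L (c \<odot>\<^bsub>free_vs S\<^esub> p) y = (c \<odot>\<^bsub>free_vs T\<^esub> L p) y" by simp
    qed
  qed (rule Lc)
  show "L (delta x) = delta (g x)" if x: "x \<in> S" for x
  proof
    fix y
    have "L (delta x) y = Sum_any (\<lambda>z. if z = x then delta (g z) y else 0)"
    proof (subst ev)
      have "delta x z * delta (g z) y = (if z = x then delta (g z) y else 0)" for z
        by (simp add: delta_def)
      then show "Sum_any (\<lambda>z. delta x z * delta (g z) y) = Sum_any (\<lambda>z. if z = x then delta (g z) y else 0)" by simp
    qed (use x in simp)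
    then show "L (delta x) y = delta (g x) y" by simp
  qed
qed

lemma complex_module_cong:
  assumes "complex_module M" "carrier N = carrier M" "add N = add M" "ring.zero N = ring.zero M"
    "module.smult N = module.smult M"
  shows "complex_module N"
  using assms unfolding complex_module_def module_def module_axioms_def abelian_group_def abelian_monoid_def
    abelian_group_axioms_def by simp

section \<open>The free associative algebra\<close>

text \<open>
  The product of the free algebra: the coefficient of a word collects all ways to cut it in two.
\<close>

definition conv :: "('g list \<Rightarrow> complex) \<Rightarrow> ('g list \<Rightarrow> complex) \<Rightarrow> 'g list \<Rightarrow> complex" where
  "conv p q = (\<lambda>w. \<Sum>i\<le>length w. p (take i w) * q (drop i w))"

lemma free_alg_simps [simp]:
  "carrier (free_alg S) = carrier (free_vs (lists S))"
  "p \<oplus>\<^bsub>free_alg S\<^esub> q = (\<lambda>x. p x + q x)" "\<zero>\<^bsub>free_alg S\<^esub> = (\<lambda>x. 0)" "c \<odot>\<^bsub>free_alg S\<^esub> p = (\<lambda>x. c * p x)"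
  "p \<otimes>\<^bsub>free_alg S\<^esub> q = conv p q" "\<one>\<^bsub>free_alg S\<^esub> = delta []"
  by (simp_all add: free_alg_def conv_def free_vs_def)

lemma free_alg_complex_module: "complex_module (free_alg S)"
  by (rule complex_module_cong[OF free_vs_complex_module[of "lists S"]]) (simp_all add: free_alg_def)

lemma setcompr_cong2:
  assumes "\<And>x y. P x y \<Longrightarrow> f x y = g x y"
  shows "{f x y | x y. P x y} = {g x y | x y. P x y}"
  using assms by force

lemma setcompr_mono2:
  assumes "\<And>x y. P x y \<Longrightarrow> Q x y"
  shows "{f x y | x y. P x y} \<subseteq> {f x y | x y. Q x y}"
  using assms by blast

lemma conv_add_left: "conv (\<lambda>w. p w + q w) r = (\<lambda>w. conv p r w + conv q r w)"
  and conv_add_right: "conv r (\<lambda>w. p w + q w) = (\<lambda>w. conv r p w + conv r q w)"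
  by (simp_all add: conv_def algebra_simps sum.distrib sum_subtractf)

lemma conv_scale_left: "conv (\<lambda>w. c * p w) r = (\<lambda>w. c * conv p r w)"
  and conv_scale_right: "conv r (\<lambda>w. c * p w) = (\<lambda>w. c * conv r p w)"
  by (simp_all add: conv_def sum_distrib_left mult_ac)

lemma conv_assoc: "conv (conv p q) r = conv p (conv q r)"
proof
  fix w :: "'a list"
  let ?n = "length w"
  let ?F = "\<lambda>i j. p (take j w) * q (drop j (take i w)) * r (drop i w)"
  have "conv (conv p q) r w = (\<Sum>i\<le>?n. \<Sum>j\<le>i. ?F i j)"
    unfolding conv_def by (rule sum.cong) (auto simp: sum_distrib_right min_def intro!: sum.cong)
  also have "\<dots> = (\<Sum>(i, j)\<in>(SIGMA i:{..?n}. {..i}). ?F i j)"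
    by (simp add: sum.Sigma)
  also have "\<dots> = (\<Sum>(j, k)\<in>(SIGMA j:{..?n}. {..?n - j}). ?F (j + k) j)"
    by (rule sum.reindex_bij_witness[of _ "\<lambda>(j, k). (j + k, j)" "\<lambda>(i, j). (j, i - j)"]) auto
  also have "\<dots> = (\<Sum>j\<le>?n. \<Sum>k\<le>?n - j. ?F (j + k) j)"
    by (simp add: sum.Sigma)
  also have "\<dots> = conv p (conv q r) w"
    unfolding conv_def
    by (rule sum.cong) (auto simp: sum_distrib_left drop_take mult_ac add.commute intro!: sum.cong)
  finally show "conv (conv p q) r w = conv p (conv q r) w" .
qed

lemma conv_delta: "conv (delta u) (delta v) = delta (u @ v)"
proof
  fix w
  have *: "delta u (take i w) * delta v (drop i w) = (if i = length u then delta (u @ v) w else 0)"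
    if "i \<le> length w" for i
  proof (cases "w = u @ v")
    case True
    then have "take i w = u \<longleftrightarrow> i = length u"
      using that by (metis append_eq_conv_conj length_take min_absorb2)
    then show ?thesis using True by (auto simp: delta_def)
  next
    case False
    then have "\<not> (take i w = u \<and> drop i w = v)" using append_take_drop_id[of i w] by auto
    then show ?thesis using False by (auto simp: delta_def)
  qed
  have "conv (delta u) (delta v) w = (\<Sum>i\<le>length w. if i = length u then delta (u @ v) w else 0)"
    unfolding conv_def by (rule sum.cong) (simp_all add: *)
  also have "\<dots> = delta (u @ v) w"
    by (auto simp: delta_def)
  finally show "conv (delta u) (delta v) w = delta (u @ v) w" .
qed

lemma conv_one_left: "conv (delta []) p = p"
proof
  fix w
  have "conv (delta []) p w = (\<Sum>i\<le>length w. if i = 0 then p w else 0)"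
    unfolding conv_def by (rule sum.cong) (auto simp: delta_def)
  then show "conv (delta []) p w = p w" by simp
qed

lemma conv_one_right: "conv p (delta []) = p"
proof
  fix w
  have "conv p (delta []) w = (\<Sum>i\<le>length w. if i = length w then p w else 0)"
    unfolding conv_def by (rule sum.cong) (auto simp: delta_def)
  then show "conv p (delta []) w = p w" by simp
qed

lemma conv_closed:
  assumes p: "p \<in> carrier (free_vs (lists S))" and q: "q \<in> carrier (free_vs (lists S))"
  shows "conv p q \<in> carrier (free_vs (lists S))"
proof -
  let ?A = "(\<lambda>(u, v). u @ v) ` ({w. p w \<noteq> 0} \<times> {w. q w \<noteq> 0})"
  have sub: "{w. conv p q w \<noteq> 0} \<subseteq> ?A"
  proof
    fix w assume "w \<in> {w. conv p q w \<noteq> 0}"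
    then obtain i where "p (take i w) * q (drop i w) \<noteq> 0"
      unfolding conv_def by (auto elim: sum.not_neutral_contains_not_neutral)
    then show "w \<in> ?A" by (intro image_eqI[of _ _ "(take i w, drop i w)"]) auto
  qed
  moreover have "finite ?A" using p q by (auto simp: free_vs_carrier)
  moreover have "?A \<subseteq> lists S"
  proof -
    have "u \<in> lists S" "v \<in> lists S" if "p u \<noteq> 0" "q v \<noteq> 0" for u v
      using p q that unfolding free_vs_carrier by blast+
    note * = this
    show ?thesis
    proof
      fix w assume "w \<in> ?A"
      then obtain u v where "w = u @ v" "p u \<noteq> 0" "q v \<noteq> 0" by auto
      then show "w \<in> lists S" by (metis * append_in_lists_conv)
    qed
  qed
  ultimately show ?thesis unfolding free_vs_carrier by (meson finite_subset order_trans)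
qed

lemma free_alg_ring: "ring (free_alg S)"
proof -
  interpret complex_module "free_alg S" by (rule free_alg_complex_module)
  show ?thesis
  proof (rule ringI)
    show "abelian_group (free_alg S)" by (rule M.abelian_group_axioms)
    show "Group.monoid (free_alg S)"
      by (rule monoidI) (simp_all add: conv_closed conv_assoc conv_one_left conv_one_right)
  qed (simp_all add: conv_add_left conv_add_right)
qed

lemma free_alg_minus:
  assumes "p \<in> carrier (free_vs (lists S))" "q \<in> carrier (free_vs (lists S))"
  shows "p \<ominus>\<^bsub>free_alg S\<^esub> q = (\<lambda>x. p x - q x)"
proof -
  interpret complex_module "free_alg S" by (rule free_alg_complex_module)
  show ?thesis using assms by (simp add: a_minus_def smult_minus1[symmetric])
qed

lemma free_alg_idealI:
  assumes sub: "submodule I CC (free_alg S)"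
    and l: "\<And>a x. a \<in> I \<Longrightarrow> x \<in> carrier (free_vs (lists S)) \<Longrightarrow> conv x a \<in> I"
    and r: "\<And>a x. a \<in> I \<Longrightarrow> x \<in> carrier (free_vs (lists S)) \<Longrightarrow> conv a x \<in> I"
  shows "ideal I (free_alg S)"
  by (rule idealI[OF free_alg_ring submodule.axioms(1)[OF sub]]) (simp_all add: l r)

section \<open>Universal enveloping algebras\<close>

locale bracket_space = G: complex_module G for G :: "(complex, 'g) module" (structure) +
  fixes br :: "'g \<Rightarrow> 'g \<Rightarrow> 'g"
  assumes br_closed: "x \<in> carrier G \<Longrightarrow> y \<in> carrier G \<Longrightarrow> br x y \<in> carrier G"
begin

abbreviation FA where "FA \<equiv> free_alg (carrier G)"
abbreviation JJ where "JJ \<equiv> uea_ideal G br"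
abbreviation UU where "UU \<equiv> uea G br"

sublocale F: complex_module FA by (rule free_alg_complex_module)

text \<open>
  The defining relations of the enveloping algebra, with the operations of the free algebra written out
  as functions on words.
\<close>

definition rels :: "('g list \<Rightarrow> complex) set" where
  "rels = {\<lambda>w. delta [x \<oplus> y] w - (delta [x] w + delta [y] w) | x y. x \<in> carrier G \<and> y \<in> carrier G} \<union>
     {\<lambda>w. delta [c \<odot> x] w - c * delta [x] w | c x. x \<in> carrier G} \<union>
     {\<lambda>w. (delta [x, y] w - delta [y, x] w) - delta [br x y] w | x y. x \<in> carrier G \<and> y \<in> carrier G}"

lemma JJ_eq: "JJ = genideal FA rels"
proof -
  have d: "delta [x] \<in> carrier (free_vs (lists (carrier G)))" if "x \<in> carrier G" for x
    using that by simp
  have d2: "delta [x, y] \<in> carrier (free_vs (lists (carrier G)))" if "x \<in> carrier G" "y \<in> carrier G" for x y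
    using that by simp
  have a: "(\<lambda>w. p w + q w) \<in> carrier (free_vs (lists (carrier G)))"
    if "p \<in> carrier (free_vs (lists (carrier G)))" "q \<in> carrier (free_vs (lists (carrier G)))" for p q
    using F.add.m_closed[of p q] that by simp
  have s: "(\<lambda>w. c * p w) \<in> carrier (free_vs (lists (carrier G)))"
    if "p \<in> carrier (free_vs (lists (carrier G)))" for p c
    using F.smult_cl[of p c] that by simp
  have m: "(\<lambda>w. p w - q w) \<in> carrier (free_vs (lists (carrier G)))"
    if "p \<in> carrier (free_vs (lists (carrier G)))" "q \<in> carrier (free_vs (lists (carrier G)))" for p q
    using F.M.minus_closed[of p q] that by (simp add: free_alg_minus)
  have 1: "delta [x \<oplus> y] \<ominus>\<^bsub>FA\<^esub> (delta [x] \<oplus>\<^bsub>FA\<^esub> delta [y]) = (\<lambda>w. delta [x \<oplus> y] w - (delta [x] w + delta [y] w))"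
    if "x \<in> carrier G" "y \<in> carrier G" for x y
    using free_alg_minus[OF d[of "x \<oplus> y"] a[OF d[of x] d[of y]]] that by simp
  have 2: "delta [c \<odot> x] \<ominus>\<^bsub>FA\<^esub> c \<odot>\<^bsub>FA\<^esub> delta [x] = (\<lambda>w. delta [c \<odot> x] w - c * delta [x] w)"
    if "x \<in> carrier G" for c x
    using free_alg_minus[OF d[of "c \<odot> x"] s[OF d[of x], of c]] that by simp
  have 3: "(delta [x] \<otimes>\<^bsub>FA\<^esub> delta [y] \<ominus>\<^bsub>FA\<^esub> delta [y] \<otimes>\<^bsub>FA\<^esub> delta [x]) \<ominus>\<^bsub>FA\<^esub> delta [br x y]
     = (\<lambda>w. (delta [x, y] w - delta [y, x] w) - delta [br x y] w)"
    if "x \<in> carrier G" "y \<in> carrier G" for x y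
    using free_alg_minus[OF m[OF d2[of x y] d2[of y x]] d[of "br x y"]] free_alg_minus[OF d2[of x y] d2[of y x]] that br_closed[of x y]
    by (simp add: conv_delta)
  show ?thesis
    unfolding uea_ideal_def Let_def rels_def
    by (rule arg_cong[where f = "genideal FA"], rule arg_cong2[where f = "(\<union>)"],
        rule arg_cong2[where f = "(\<union>)"])
       (rule setcompr_cong2, rule 1, blast, blast, rule setcompr_cong2, rule 2, blast, rule setcompr_cong2, rule 3, blast, blast)
qed

lemma FA_closed:
  "p \<in> carrier FA \<Longrightarrow> q \<in> carrier FA \<Longrightarrow> (\<lambda>w. p w + q w) \<in> carrier FA"
  "p \<in> carrier FA \<Longrightarrow> (\<lambda>w. c * p w) \<in> carrier FA"
  "p \<in> carrier FA \<Longrightarrow> q \<in> carrier FA \<Longrightarrow> (\<lambda>w. p w - q w) \<in> carrier FA"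
  "x \<in> carrier G \<Longrightarrow> delta [x] \<in> carrier FA"
  using F.add.m_closed[of p q] F.smult_cl[of p c] F.M.minus_closed[of p q]
  by (simp_all add: free_alg_minus)

lemma rels_carrier: "rels \<subseteq> carrier FA"
proof -
  have d: "delta [x, y] \<in> carrier FA" if "x \<in> carrier G" "y \<in> carrier G" for x y using that by simp
  show ?thesis
    unfolding rels_def by (auto simp del: free_alg_simps intro!: FA_closed d br_closed)
qed

lemma JJ_ideal: "ideal JJ FA"
  unfolding JJ_eq by (rule ring.genideal_ideal[OF free_alg_ring rels_carrier])

lemma rels_JJ: "rels \<subseteq> JJ"
  unfolding JJ_eq by (rule ring.genideal_self[OF free_alg_ring rels_carrier])

lemma JJ_minimal: "ideal I FA \<Longrightarrow> rels \<subseteq> I \<Longrightarrow> JJ \<subseteq> I"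
  unfolding JJ_eq by (rule ring.genideal_minimal[OF free_alg_ring])

lemma ideal_submodule: "ideal I FA \<Longrightarrow> submodule I CC FA"
proof (rule F.submodI)
  assume I: "ideal I FA"
  interpret I: ideal I FA by (rule I)
  show "I \<subseteq> carrier FA" by (rule I.a_subset)
  show "\<zero>\<^bsub>FA\<^esub> \<in> I" by (rule additive_subgroup.zero_closed[OF I.is_additive_subgroup])
  show "a \<oplus>\<^bsub>FA\<^esub> b \<in> I" if "a \<in> I" "b \<in> I" for a b using I.a_closed[OF that] .
  show "c \<odot>\<^bsub>FA\<^esub> x \<in> I" if x: "x \<in> I" for c x
  proof -
    have "(\<lambda>w. c * delta [] w) \<in> carrier FA" using F.smult_cl[of "delta []" c] by simp
    from I.I_l_closed[OF x this] show ?thesis by (simp add: conv_scale_left conv_one_left)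
  qed
qed

lemma JJ_submodule: "submodule JJ CC FA"
  by (rule ideal_submodule[OF JJ_ideal])

sublocale Q: quotient FA JJ
  by (intro quotient.intro quotient_axioms.intro F.complex_module_axioms JJ_submodule)

lemma UU_simps:
  "carrier UU = carrier (quot_module FA JJ)" "add UU = add (quot_module FA JJ)"
  "ring.zero UU = ring.zero (quot_module FA JJ)" "module.smult UU = module.smult (quot_module FA JJ)"
  "monoid.mult UU = rcoset_mult FA JJ" "monoid.one UU = JJ +>\<^bsub>FA\<^esub> \<one>\<^bsub>FA\<^esub>"
  by (simp_all add: uea_def Let_def quot_module_def FactRing_def del: free_alg_simps)

lemma UU_complex_module: "complex_module UU"
  by (rule complex_module_cong[OF Q.quot_complex_module]) (simp_all add: UU_simps)

sublocale U: complex_module UU by (rule UU_complex_module)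

lemma UU_carrier: "carrier UU = Q.cl ` carrier FA"
  by (simp add: UU_simps Q.quot_carrier)

lemma UU_add: "p \<in> carrier FA \<Longrightarrow> q \<in> carrier FA \<Longrightarrow> Q.cl p \<oplus>\<^bsub>UU\<^esub> Q.cl q = Q.cl (\<lambda>w. p w + q w)"
  using Q.quot_add[of p q] by (simp add: UU_simps)

lemma UU_smult: "p \<in> carrier FA \<Longrightarrow> c \<odot>\<^bsub>UU\<^esub> Q.cl p = Q.cl (\<lambda>w. c * p w)"
  using Q.quot_smult[of p c] by (simp add: UU_simps)

lemma UU_mult: "p \<in> carrier FA \<Longrightarrow> q \<in> carrier FA \<Longrightarrow> Q.cl p \<otimes>\<^bsub>UU\<^esub> Q.cl q = Q.cl (conv p q)"
  using ideal.rcoset_mult_add[OF JJ_ideal, of p q] by (simp add: UU_simps Q.cl_def)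

lemma UU_one: "\<one>\<^bsub>UU\<^esub> = Q.cl (delta [])"
  by (simp add: UU_simps Q.cl_def)

lemma Q_cl_eq: "p \<in> carrier FA \<Longrightarrow> q \<in> carrier FA \<Longrightarrow> Q.cl p = Q.cl q \<longleftrightarrow> (\<lambda>w. p w - q w) \<in> JJ"
  using Q.cl_eq_iff[of p q] by (simp add: free_alg_minus)

lemma Q_cl_mlinear: "mlinear FA UU Q.cl"
  by (auto simp: mlinear_def UU_carrier UU_add UU_smult)

lemma UU_mult_closed: "u \<in> carrier UU \<Longrightarrow> v \<in> carrier UU \<Longrightarrow> u \<otimes>\<^bsub>UU\<^esub> v \<in> carrier UU"
  by (auto simp: UU_carrier UU_mult conv_closed)

lemma UU_one_closed: "\<one>\<^bsub>UU\<^esub> \<in> carrier UU"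
  by (auto simp: UU_carrier UU_one)

lemma UU_mult_assoc:
  "u \<in> carrier UU \<Longrightarrow> v \<in> carrier UU \<Longrightarrow> w \<in> carrier UU \<Longrightarrow> (u \<otimes>\<^bsub>UU\<^esub> v) \<otimes>\<^bsub>UU\<^esub> w = u \<otimes>\<^bsub>UU\<^esub> (v \<otimes>\<^bsub>UU\<^esub> w)"
  by (auto simp: UU_carrier UU_mult conv_closed conv_assoc)

lemma UU_one_left: "u \<in> carrier UU \<Longrightarrow> \<one>\<^bsub>UU\<^esub> \<otimes>\<^bsub>UU\<^esub> u = u"
  and UU_one_right: "u \<in> carrier UU \<Longrightarrow> u \<otimes>\<^bsub>UU\<^esub> \<one>\<^bsub>UU\<^esub> = u"
  by (auto simp: UU_carrier UU_one UU_mult conv_one_left conv_one_right)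

lemma conv_FA: "p \<in> carrier FA \<Longrightarrow> q \<in> carrier FA \<Longrightarrow> conv p q \<in> carrier FA"
  by (simp add: conv_closed)

lemma UU_lmult_mlinear:
  assumes "u \<in> carrier UU" shows "mlinear UU UU (\<lambda>v. u \<otimes>\<^bsub>UU\<^esub> v)"
proof -
  obtain r where r: "r \<in> carrier FA" "u = Q.cl r" using assms UU_carrier by blast
  have "mlinear FA FA (conv r)"
    using r(1) conv_FA by (auto simp: mlinear_def conv_add_right conv_scale_right)
  then show ?thesis
    by (intro mlinear_descend[OF F.complex_module_axioms Q_cl_mlinear UU_carrier mlinear_compose[OF _ Q_cl_mlinear]])
       (simp_all only: r UU_mult)
qed

lemma UU_rmult_mlinear:
  assumes "u \<in> carrier UU" shows "mlinear UU UU (\<lambda>v. v \<otimes>\<^bsub>UU\<^esub> u)"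
proof -
  obtain r where r: "r \<in> carrier FA" "u = Q.cl r" using assms UU_carrier by blast
  have "mlinear FA FA (\<lambda>p. conv p r)"
    using r(1) conv_FA by (auto simp: mlinear_def conv_add_left conv_scale_left)
  then show ?thesis
    by (intro mlinear_descend[OF F.complex_module_axioms Q_cl_mlinear UU_carrier mlinear_compose[OF _ Q_cl_mlinear]])
       (simp_all only: r UU_mult)
qed

lemma emb_cl: "uea_emb G br x = Q.cl (delta [x])"
  by (simp add: uea_emb_def Q.cl_def)

lemma emb_closed: "x \<in> carrier G \<Longrightarrow> uea_emb G br x \<in> carrier UU"
  by (auto simp: emb_cl UU_carrier)

lemma emb_add:
  assumes "x \<in> carrier G" "y \<in> carrier G"
  shows "uea_emb G br (x \<oplus> y) = uea_emb G br x \<oplus>\<^bsub>UU\<^esub> uea_emb G br y"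
proof -
  have "(\<lambda>w. delta [x \<oplus> y] w - (delta [x] w + delta [y] w)) \<in> rels"
    unfolding rels_def
    by (rule UnI1, rule UnI1, rule CollectI, rule exI[of _ x], rule exI[of _ y]) (simp add: assms)
  then have "(\<lambda>w. delta [x \<oplus> y] w - (delta [x] w + delta [y] w)) \<in> JJ" using rels_JJ by blast
  then show ?thesis
    using assms by (simp add: emb_cl UU_add Q_cl_eq FA_closed del: free_alg_simps(1))
qed

lemma emb_smult:
  assumes "x \<in> carrier G"
  shows "uea_emb G br (c \<odot> x) = c \<odot>\<^bsub>UU\<^esub> uea_emb G br x"
proof -
  have "(\<lambda>w. delta [c \<odot> x] w - c * delta [x] w) \<in> rels"
    unfolding rels_def
    by (rule UnI1, rule UnI2, rule CollectI, rule exI[of _ c], rule exI[of _ x]) (simp add: assms)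
  then have "(\<lambda>w. delta [c \<odot> x] w - c * delta [x] w) \<in> JJ" using rels_JJ by blast
  then show ?thesis
    using assms by (simp add: emb_cl UU_smult Q_cl_eq FA_closed del: free_alg_simps(1))
qed

lemma emb_bracket:
  assumes "x \<in> carrier G" "y \<in> carrier G"
  shows "uea_emb G br x \<otimes>\<^bsub>UU\<^esub> uea_emb G br y \<ominus>\<^bsub>UU\<^esub> uea_emb G br y \<otimes>\<^bsub>UU\<^esub> uea_emb G br x = uea_emb G br (br x y)"
proof -
  have d: "delta [x, y] \<in> carrier FA" "delta [y, x] \<in> carrier FA" using assms by auto
  have "(\<lambda>w. (delta [x, y] w - delta [y, x] w) - delta [br x y] w) \<in> rels"
    unfolding rels_def
    by (rule UnI2, rule CollectI, rule exI[of _ x], rule exI[of _ y]) (simp add: assms)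
  then have "(\<lambda>w. (delta [x, y] w - delta [y, x] w) - delta [br x y] w) \<in> JJ" using rels_JJ by blast
  then have "Q.cl (\<lambda>w. delta [x, y] w - delta [y, x] w) = Q.cl (delta [br x y])"
    using assms d by (simp add: Q_cl_eq FA_closed br_closed del: free_alg_simps(1))
  moreover have "Q.cl (\<lambda>w. delta [x, y] w - delta [y, x] w) = Q.cl (delta [x, y]) \<ominus>\<^bsub>UU\<^esub> Q.cl (delta [y, x])"
    using mlinear_minus[OF F.complex_module_axioms UU_complex_module Q_cl_mlinear d] d by (simp add: free_alg_minus)
  ultimately show ?thesis
    using assms by (simp add: emb_cl UU_mult FA_closed conv_delta del: free_alg_simps(1))
qed

text \<open>
  The classes of words span the enveloping algebra, and a word is built from the empty one by
  multiplication with letters from the left.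
\<close>

lemma UU_induct:
  assumes H: "submodule H CC UU" and one: "\<one>\<^bsub>UU\<^esub> \<in> H"
    and step: "\<And>x u. x \<in> carrier G \<Longrightarrow> u \<in> carrier UU \<Longrightarrow> u \<in> H \<Longrightarrow> uea_emb G br x \<otimes>\<^bsub>UU\<^esub> u \<in> H"
    and u: "u \<in> carrier UU"
  shows "u \<in> H"
proof -
  have w: "Q.cl (delta w) \<in> H \<and> Q.cl (delta w) \<in> carrier UU" if "w \<in> lists (carrier G)" for w
    using that
  proof (induction w rule: lists.induct)
    case Nil then show ?case using one by (auto simp: UU_one UU_carrier)
  next
    case (Cons x w)
    have "Q.cl (delta (x # w)) = uea_emb G br x \<otimes>\<^bsub>UU\<^esub> Q.cl (delta w)"
      using Cons by (simp add: emb_cl UU_mult conv_delta)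
    then show ?case using step[OF Cons(1), of "Q.cl (delta w)"] Cons emb_closed UU_mult_closed by auto
  qed
  obtain p where p: "p \<in> carrier FA" "u = Q.cl p" using u by (auto simp: UU_carrier)
  have sub: "submodule {p \<in> carrier FA. Q.cl p \<in> H} CC FA"
    by (rule mlinear_vimage[OF F.complex_module_axioms UU_complex_module Q_cl_mlinear H])
  have sub': "submodule {p \<in> carrier FA. Q.cl p \<in> H} CC (free_vs (lists (carrier G)))"
  proof -
    interpret fv: complex_module "free_vs (lists (carrier G))" by (rule free_vs_complex_module)
    show ?thesis
      by (rule fv.submodI) (use F.submodD[OF sub] in auto)
  qed
  have "p \<in> {p \<in> carrier FA. Q.cl p \<in> H}"
    by (rule free_vs_submodule_all[OF sub']) (use p w in auto)
  then show ?thesis using p by simp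
qed

end

section \<open>Induced modules\<close>

lemma complex_line_simps [simp]:
  "carrier complex_line = UNIV" "x \<oplus>\<^bsub>complex_line\<^esub> y = x + y" "c \<odot>\<^bsub>complex_line\<^esub> x = c * x"
  by (simp_all add: complex_line_def)

locale induced = bracket_space G br
  for G :: "(complex, 'g) module" (structure) and br +
  fixes P :: "'g set"
  assumes P_sub: "submodule P CC G" and P_br: "x \<in> P \<Longrightarrow> y \<in> P \<Longrightarrow> br x y \<in> P"
begin

lemma P_subset: "P \<subseteq> carrier G"
  using G.submodD(1)[OF P_sub] .

definition GP where "GP = G\<lparr>carrier := P\<rparr>"

lemma GP_simps: "carrier GP = P" "x \<oplus>\<^bsub>GP\<^esub> y = x \<oplus> y" "c \<odot>\<^bsub>GP\<^esub> x = c \<odot> x"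
  by (simp_all add: GP_def)

lemma P_complex_module: "complex_module GP"
  unfolding complex_module_def GP_def by (rule submodule.submodule_is_module[OF P_sub]) (rule G.module_axioms)

sublocale P: bracket_space GP br
  by (intro bracket_space.intro bracket_space_axioms.intro P_complex_module) (simp add: P_br GP_simps)

lemma FA_P_subset: "carrier P.FA \<subseteq> carrier FA"
proof
  fix p assume "p \<in> carrier P.FA"
  then have "finite {x. p x \<noteq> 0}" "{x. p x \<noteq> 0} \<subseteq> lists P" by (simp_all add: free_vs_carrier GP_simps)
  moreover have "lists P \<subseteq> lists (carrier G)" by (rule lists_mono[OF P_subset])
  ultimately have "finite {x. p x \<noteq> 0} \<and> {x. p x \<noteq> 0} \<subseteq> lists (carrier G)" by blast
  then show "p \<in> carrier FA" unfolding free_alg_simps(1) free_vs_carrier .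
qed

text \<open>
  The relations of the subalgebra are among those of the whole algebra, and the ideal of the latter
  restricts to an ideal of the smaller free algebra.
\<close>

lemma JP_subset: "P.JJ \<subseteq> JJ"
proof -
  have sub: "submodule (JJ \<inter> carrier P.FA) CC P.FA"
  proof (rule P.F.submodI)
    show "a \<oplus>\<^bsub>P.FA\<^esub> b \<in> JJ \<inter> carrier P.FA" if "a \<in> JJ \<inter> carrier P.FA" "b \<in> JJ \<inter> carrier P.FA" for a b
      using F.submodD(3)[OF JJ_submodule, of a b] P.F.add.m_closed[of a b] that by simp
    show "c \<odot>\<^bsub>P.FA\<^esub> x \<in> JJ \<inter> carrier P.FA" if "x \<in> JJ \<inter> carrier P.FA" for c x
      using F.submodD(4)[OF JJ_submodule, of x c] P.F.smult_cl[of x c] that by simp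
  qed (use F.submodD(2)[OF JJ_submodule] P.F.M.zero_closed in auto)
  have "ideal (JJ \<inter> carrier P.FA) P.FA"
  proof (rule free_alg_idealI[OF sub])
    fix a x assume a: "a \<in> JJ \<inter> carrier P.FA" and x: "x \<in> carrier (free_vs (lists (carrier GP)))"
    have x': "x \<in> carrier P.FA" "x \<in> carrier FA" using x FA_P_subset by auto
    show "conv x a \<in> JJ \<inter> carrier P.FA"
      using ideal.I_l_closed[OF JJ_ideal, of a x] a x' P.conv_FA[of x a] by simp
    show "conv a x \<in> JJ \<inter> carrier P.FA"
      using ideal.I_r_closed[OF JJ_ideal, of a x] a x' P.conv_FA[of a x] by simp
  qed
  moreover have "P.rels \<subseteq> rels"
    unfolding P.rels_def rels_def GP_simps
    by (intro Un_mono setcompr_mono2) (use P_subset in auto)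
  then have "P.rels \<subseteq> JJ \<inter> carrier P.FA"
    using rels_JJ P.rels_carrier by blast
  ultimately show ?thesis using P.JJ_minimal by blast
qed

lemma incl_cl: "p \<in> carrier P.FA \<Longrightarrow> uea_incl G br (P.Q.cl p) = Q.cl p"
  unfolding uea_incl_def
proof (rule coset_map_mlinear(2)[OF P.Q.quotient_axioms Q.quotient_axioms])
  show "mlinear P.FA FA (\<lambda>p. p)"
    using FA_P_subset unfolding mlinear_def by (auto simp del: free_alg_simps(1))
qed (use JP_subset in auto)

lemma incl_closed: "h \<in> carrier P.UU \<Longrightarrow> uea_incl G br h \<in> carrier UU"
  using FA_P_subset by (auto simp: P.UU_carrier UU_carrier incl_cl simp del: free_alg_simps)

text \<open>
  The elements with constant coefficient \<open>0\<close> form an ideal that contains all defining relations. Hence the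
  constant coefficient is well defined on classes, and a single letter has constant coefficient \<open>0\<close>.
\<close>

lemma counit_emb: assumes "x \<in> P" shows "uea_counit (uea_emb GP br x) = 0"
proof -
  define K where "K = {p \<in> carrier P.FA. p [] = 0}"
  have sub: "submodule K CC P.FA"
    by (rule P.F.submodI) (use P.FA_closed P.F.M.zero_closed in \<open>auto simp: K_def\<close>)
  have "ideal K P.FA"
    by (rule free_alg_idealI[OF sub]) (use P.conv_FA in \<open>auto simp: K_def conv_def\<close>)
  moreover have "P.rels \<subseteq> K"
  proof -
    have "p [] = 0" if "p \<in> P.rels" for p
      using that unfolding P.rels_def by (auto simp: delta_def)
    then show ?thesis using P.rels_carrier by (auto simp: K_def)
  qed
  ultimately have JK: "P.JJ \<subseteq> K" by (rule P.JJ_minimal)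
  have d: "delta [x] \<in> carrier P.FA" using assms by (simp add: GP_simps)
  have 1: "delta [x] \<in> P.Q.cl (delta [x])"
    using P.Q.a_rcos_self[OF d] by (simp add: P.Q.cl_def)
  have 2: "p [] = 0" if "p \<in> P.Q.cl (delta [x])" for p
  proof -
    have p: "p \<in> carrier P.FA" "P.Q.cl p = P.Q.cl (delta [x])" using P.Q.cl_in[OF d that] by auto
    then have "(\<lambda>w. p w - delta [x] w) \<in> P.JJ" using P.Q_cl_eq[OF p(1) d] by simp
    then have "p [] - delta [x] [] = 0" using JK by (auto simp: K_def)
    then show ?thesis by (simp add: delta_def)
  qed
  show ?thesis
    unfolding uea_counit_def P.emb_cl
    by (rule the_equality) (use 1 2 in \<open>auto simp: delta_def\<close>)
qed

abbreviation FV where "FV \<equiv> ind_free G br"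
abbreviation NN where "NN \<equiv> ind_rels G br P"
abbreviation IV where "IV \<equiv> ind_triv G br P"

lemma FV_eq: "FV = free_vs (carrier UU \<times> UNIV)"
  by (simp add: ind_free_def)

lemma FV_complex_module: "complex_module FV"
  unfolding FV_eq by (rule free_vs_complex_module)

sublocale FV: complex_module FV by (rule FV_complex_module)

lemma delta_FV: "u \<in> carrier UU \<Longrightarrow> delta (u, c) \<in> carrier FV"
  by (simp add: FV_eq)

text \<open>
  The generators of the tensor relations, with the operations of the complex line replaced by those of
  the complex numbers.
\<close>

definition tgens where
  "tgens = {delta (m \<oplus>\<^bsub>UU\<^esub> m', n) \<ominus>\<^bsub>FV\<^esub> (delta (m, n) \<oplus>\<^bsub>FV\<^esub> delta (m', n)) | m m' n.
        m \<in> carrier UU \<and> m' \<in> carrier UU} \<union>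
     {delta (m, n + n') \<ominus>\<^bsub>FV\<^esub> (delta (m, n) \<oplus>\<^bsub>FV\<^esub> delta (m, n')) | m n n'.
        m \<in> carrier UU} \<union>
     {delta (c \<odot>\<^bsub>UU\<^esub> m, n) \<ominus>\<^bsub>FV\<^esub> c \<odot>\<^bsub>FV\<^esub> delta (m, n) | c m n. m \<in> carrier UU} \<union>
     {delta (m, c * n) \<ominus>\<^bsub>FV\<^esub> c \<odot>\<^bsub>FV\<^esub> delta (m, n) | c m n. m \<in> carrier UU} \<union>
     {delta (m \<otimes>\<^bsub>UU\<^esub> uea_incl G br a, n) \<ominus>\<^bsub>FV\<^esub> delta (m, uea_counit a * n) | m a n.
        m \<in> carrier UU \<and> a \<in> carrier P.UU}"

lemma tgensI:
  "m \<in> carrier UU \<Longrightarrow> m' \<in> carrier UU \<Longrightarrow> delta (m \<oplus>\<^bsub>UU\<^esub> m', n) \<ominus>\<^bsub>FV\<^esub> (delta (m, n) \<oplus>\<^bsub>FV\<^esub> delta (m', n)) \<in> tgens"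
  "m \<in> carrier UU \<Longrightarrow> delta (m, n + n') \<ominus>\<^bsub>FV\<^esub> (delta (m, n) \<oplus>\<^bsub>FV\<^esub> delta (m, n')) \<in> tgens"
  "m \<in> carrier UU \<Longrightarrow> delta (c \<odot>\<^bsub>UU\<^esub> m, n) \<ominus>\<^bsub>FV\<^esub> c \<odot>\<^bsub>FV\<^esub> delta (m, n) \<in> tgens"
  "m \<in> carrier UU \<Longrightarrow> delta (m, c * n) \<ominus>\<^bsub>FV\<^esub> c \<odot>\<^bsub>FV\<^esub> delta (m, n) \<in> tgens"
  "m \<in> carrier UU \<Longrightarrow> h \<in> carrier P.UU \<Longrightarrow>
     delta (m \<otimes>\<^bsub>UU\<^esub> uea_incl G br h, n) \<ominus>\<^bsub>FV\<^esub> delta (m, uea_counit h * n) \<in> tgens"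
  unfolding tgens_def
  subgoal by (rule UnI1, rule UnI1, rule UnI1, rule UnI1, rule CollectI, rule exI[of _ m], rule exI[of _ m'], rule exI[of _ n]) simp
  subgoal by (rule UnI1, rule UnI1, rule UnI1, rule UnI2, rule CollectI, rule exI[of _ m], rule exI[of _ n], rule exI[of _ n']) simp
  subgoal by (rule UnI1, rule UnI1, rule UnI2, rule CollectI, rule exI[of _ c], rule exI[of _ m], rule exI[of _ n]) simp
  subgoal by (rule UnI1, rule UnI2, rule CollectI, rule exI[of _ c], rule exI[of _ m], rule exI[of _ n]) simp
  subgoal by (rule UnI2, rule CollectI, rule exI[of _ m], rule exI[of _ h], rule exI[of _ n]) simp
  done

lemma tgens_cases:
  assumes "z \<in> tgens"
  obtains (1) m m' n where "z = delta (m \<oplus>\<^bsub>UU\<^esub> m', n) \<ominus>\<^bsub>FV\<^esub> (delta (m, n) \<oplus>\<^bsub>FV\<^esub> delta (m', n))" "m \<in> carrier UU" "m' \<in> carrier UU"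
    | (2) m n n' where "z = delta (m, n + n') \<ominus>\<^bsub>FV\<^esub> (delta (m, n) \<oplus>\<^bsub>FV\<^esub> delta (m, n'))" "m \<in> carrier UU"
    | (3) c m n where "z = delta (c \<odot>\<^bsub>UU\<^esub> m, n) \<ominus>\<^bsub>FV\<^esub> c \<odot>\<^bsub>FV\<^esub> delta (m, n)" "m \<in> carrier UU"
    | (4) c m n where "z = delta (m, c * n) \<ominus>\<^bsub>FV\<^esub> c \<odot>\<^bsub>FV\<^esub> delta (m, n)" "m \<in> carrier UU"
    | (5) m h n where "z = delta (m \<otimes>\<^bsub>UU\<^esub> uea_incl G br h, n) \<ominus>\<^bsub>FV\<^esub> delta (m, uea_counit h * n)"
        "m \<in> carrier UU" "h \<in> carrier P.UU"
  using assms unfolding tgens_def by (elim UnE CollectE exE conjE) (erule (2) that | erule (1) that)+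

lemma NN_eq: "NN = lin_span FV tgens"
  unfolding ind_rels_def tensor_rels_def Let_def tgens_def ind_free_def GP_def[symmetric] by simp

lemma tgens_carrier: "tgens \<subseteq> carrier FV"
  by (auto elim!: tgens_cases intro!: FV.M.minus_closed FV.M.add.m_closed delta_FV UU_mult_closed incl_closed FV.smult_cl)

lemma NN_submodule: "submodule NN CC FV"
  unfolding NN_eq by (rule FV.lin_span_submodule[OF tgens_carrier])

sublocale T: quotient FV NN
  by (intro quotient.intro quotient_axioms.intro FV_complex_module NN_submodule)

lemma IV_eq: "IV = quot_module FV NN"
  by (simp add: ind_triv_def)

sublocale IV: complex_module IV
  unfolding IV_eq by (rule T.quot_complex_module)

definition tens where "tens u c = T.cl (delta (u, c))"

lemma tens_closed: "u \<in> carrier UU \<Longrightarrow> tens u c \<in> carrier IV"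
  unfolding tens_def IV_eq T.quot_carrier by (rule imageI, rule delta_FV)

lemma tgens_eq:
  assumes "p \<ominus>\<^bsub>FV\<^esub> q \<in> tgens" "p \<in> carrier FV" "q \<in> carrier FV" shows "T.cl p = T.cl q"
proof -
  have "p \<ominus>\<^bsub>FV\<^esub> q \<in> NN" unfolding NN_eq by (rule subsetD[OF lin_span_superset assms(1)])
  then show ?thesis unfolding T.cl_eq_iff[OF assms(2,3)] .
qed

lemma tens_mlinear: "mlinear UU IV (\<lambda>u. tens u c)"
  unfolding mlinear_def
proof (intro conjI ballI allI)
  fix u v assume u: "u \<in> carrier UU" and v: "v \<in> carrier UU"
  have "delta (u \<oplus>\<^bsub>UU\<^esub> v, c) \<ominus>\<^bsub>FV\<^esub> (delta (u, c) \<oplus>\<^bsub>FV\<^esub> delta (v, c)) \<in> tgens"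
    by (rule tgensI(1)[OF u v])
  then have "T.cl (delta (u \<oplus>\<^bsub>UU\<^esub> v, c)) = T.cl (delta (u, c) \<oplus>\<^bsub>FV\<^esub> delta (v, c))"
    by (rule tgens_eq) (use u v in \<open>simp_all add: delta_FV\<close>)
  then show "tens (u \<oplus>\<^bsub>UU\<^esub> v) c = tens u c \<oplus>\<^bsub>IV\<^esub> tens v c"
    using u v by (simp add: tens_def IV_eq T.quot_add delta_FV)
next
  fix u k assume u: "u \<in> carrier UU"
  have "delta (k \<odot>\<^bsub>UU\<^esub> u, c) \<ominus>\<^bsub>FV\<^esub> k \<odot>\<^bsub>FV\<^esub> delta (u, c) \<in> tgens"
    by (rule tgensI(3)[OF u])
  then have "T.cl (delta (k \<odot>\<^bsub>UU\<^esub> u, c)) = T.cl (k \<odot>\<^bsub>FV\<^esub> delta (u, c))"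
    by (rule tgens_eq) (use u in \<open>simp_all add: delta_FV\<close>)
  then show "tens (k \<odot>\<^bsub>UU\<^esub> u) c = k \<odot>\<^bsub>IV\<^esub> tens u c"
    using u by (simp add: tens_def IV_eq T.quot_smult delta_FV)
qed (rule tens_closed)

lemma tens_scalar:
  assumes u: "u \<in> carrier UU" shows "tens u (k * c) = k \<odot>\<^bsub>IV\<^esub> tens u c"
proof -
  have "delta (u, k * c) \<ominus>\<^bsub>FV\<^esub> k \<odot>\<^bsub>FV\<^esub> delta (u, c) \<in> tgens"
    by (rule tgensI(4)[OF u])
  then have "T.cl (delta (u, k * c)) = T.cl (k \<odot>\<^bsub>FV\<^esub> delta (u, c))"
    by (rule tgens_eq) (use u in \<open>simp_all add: delta_FV\<close>)
  then show ?thesis using u by (simp add: tens_def IV_eq T.quot_smult delta_FV)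
qed

text \<open>
  Together with \<open>counit_emb\<close> this makes the subalgebra act by zero on the canonical generator.
\<close>

lemma tens_P:
  assumes u: "u \<in> carrier UU" and h: "h \<in> carrier P.UU"
  shows "tens (u \<otimes>\<^bsub>UU\<^esub> uea_incl G br h) c = tens u (uea_counit h * c)"
proof -
  have "delta (u \<otimes>\<^bsub>UU\<^esub> uea_incl G br h, c) \<ominus>\<^bsub>FV\<^esub> delta (u, uea_counit h * c) \<in> tgens"
    by (rule tgensI(5)[OF u h])
  then have "T.cl (delta (u \<otimes>\<^bsub>UU\<^esub> uea_incl G br h, c)) = T.cl (delta (u, uea_counit h * c))"
    by (rule tgens_eq) (use u h in \<open>simp_all add: delta_FV UU_mult_closed incl_closed\<close>)
  then show ?thesis by (simp add: tens_def)
qed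

lemma IV_induct:
  assumes H: "submodule H CC IV" and t: "\<And>u c. u \<in> carrier UU \<Longrightarrow> tens u c \<in> H" and w: "w \<in> carrier IV"
  shows "w \<in> H"
proof -
  obtain p where p: "p \<in> carrier FV" "w = T.cl p" using w by (auto simp: IV_eq T.quot_carrier)
  have m: "mlinear FV IV T.cl" unfolding IV_eq by (rule T.cl_mlinear)
  have sub: "submodule {p \<in> carrier FV. T.cl p \<in> H} CC (free_vs (carrier UU \<times> UNIV))"
    unfolding FV_eq[symmetric] by (rule mlinear_vimage[OF FV_complex_module IV.complex_module_axioms m H])
  have "p \<in> {p \<in> carrier FV. T.cl p \<in> H}"
  proof (rule free_vs_submodule_all[OF sub])
    show "p \<in> carrier (free_vs (carrier UU \<times> UNIV))" using p(1) unfolding FV_eq .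
    fix s :: "('g list \<Rightarrow> complex) set \<times> complex" assume "s \<in> carrier UU \<times> UNIV"
    then obtain u c where s: "s = (u, c)" "u \<in> carrier UU" by blast
    show "delta s \<in> {p \<in> carrier FV. T.cl p \<in> H}"
      using t[OF s(2), of c] delta_FV[OF s(2), of c] unfolding s(1) tens_def by blast
  qed
  then show ?thesis using p by simp
qed

lemma IV_ext:
  assumes "complex_module M" "mlinear IV M f" "mlinear IV M g" "\<And>u c. u \<in> carrier UU \<Longrightarrow> f (tens u c) = g (tens u c)"
    "w \<in> carrier IV"
  shows "f w = g w"
  using IV_induct[OF mlinear_equalizer[OF IV.complex_module_axioms assms(1-3)], of w] assms(4,5) tens_closed by blast

text \<open>
  Left multiplication by \<open>x\<close> on the first factor maps each generator of the tensor relations to a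
  generator of the same kind, so it descends to the tensor product.
\<close>

lemma act_props:
  assumes x: "x \<in> carrier G"
  shows act_mlinear: "mlinear IV IV (ind_act G br P x)"
    and act_tens: "u \<in> carrier UU \<Longrightarrow> ind_act G br P x (tens u c) = tens (uea_emb G br x \<otimes>\<^bsub>UU\<^esub> u) c"
proof -
  let ?e = "uea_emb G br x"
  note e = emb_closed[OF x]
  let ?g = "\<lambda>(u, c). (?e \<otimes>\<^bsub>UU\<^esub> u, c :: complex)"
  let ?L = "\<lambda>T. fsum FV (\<lambda>(u, c). T (u, c) \<odot>\<^bsub>FV\<^esub> delta (?e \<otimes>\<^bsub>UU\<^esub> u, c))"
  let ?L' = "\<lambda>T. fsum FV (\<lambda>s. T s \<odot>\<^bsub>FV\<^esub> delta (?g s))"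
  have L_eq: "?L = ?L'"
  proof (rule ext, rule arg_cong[where f = "fsum FV"], rule ext)
    fix T :: "('g list \<Rightarrow> complex) set \<times> complex \<Rightarrow> complex" and s :: "('g list \<Rightarrow> complex) set \<times> complex"
    show "(case s of (u, c) \<Rightarrow> T (u, c) \<odot>\<^bsub>FV\<^esub> delta (?e \<otimes>\<^bsub>UU\<^esub> u, c)) = T s \<odot>\<^bsub>FV\<^esub> delta (?g s)"
      by (cases s) simp
  qed
  have g: "?g s \<in> carrier UU \<times> UNIV" if "s \<in> carrier UU \<times> UNIV" for s
    using e that by (auto simp: UU_mult_closed)
  have "mlinear FV FV ?L'" unfolding FV_eq by (rule free_map(1)) (rule g)
  then have L: "mlinear FV FV ?L" by (simp only: L_eq)
  have Ld: "?L (delta (u, c)) = delta (?e \<otimes>\<^bsub>UU\<^esub> u, c)" if "u \<in> carrier UU" for u c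
  proof -
    have "?L' (delta (u, c)) = delta (?g (u, c))"
      unfolding FV_eq by (rule free_map(2)[OF g]) (use that in auto)
    then show ?thesis unfolding L_eq[THEN fun_cong] by simp
  qed
  note lm = UU_lmult_mlinear[OF e]
  note Lmin = mlinear_minus[OF FV_complex_module FV_complex_module L] and cls = UU_mult_closed[OF e]
  note sim = Lmin mlinearD(2,3)[OF L] Ld delta_FV mlinearD(2,3)[OF lm] cls
  have sub: "?L s \<in> NN" if s: "s \<in> NN" for s
  proof (rule mlinear_span[OF FV_complex_module FV_complex_module L NN_submodule tgens_carrier _ s[unfolded NN_eq]])
    fix z assume "z \<in> tgens"
    then have "?L z \<in> tgens"
    proof (cases rule: tgens_cases)
      case (1 m m' n)
      then have "?L z = delta ((?e \<otimes>\<^bsub>UU\<^esub> m) \<oplus>\<^bsub>UU\<^esub> (?e \<otimes>\<^bsub>UU\<^esub> m'), n) \<ominus>\<^bsub>FV\<^esub> (delta (?e \<otimes>\<^bsub>UU\<^esub> m, n) \<oplus>\<^bsub>FV\<^esub> delta (?e \<otimes>\<^bsub>UU\<^esub> m', n))"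
        by (simp only: sim U.M.add.m_closed FV.M.add.m_closed)
      then show ?thesis using tgensI(1)[OF cls[OF 1(2)] cls[OF 1(3)]] by simp
    next
      case (2 m n n')
      then have "?L z = delta (?e \<otimes>\<^bsub>UU\<^esub> m, n + n') \<ominus>\<^bsub>FV\<^esub> (delta (?e \<otimes>\<^bsub>UU\<^esub> m, n) \<oplus>\<^bsub>FV\<^esub> delta (?e \<otimes>\<^bsub>UU\<^esub> m, n'))"
        by (simp only: sim FV.M.add.m_closed)
      then show ?thesis using tgensI(2)[OF cls[OF 2(2)]] by simp
    next
      case (3 c m n)
      then have "?L z = delta (c \<odot>\<^bsub>UU\<^esub> (?e \<otimes>\<^bsub>UU\<^esub> m), n) \<ominus>\<^bsub>FV\<^esub> c \<odot>\<^bsub>FV\<^esub> delta (?e \<otimes>\<^bsub>UU\<^esub> m, n)"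
        by (simp only: sim U.smult_cl FV.smult_cl)
      then show ?thesis using tgensI(3)[OF cls[OF 3(2)]] by simp
    next
      case (4 c m n)
      then have "?L z = delta (?e \<otimes>\<^bsub>UU\<^esub> m, c * n) \<ominus>\<^bsub>FV\<^esub> c \<odot>\<^bsub>FV\<^esub> delta (?e \<otimes>\<^bsub>UU\<^esub> m, n)"
        by (simp only: sim FV.smult_cl)
      then show ?thesis using tgensI(4)[OF cls[OF 4(2)]] by simp
    next
      case (5 m h n)
      then have "?L z = delta ((?e \<otimes>\<^bsub>UU\<^esub> m) \<otimes>\<^bsub>UU\<^esub> uea_incl G br h, n) \<ominus>\<^bsub>FV\<^esub> delta (?e \<otimes>\<^bsub>UU\<^esub> m, uea_counit h * n)"
        by (simp only: sim UU_mult_closed incl_closed UU_mult_assoc e)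
      then show ?thesis using tgensI(5)[OF cls[OF 5(2)] 5(3)] by simp
    qed
    then show "?L z \<in> NN" unfolding NN_eq by (rule subsetD[OF lin_span_superset])
  qed
  have act: "ind_act G br P x = coset_map FV NN ?L" by (simp add: ind_act_def)
  show "mlinear IV IV (ind_act G br P x)"
    unfolding act IV_eq by (rule coset_map_mlinear(1)[OF T.quotient_axioms T.quotient_axioms L]) (rule sub)
  have cm: "coset_map FV NN ?L (T.cl p) = T.cl (?L p)" if "p \<in> carrier FV" for p
    by (rule coset_map_mlinear(2)[OF T.quotient_axioms T.quotient_axioms L _ that]) (rule sub)
  show "ind_act G br P x (tens u c) = tens (?e \<otimes>\<^bsub>UU\<^esub> u) c" if "u \<in> carrier UU"
    unfolding act tens_def unfolding cm[OF delta_FV[OF that]] Ld[OF that] ..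
qed

lemma act_closed: "x \<in> carrier G \<Longrightarrow> w \<in> carrier IV \<Longrightarrow> ind_act G br P x w \<in> carrier IV"
  using mlinearD(1)[OF act_mlinear] .

lemma act_add:
  assumes x: "x \<in> carrier G" and y: "y \<in> carrier G" and w: "w \<in> carrier IV"
  shows "ind_act G br P (x \<oplus> y) w = ind_act G br P x w \<oplus>\<^bsub>IV\<^esub> ind_act G br P y w"
proof -
  have m: "mlinear IV IV (\<lambda>w. ind_act G br P (x \<oplus> y) w \<ominus>\<^bsub>IV\<^esub> ind_act G br P y w)"
    using x y by (intro mlinear_diff IV.complex_module_axioms act_mlinear) simp_all
  have "ind_act G br P (x \<oplus> y) w \<ominus>\<^bsub>IV\<^esub> ind_act G br P y w = ind_act G br P x w"
  proof (rule IV_ext[OF IV.complex_module_axioms m act_mlinear[OF x] _ w])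
    fix u c assume u: "u \<in> carrier UU"
    note ex = emb_closed[OF x] and ey = emb_closed[OF y]
    have "tens (uea_emb G br (x \<oplus> y) \<otimes>\<^bsub>UU\<^esub> u) c = tens (uea_emb G br x \<otimes>\<^bsub>UU\<^esub> u) c \<oplus>\<^bsub>IV\<^esub> tens (uea_emb G br y \<otimes>\<^bsub>UU\<^esub> u) c"
      using mlinearD(2)[OF tens_mlinear UU_mult_closed[OF ex u] UU_mult_closed[OF ey u]] mlinearD(2)[OF UU_rmult_mlinear[OF u] ex ey]
      by (simp add: emb_add x y)
    then show "ind_act G br P (x \<oplus> y) (tens u c) \<ominus>\<^bsub>IV\<^esub> ind_act G br P y (tens u c) = ind_act G br P x (tens u c)"
      using x y u tens_closed[OF UU_mult_closed[OF ex u], of c] tens_closed[OF UU_mult_closed[OF ey u], of c]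
      by (simp add: act_tens a_minus_def IV.M.a_assoc IV.M.r_neg)
  qed
  then show ?thesis
    using act_closed[OF x w] act_closed[OF y w] act_closed[of "x \<oplus> y" w] x y w
    by (metis IV.M.a_comm IV.M.add.inv_solve_right IV.M.minus_eq IV.M.r_neg1 IV.M.a_inv_closed G.M.add.m_closed)
qed

lemma act_smult:
  assumes x: "x \<in> carrier G" and w: "w \<in> carrier IV"
  shows "ind_act G br P (k \<odot> x) w = k \<odot>\<^bsub>IV\<^esub> ind_act G br P x w"
proof (rule IV_ext[OF IV.complex_module_axioms act_mlinear mlinear_smult[OF IV.complex_module_axioms act_mlinear[OF x]] _ w])
  fix u c assume u: "u \<in> carrier UU"
  note ex = emb_closed[OF x]
  show "ind_act G br P (k \<odot> x) (tens u c) = k \<odot>\<^bsub>IV\<^esub> ind_act G br P x (tens u c)"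
    using mlinearD(3)[OF tens_mlinear UU_mult_closed[OF ex u]] mlinearD(3)[OF UU_rmult_mlinear[OF u] ex] x u
    by (simp add: act_tens emb_smult)
qed (use x in simp)

lemma act_bracket:
  assumes x: "x \<in> carrier G" and y: "y \<in> carrier G" and w: "w \<in> carrier IV"
  shows "ind_act G br P x (ind_act G br P y w) \<ominus>\<^bsub>IV\<^esub> ind_act G br P y (ind_act G br P x w) = ind_act G br P (br x y) w"
proof (rule IV_ext[OF IV.complex_module_axioms _ act_mlinear _ w])
  show "mlinear IV IV (\<lambda>w. ind_act G br P x (ind_act G br P y w) \<ominus>\<^bsub>IV\<^esub> ind_act G br P y (ind_act G br P x w))"
    by (intro mlinear_diff IV.complex_module_axioms mlinear_compose[OF act_mlinear[OF y] act_mlinear[OF x]] mlinear_compose[OF act_mlinear[OF x] act_mlinear[OF y]])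
  fix u c assume u: "u \<in> carrier UU"
  let ?x = "uea_emb G br x" and ?y = "uea_emb G br y"
  note ex = emb_closed[OF x] and ey = emb_closed[OF y]
  note xy = UU_mult_closed[OF ex ey] and yx = UU_mult_closed[OF ey ex]
  have "tens (?x \<otimes>\<^bsub>UU\<^esub> (?y \<otimes>\<^bsub>UU\<^esub> u)) c \<ominus>\<^bsub>IV\<^esub> tens (?y \<otimes>\<^bsub>UU\<^esub> (?x \<otimes>\<^bsub>UU\<^esub> u)) c
     = tens ((?x \<otimes>\<^bsub>UU\<^esub> ?y) \<otimes>\<^bsub>UU\<^esub> u \<ominus>\<^bsub>UU\<^esub> (?y \<otimes>\<^bsub>UU\<^esub> ?x) \<otimes>\<^bsub>UU\<^esub> u) c"
    using mlinear_minus[OF UU_complex_module IV.complex_module_axioms tens_mlinear UU_mult_closed[OF xy u] UU_mult_closed[OF yx u]]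
    by (simp add: UU_mult_assoc ex ey u)
  also have "\<dots> = tens (uea_emb G br (br x y) \<otimes>\<^bsub>UU\<^esub> u) c"
    using mlinear_minus[OF UU_complex_module UU_complex_module UU_rmult_mlinear[OF u] xy yx] by (simp add: emb_bracket x y)
  finally show "ind_act G br P x (ind_act G br P y (tens u c)) \<ominus>\<^bsub>IV\<^esub> ind_act G br P y (ind_act G br P x (tens u c))
     = ind_act G br P (br x y) (tens u c)"
    using x y u ex ey by (simp add: act_tens br_closed UU_mult_closed)
qed (use x y br_closed in auto)

lemma gen_eq: "ind_gen G br P = tens \<one>\<^bsub>UU\<^esub> 1"
  by (simp add: ind_gen_def tens_def T.cl_def)

lemma gen_closed: "ind_gen G br P \<in> carrier IV"
  unfolding gen_eq by (rule tens_closed[OF UU_one_closed])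

text \<open>
  Here \<open>x \<otimes> 1 = 1 \<cdot> x \<otimes> 1 = 1 \<otimes> \<epsilon>(x) = 0\<close> with the counit \<open>\<epsilon>\<close>.
\<close>

lemma act_gen:
  assumes x: "x \<in> P" shows "ind_act G br P x (ind_gen G br P) = \<zero>\<^bsub>IV\<^esub>"
proof -
  have xG: "x \<in> carrier G" using x P_subset by auto
  have h: "uea_emb GP br x \<in> carrier P.UU" using x by (simp add: P.emb_closed GP_simps)
  have i: "uea_incl G br (uea_emb GP br x) = uea_emb G br x"
    unfolding P.emb_cl emb_cl by (rule incl_cl) (use x in \<open>simp add: GP_simps\<close>)
  have "ind_act G br P x (ind_gen G br P) = tens (\<one>\<^bsub>UU\<^esub> \<otimes>\<^bsub>UU\<^esub> uea_emb G br x) 1"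
    by (simp add: gen_eq act_tens xG UU_one_closed UU_one_left UU_one_right emb_closed)
  also have "\<dots> = tens \<one>\<^bsub>UU\<^esub> (0 * 1)"
    using tens_P[OF UU_one_closed h, of 1] by (simp add: i counit_emb x)
  also have "\<dots> = \<zero>\<^bsub>IV\<^esub>"
    unfolding tens_scalar[OF UU_one_closed] by (simp add: tens_closed UU_one_closed)
  finally show ?thesis .
qed

text \<open>
  The elements \<open>u \<otimes> 1\<close> arise from \<open>1 \<otimes> 1\<close> by letters acting from the left.
\<close>

lemma cyclic:
  assumes H: "submodule H CC IV" and gen: "ind_gen G br P \<in> H"
    and act: "\<And>x w. x \<in> carrier G \<Longrightarrow> w \<in> H \<Longrightarrow> ind_act G br P x w \<in> H"
    and w: "w \<in> carrier IV"
  shows "w \<in> H"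
proof (rule IV_induct[OF H _ w])
  fix u c assume u: "u \<in> carrier UU"
  have "u \<in> {u \<in> carrier UU. tens u 1 \<in> H}"
  proof (rule UU_induct[OF mlinear_vimage[OF UU_complex_module IV.complex_module_axioms tens_mlinear H] _ _ u])
    show "\<one>\<^bsub>UU\<^esub> \<in> {u \<in> carrier UU. tens u 1 \<in> H}" using gen by (simp add: gen_eq UU_one_closed)
    fix x v assume x: "x \<in> carrier G" and v: "v \<in> carrier UU" "v \<in> {u \<in> carrier UU. tens u 1 \<in> H}"
    then show "uea_emb G br x \<otimes>\<^bsub>UU\<^esub> v \<in> {u \<in> carrier UU. tens u 1 \<in> H}"
      using act[OF x, of "tens v 1"] by (simp add: act_tens emb_closed UU_mult_closed)
  qed
  then have "c \<odot>\<^bsub>IV\<^esub> tens u 1 \<in> H" using IV.submodD(4)[OF H] by blast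
  then show "tens u c \<in> H" using tens_scalar[OF u, of c 1] by simp
qed

end

section \<open>The Lie algebra of modes\<close>

sublocale vertex_algebra \<subseteq> VM: complex_module V
  by (simp add: complex_module_def module_axioms)

context vertex_algebra
begin

lemma Y_zero_left [simp]: "b \<in> carrier V \<Longrightarrow> Y \<zero>\<^bsub>V\<^esub> n b = \<zero>\<^bsub>V\<^esub>"
  using Y_smult_left[of "\<zero>\<^bsub>V\<^esub>" b 0 n] Y_closed[of "\<zero>\<^bsub>V\<^esub>" b n] by simp

lemma Y_zero_right [simp]: "a \<in> carrier V \<Longrightarrow> Y a n \<zero>\<^bsub>V\<^esub> = \<zero>\<^bsub>V\<^esub>"
  using Y_smult_right[of a "\<zero>\<^bsub>V\<^esub>" n 0] Y_closed[of a "\<zero>\<^bsub>V\<^esub>" n] by simp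

lemma fsum_single:
  fixes f :: "nat \<Rightarrow> 'v"
  assumes "\<And>i. i > 0 \<Longrightarrow> f i = \<zero>\<^bsub>V\<^esub>" "f 0 \<in> carrier V"
  shows "fsum V f = f 0"
proof (cases "f 0 = \<zero>\<^bsub>V\<^esub>")
  case True
  then have "f i = \<zero>\<^bsub>V\<^esub>" for i using assms(1)[of i] by (cases "i = 0") auto
  then have "{i. f i \<noteq> \<zero>\<^bsub>V\<^esub>} = {}" by auto
  then show ?thesis using True by (simp add: fsum_def)
next
  case False
  then have "{i. f i \<noteq> \<zero>\<^bsub>V\<^esub>} = {0}" using assms(1) by fastforce
  then show ?thesis using assms(2) by (simp add: fsum_def)
qed

text \<open>
  The Borcherds identity at \<open>l = 0\<close>, where only the term \<open>i = 0\<close> of the right-hand sum survives.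
\<close>

lemma commutator:
  assumes a: "a \<in> carrier V" and b: "b \<in> carrier V" and c: "c \<in> carrier V"
  shows "Y a m (Y b n c) \<ominus>\<^bsub>V\<^esub> Y b n (Y a m c) =
    fsum V (\<lambda>i::nat. (of_int m gchoose i) \<odot>\<^bsub>V\<^esub> Y (Y a (int i) b) (m + n - int i) c)"
proof -
  let ?f = "\<lambda>i::nat. ((-1) ^ i * (of_int 0 gchoose i)) \<odot>\<^bsub>V\<^esub>
            (Y a (m + 0 - int i) (Y b (n + int i) c) \<ominus>\<^bsub>V\<^esub>
             ((-1) powi 0) \<odot>\<^bsub>V\<^esub> Y b (n + 0 - int i) (Y a (m + int i) c))"
  have "fsum V ?f = ?f 0"
    by (rule fsum_single) (use a b c in \<open>simp_all add: gbinomial_0_left Y_closed\<close>)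
  then show ?thesis using jacobi[OF a b c, of m 0 n] by (simp add: a b c Y_closed)
qed

lemma commutator_0:
  assumes a: "a \<in> carrier V" and b: "b \<in> carrier V" and c: "c \<in> carrier V"
  shows "Y a 0 (Y b n c) \<ominus>\<^bsub>V\<^esub> Y b n (Y a 0 c) = Y (Y a 0 b) n c"
proof -
  let ?f = "\<lambda>i::nat. (of_int 0 gchoose i) \<odot>\<^bsub>V\<^esub> Y (Y a (int i) b) (0 + n - int i) c"
  have "fsum V ?f = ?f 0"
    by (rule fsum_single) (use a b c in \<open>simp_all add: gbinomial_0_left Y_closed\<close>)
  then show ?thesis using commutator[OF a b c, of 0 n] by (simp add: a b c Y_closed)
qed

abbreviation LV where "LV \<equiv> laurent V"
abbreviation HD where "HD \<equiv> hatD_image V Y vac"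
abbreviation GV where "GV \<equiv> gV V Y vac"
abbreviation gm where "gm \<equiv> gmode V Y vac"
abbreviation gbr where "gbr \<equiv> gV_bracket V Y vac"

lemma laurent_simps [simp]:
  "f \<oplus>\<^bsub>LV\<^esub> g = (\<lambda>n. f n \<oplus>\<^bsub>V\<^esub> g n)" "\<zero>\<^bsub>LV\<^esub> = (\<lambda>n. \<zero>\<^bsub>V\<^esub>)" "c \<odot>\<^bsub>LV\<^esub> f = (\<lambda>n. c \<odot>\<^bsub>V\<^esub> f n)"
  by (simp_all add: laurent_def)

lemma laurent_carrier: "f \<in> carrier LV \<longleftrightarrow> (\<forall>n. f n \<in> carrier V) \<and> finite {n. f n \<noteq> \<zero>\<^bsub>V\<^esub>}"
  by (simp add: laurent_def)

lemma laurent_closed: "f \<in> carrier LV \<Longrightarrow> f n \<in> carrier V"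
  by (simp add: laurent_carrier)

lemma LV_complex_module: "complex_module LV"
proof -
  have add: "(\<lambda>n. f n \<oplus>\<^bsub>V\<^esub> g n) \<in> carrier LV" if "f \<in> carrier LV" "g \<in> carrier LV" for f g
  proof -
    have "{n. f n \<oplus>\<^bsub>V\<^esub> g n \<noteq> \<zero>\<^bsub>V\<^esub>} \<subseteq> {n. f n \<noteq> \<zero>\<^bsub>V\<^esub>} \<union> {n. g n \<noteq> \<zero>\<^bsub>V\<^esub>}" by auto
    then show ?thesis using that unfolding laurent_carrier by (auto intro: finite_subset)
  qed
  have sc: "(\<lambda>n. c \<odot>\<^bsub>V\<^esub> f n) \<in> carrier LV" if "f \<in> carrier LV" for f c
  proof -
    have "{n. c \<odot>\<^bsub>V\<^esub> f n \<noteq> \<zero>\<^bsub>V\<^esub>} \<subseteq> {n. f n \<noteq> \<zero>\<^bsub>V\<^esub>}" by auto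
    then show ?thesis using that unfolding laurent_carrier by (auto intro: finite_subset)
  qed
  have z: "(\<lambda>n. \<zero>\<^bsub>V\<^esub>) \<in> carrier LV" by (simp add: laurent_carrier)
  note lc = laurent_closed
  have "abelian_group LV"
  proof (rule abelian_groupI)
    fix f assume f: "f \<in> carrier LV"
    show "\<exists>g\<in>carrier LV. g \<oplus>\<^bsub>LV\<^esub> f = \<zero>\<^bsub>LV\<^esub>"
      by (rule bexI[OF _ sc[OF f, of "-1"]]) (simp add: VM.smult_minus1 lc[OF f] M.l_neg)
  qed (simp_all add: add z lc M.a_ac fun_eq_iff)
  then show ?thesis
    unfolding complex_module_def
    by (intro moduleI) (simp_all add: cring_from_type_algebra sc lc VM.smult_l_distr' smult_r_distr VM.smult_assoc')
qed

sublocale LV: complex_module LV by (rule LV_complex_module)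

lemma term_closed [simp]: "a \<in> carrier V \<Longrightarrow> laurent_term V a m \<in> carrier LV"
  by (simp add: laurent_carrier laurent_term_def)

lemma term_add: "a \<in> carrier V \<Longrightarrow> b \<in> carrier V \<Longrightarrow>
    laurent_term V (a \<oplus>\<^bsub>V\<^esub> b) m = laurent_term V a m \<oplus>\<^bsub>LV\<^esub> laurent_term V b m"
  and term_smult: "a \<in> carrier V \<Longrightarrow> laurent_term V (c \<odot>\<^bsub>V\<^esub> a) m = c \<odot>\<^bsub>LV\<^esub> laurent_term V a m"
  by (auto simp: laurent_term_def)

lemma term_zero: "laurent_term V \<zero>\<^bsub>V\<^esub> m = \<zero>\<^bsub>LV\<^esub>"
  by (auto simp: laurent_term_def)

lemma LV_submodule_all:
  assumes H: "submodule H CC LV" and t: "\<And>a m. a \<in> carrier V \<Longrightarrow> laurent_term V a m \<in> H"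
    and f: "f \<in> carrier LV"
  shows "f \<in> H"
proof -
  have "\<forall>f. (\<forall>n. f n \<in> carrier V) \<longrightarrow> {n. f n \<noteq> \<zero>\<^bsub>V\<^esub>} \<subseteq> A \<longrightarrow> f \<in> H" if "finite A" for A
    using that
  proof (induction A rule: finite_induct)
    case empty
    have "f \<in> H" if "\<forall>n. f n = \<zero>\<^bsub>V\<^esub>" for f
    proof -
      have "f = \<zero>\<^bsub>LV\<^esub>" using that by auto
      then show ?thesis using LV.submodD(2)[OF H] by simp
    qed
    then show ?case by auto
  next
    case (insert a A)
    show ?case
    proof (intro allI impI)
      fix f assume fc: "\<forall>n. f n \<in> carrier V" and sub: "{n. f n \<noteq> \<zero>\<^bsub>V\<^esub>} \<subseteq> insert a A"
      define g where "g = f(a := \<zero>\<^bsub>V\<^esub>)"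
      have "\<forall>n. g n \<in> carrier V" "{n. g n \<noteq> \<zero>\<^bsub>V\<^esub>} \<subseteq> A" using fc sub by (auto simp: g_def)
      then have "g \<in> H" using insert by blast
      then have "g \<oplus>\<^bsub>LV\<^esub> laurent_term V (f a) a \<in> H" using LV.submodD(3)[OF H] t fc by blast
      moreover have "g \<oplus>\<^bsub>LV\<^esub> laurent_term V (f a) a = f" using fc by (auto simp: g_def laurent_term_def)
      ultimately show "f \<in> H" by simp
    qed
  qed
  then show ?thesis using f unfolding laurent_carrier by blast
qed

lemma coord_fsum_LV:
  assumes "\<And>t. F t \<in> carrier LV" "finite {t. F t \<noteq> \<zero>\<^bsub>LV\<^esub>}"
  shows "VM.coord (fsum LV F k) = Sum_any (\<lambda>t. VM.coord (F t k))"
  by (rule LV.additive_fsum[of F "\<lambda>f. VM.coord (f k)"]) (use assms laurent_closed in \<open>auto simp: VM.coord_add\<close>)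

lemma LV_eqI:
  assumes "f \<in> carrier LV" "g \<in> carrier LV" "\<And>k. VM.coord (f k) = VM.coord (g k)"
  shows "f = g"
  using assms by (intro ext) (simp add: VM.coord_eq_iff laurent_closed)

text \<open>
  The summands of the bracket, as a family whose linearity in \<open>f\<close> and in \<open>g\<close> is visible termwise.
\<close>

definition bracket_term where
  "bracket_term f g = (\<lambda>(m :: int, n :: int, i :: nat).
     laurent_term V ((of_int m gchoose i) \<odot>\<^bsub>V\<^esub> Y (f m) (int i) (g n)) (m + n - int i))"

lemma bracket_term_closed:
  assumes "f \<in> carrier LV" "g \<in> carrier LV" shows "bracket_term f g t \<in> carrier LV"
  using assms by (cases t) (simp add: bracket_term_def laurent_closed Y_closed)

lemma bracket_term_finite:
  assumes f: "f \<in> carrier LV" and g: "g \<in> carrier LV"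
  shows "finite {t. bracket_term f g t \<noteq> \<zero>\<^bsub>LV\<^esub>}"
proof -
  have "\<exists>I. \<forall>i\<ge>I. Y (f m) (int i) (g n) = \<zero>\<^bsub>V\<^esub>" for m n
  proof -
    obtain N where N: "\<forall>k\<ge>N. Y (f m) k (g n) = \<zero>\<^bsub>V\<^esub>"
      using truncation[of "f m" "g n"] f g by (auto simp: laurent_closed)
    show ?thesis by (rule exI[of _ "nat N"]) (use N in auto)
  qed
  then obtain I where I: "\<And>m n i. i \<ge> I m n \<Longrightarrow> Y (f m) (int i) (g n) = \<zero>\<^bsub>V\<^esub>" by metis
  let ?A = "SIGMA m:{m. f m \<noteq> \<zero>\<^bsub>V\<^esub>}. SIGMA n:{n. g n \<noteq> \<zero>\<^bsub>V\<^esub>}. {..<I m n}"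
  have "{t. bracket_term f g t \<noteq> \<zero>\<^bsub>LV\<^esub>} \<subseteq> ?A"
  proof
    fix t assume t: "t \<in> {t. bracket_term f g t \<noteq> \<zero>\<^bsub>LV\<^esub>}"
    obtain m n i where mni: "t = (m, n, i)" by (cases t)
    have nz: "Y (f m) (int i) (g n) \<noteq> \<zero>\<^bsub>V\<^esub>"
      using t unfolding mni bracket_term_def by (auto simp: term_zero)
    then have "f m \<noteq> \<zero>\<^bsub>V\<^esub>" "g n \<noteq> \<zero>\<^bsub>V\<^esub>" "i < I m n"
      using f g I[of m n i] by (auto simp: laurent_closed not_le[symmetric])
    then show "t \<in> ?A" by (simp add: mni)
  qed
  moreover have "finite ?A" using f g by (intro finite_SigmaI) (auto simp: laurent_carrier)
  ultimately show ?thesis by (rule finite_subset)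
qed

lemma pre_bracket_eq: "pre_bracket V Y f g = fsum LV (bracket_term f g)"
  by (simp add: pre_bracket_def bracket_term_def)

lemma pre_bracket_closed: "f \<in> carrier LV \<Longrightarrow> g \<in> carrier LV \<Longrightarrow> pre_bracket V Y f g \<in> carrier LV"
  unfolding pre_bracket_eq by (rule LV.fsum_closed[OF bracket_term_closed])

lemma coord_pre_bracket:
  "f \<in> carrier LV \<Longrightarrow> g \<in> carrier LV \<Longrightarrow>
   VM.coord (pre_bracket V Y f g k) = Sum_any (\<lambda>t. VM.coord (bracket_term f g t k))"
  unfolding pre_bracket_eq by (rule coord_fsum_LV[OF bracket_term_closed bracket_term_finite])

lemma coord_bracket_term_finite:
  assumes "f \<in> carrier LV" "g \<in> carrier LV"
  shows "finite {t. VM.coord (bracket_term f g t k) \<noteq> 0}"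
  by (rule finite_subset[OF _ bracket_term_finite[OF assms]]) auto

lemma pre_bracket_mlinear_aux:
  assumes "f \<in> carrier LV" "g \<in> carrier LV" "f' \<in> carrier LV" "g' \<in> carrier LV" "h \<in> carrier LV" "h' \<in> carrier LV"
    "\<And>t. bracket_term h h' t = bracket_term f g t \<oplus>\<^bsub>LV\<^esub> bracket_term f' g' t"
  shows "pre_bracket V Y h h' = pre_bracket V Y f g \<oplus>\<^bsub>LV\<^esub> pre_bracket V Y f' g'"
proof (rule LV_eqI)
  fix k
  have "VM.coord (pre_bracket V Y h h' k) = Sum_any (\<lambda>t. VM.coord (bracket_term f g t k) + VM.coord (bracket_term f' g' t k))"
    unfolding coord_pre_bracket[OF assms(5,6)] assms(7)
    using bracket_term_closed[OF assms(1,2)] bracket_term_closed[OF assms(3,4)] by (simp add: VM.coord_add laurent_closed)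
  also have "\<dots> = VM.coord ((pre_bracket V Y f g \<oplus>\<^bsub>LV\<^esub> pre_bracket V Y f' g') k)"
    using Sum_any.distrib[OF coord_bracket_term_finite[OF assms(1,2), of k] coord_bracket_term_finite[OF assms(3,4), of k]]
      pre_bracket_closed[OF assms(1,2)] pre_bracket_closed[OF assms(3,4)]
    by (simp add: coord_pre_bracket assms VM.coord_add laurent_closed)
  finally show "VM.coord (pre_bracket V Y h h' k) = VM.coord ((pre_bracket V Y f g \<oplus>\<^bsub>LV\<^esub> pre_bracket V Y f' g') k)" .
qed (use assms pre_bracket_closed LV.M.add.m_closed in blast)+

lemma pre_bracket_mlinear_aux2:
  assumes "f \<in> carrier LV" "g \<in> carrier LV" "h \<in> carrier LV" "h' \<in> carrier LV"
    "\<And>t. bracket_term h h' t = c \<odot>\<^bsub>LV\<^esub> bracket_term f g t"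
  shows "pre_bracket V Y h h' = c \<odot>\<^bsub>LV\<^esub> pre_bracket V Y f g"
proof (rule LV_eqI)
  fix k
  have "VM.coord (pre_bracket V Y h h' k) = Sum_any (\<lambda>t. pscale c (VM.coord (bracket_term f g t k)))"
    unfolding coord_pre_bracket[OF assms(3,4)] assms(5)
    using bracket_term_closed[OF assms(1,2)] by (simp add: VM.coord_scale laurent_closed)
  also have "\<dots> = pscale c (Sum_any (\<lambda>t. VM.coord (bracket_term f g t k)))"
    by (rule additive_Sum_any[symmetric, OF coord_bracket_term_finite[OF assms(1,2)]]) (simp_all add: pm.scale_right_distrib)
  also have "\<dots> = VM.coord ((c \<odot>\<^bsub>LV\<^esub> pre_bracket V Y f g) k)"
    using pre_bracket_closed[OF assms(1,2)] by (simp add: coord_pre_bracket assms VM.coord_scale laurent_closed)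
  finally show "VM.coord (pre_bracket V Y h h' k) = VM.coord ((c \<odot>\<^bsub>LV\<^esub> pre_bracket V Y f g) k)" .
qed (use assms pre_bracket_closed LV.smult_cl in blast)+

lemma pre_bracket_mlinear_right:
  assumes f: "f \<in> carrier LV" shows "mlinear LV LV (pre_bracket V Y f)"
  unfolding mlinear_def
proof (intro conjI ballI allI)
  fix g h assume g: "g \<in> carrier LV" and h: "h \<in> carrier LV"
  show "pre_bracket V Y f (g \<oplus>\<^bsub>LV\<^esub> h) = pre_bracket V Y f g \<oplus>\<^bsub>LV\<^esub> pre_bracket V Y f h"
    by (rule pre_bracket_mlinear_aux[OF f g f h f LV.M.add.m_closed[OF g h]])
       (auto simp: bracket_term_def laurent_closed f g h Y_add_right Y_closed smult_r_distr term_add laurent_term_def)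
next
  fix g c assume g: "g \<in> carrier LV"
  show "pre_bracket V Y f (c \<odot>\<^bsub>LV\<^esub> g) = c \<odot>\<^bsub>LV\<^esub> pre_bracket V Y f g"
    by (rule pre_bracket_mlinear_aux2[OF f g f LV.smult_cl[OF g]])
       (auto simp: bracket_term_def laurent_closed f g Y_smult_right Y_closed VM.smult_assoc'[symmetric] laurent_term_def mult.commute)
qed (rule pre_bracket_closed[OF f])

lemma pre_bracket_mlinear_left:
  assumes f: "f \<in> carrier LV" shows "mlinear LV LV (\<lambda>g. pre_bracket V Y g f)"
  unfolding mlinear_def
proof (intro conjI ballI allI)
  fix g h assume g: "g \<in> carrier LV" and h: "h \<in> carrier LV"
  show "pre_bracket V Y (g \<oplus>\<^bsub>LV\<^esub> h) f = pre_bracket V Y g f \<oplus>\<^bsub>LV\<^esub> pre_bracket V Y h f"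
    by (rule pre_bracket_mlinear_aux[OF g f h f LV.M.add.m_closed[OF g h] f])
       (auto simp: bracket_term_def laurent_closed f g h Y_add_left Y_closed smult_r_distr term_add laurent_term_def)
next
  fix g c assume g: "g \<in> carrier LV"
  show "pre_bracket V Y (c \<odot>\<^bsub>LV\<^esub> g) f = c \<odot>\<^bsub>LV\<^esub> pre_bracket V Y g f"
    by (rule pre_bracket_mlinear_aux2[OF g f LV.smult_cl[OF g] f])
       (auto simp: bracket_term_def laurent_closed f g Y_smult_left Y_closed VM.smult_assoc'[symmetric] laurent_term_def mult.commute)
qed (rule pre_bracket_closed[OF _ f])

text \<open>
  The coefficient of \<open>t\<^sup>k\<close> receives only the term with \<open>i = m + n - k\<close>.
\<close>

lemma pre_bracket_terms:
  assumes a: "a \<in> carrier V" and b: "b \<in> carrier V"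
  shows "pre_bracket V Y (laurent_term V a m) (laurent_term V b n) =
    (\<lambda>k. if m + n - k \<ge> 0 then (of_int m gchoose nat (m + n - k)) \<odot>\<^bsub>V\<^esub> Y a (m + n - k) b else \<zero>\<^bsub>V\<^esub>)" (is "_ = ?Q")
proof
  fix k
  note ab = term_closed[OF a, of m] term_closed[OF b, of n]
  have pt: "bracket_term (laurent_term V a m) (laurent_term V b n) (m', n', i) k =
     (if m' = m \<and> n' = n \<and> k = m + n - int i then (of_int m gchoose i) \<odot>\<^bsub>V\<^esub> Y a (int i) b else \<zero>\<^bsub>V\<^esub>)" for m' n' i
    using a b by (auto simp: bracket_term_def laurent_term_def)
  have "{t. VM.coord (bracket_term (laurent_term V a m) (laurent_term V b n) t k) \<noteq> 0} \<subseteq> {(m, n, nat (m + n - k))}"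
  proof
    fix t assume t: "t \<in> {t. VM.coord (bracket_term (laurent_term V a m) (laurent_term V b n) t k) \<noteq> 0}"
    obtain m' n' i where t': "t = (m', n', i)" by (cases t)
    show "t \<in> {(m, n, nat (m + n - k))}"
      using t unfolding t' mem_Collect_eq pt by (auto split: if_splits)
  qed
  then have "VM.coord (pre_bracket V Y (laurent_term V a m) (laurent_term V b n) k)
     = VM.coord (bracket_term (laurent_term V a m) (laurent_term V b n) (m, n, nat (m + n - k)) k)"
    unfolding coord_pre_bracket[OF ab] by (subst Sum_any.expand_superset[of "{(m, n, nat (m + n - k))}"]) auto
  also have "\<dots> = VM.coord (?Q k)" unfolding pt by auto
  finally show "pre_bracket V Y (laurent_term V a m) (laurent_term V b n) k = ?Q k"
    using laurent_closed[OF pre_bracket_closed[OF ab], of k] a b by (subst (asm) VM.coord_eq_iff) (auto simp: Y_closed)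
qed

text \<open>
  For two monomials the triple sum reduces to a sum over \<open>i\<close>, since only one pair of exponents
  contributes.
\<close>

lemma pre_bracket_fsum:
  fixes m n :: int
  assumes a: "a \<in> carrier V" and b: "b \<in> carrier V"
  defines "F \<equiv> \<lambda>i::nat. laurent_term V ((of_int m gchoose i) \<odot>\<^bsub>V\<^esub> Y a (int i) b) (m + n - int i)"
  shows "pre_bracket V Y (laurent_term V a m) (laurent_term V b n) = fsum LV F"
    and "finite {i. F i \<noteq> \<zero>\<^bsub>LV\<^esub>}" and "F i \<in> carrier LV"
proof -
  have F: "F i \<in> carrier LV" for i using a b by (simp add: F_def Y_closed)
  then show "F i \<in> carrier LV" .
  obtain N where N: "\<forall>k\<ge>N. Y a k b = \<zero>\<^bsub>V\<^esub>" using truncation[OF a b] by blast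
  have "{i. F i \<noteq> \<zero>\<^bsub>LV\<^esub>} \<subseteq> {..<nat N}"
  proof
    fix i assume "i \<in> {i. F i \<noteq> \<zero>\<^bsub>LV\<^esub>}"
    then have "Y a (int i) b \<noteq> \<zero>\<^bsub>V\<^esub>" by (auto simp: F_def term_zero)
    then show "i \<in> {..<nat N}" using N by (cases "int i < N") auto
  qed
  then show fin: "finite {i. F i \<noteq> \<zero>\<^bsub>LV\<^esub>}" by (rule finite_subset) simp
  note ab = term_closed[OF a, of m] term_closed[OF b, of n]
  show "pre_bracket V Y (laurent_term V a m) (laurent_term V b n) = fsum LV F"
  proof (rule LV_eqI[OF pre_bracket_closed[OF ab] LV.fsum_closed[OF F]])
    fix k
    have "VM.coord (fsum LV F k) = Sum_any (\<lambda>i. VM.coord (F i k))"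
      by (rule coord_fsum_LV[OF F fin])
    also have "\<dots> = (\<Sum>i\<in>{nat (m + n - k)}. VM.coord (F i k))"
      by (rule Sum_any.expand_superset) (auto simp: F_def laurent_term_def split: if_splits)
    also have "\<dots> = VM.coord (pre_bracket V Y (laurent_term V a m) (laurent_term V b n) k)"
      unfolding pre_bracket_terms[OF a b] by (auto simp: F_def laurent_term_def)
    finally show "VM.coord (pre_bracket V Y (laurent_term V a m) (laurent_term V b n) k) = VM.coord (fsum LV F k)" by simp
  qed
qed

end

context vertex_operator_algebra
begin

abbreviation deriv where "deriv a \<equiv> Y a (-2) vac"

lemma deriv_omega: "a \<in> carrier V \<Longrightarrow> deriv a = Y \<omega> 0 a"
  using Lm1_derivative[of a vac "-1"] creation'[of "Y \<omega> 0 a"] by (simp add: vac_closed Y_closed conformal_closed)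

lemma deriv_closed: "a \<in> carrier V \<Longrightarrow> deriv a \<in> carrier V"
  by (simp add: Y_closed vac_closed)

lemma deriv_mode: "a \<in> carrier V \<Longrightarrow> b \<in> carrier V \<Longrightarrow> Y (deriv a) n b = (- of_int n) \<odot>\<^bsub>V\<^esub> Y a (n - 1) b"
  by (simp add: deriv_omega Lm1_derivative)

text \<open>
  \<open>D\<close> agrees with \<open>\<omega>\<^sub>0\<close>, which is a derivation of all products by \<open>commutator_0\<close>; and \<open>(D a)\<^sub>n = -n a\<^bsub>n-1\<^esub>\<close>.
\<close>

lemma deriv_derivation:
  assumes a: "a \<in> carrier V" and b: "b \<in> carrier V"
  shows "VM.coord (deriv (Y a n b)) = VM.coord (Y a n (deriv b)) - pscale (of_int n) (VM.coord (Y a (n - 1) b))"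
proof -
  have "VM.coord (Y \<omega> 0 (Y a n b) \<ominus>\<^bsub>V\<^esub> Y a n (Y \<omega> 0 b)) = VM.coord (Y (Y \<omega> 0 a) n b)"
    using commutator_0[OF conformal_closed a b, of n] by simp
  also have "\<dots> = pscale (- of_int n) (VM.coord (Y a (n - 1) b))"
    using a b by (simp add: Lm1_derivative VM.coord_scale Y_closed)
  finally show ?thesis
    using a b by (simp add: deriv_omega Y_closed conformal_closed VM.coord_minus diff_eq_eq)
qed

lemma deriv_zero: "deriv \<zero>\<^bsub>V\<^esub> = \<zero>\<^bsub>V\<^esub>"
  by (simp add: vac_closed)

lemma deriv_vac: "deriv vac = \<zero>\<^bsub>V\<^esub>"
  using vacuum[OF vac_closed, of "-2"] by simp

lemma hatD_closed: assumes f: "f \<in> carrier LV" shows "hatD V Y vac f \<in> carrier LV"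
proof -
  have "{n. hatD V Y vac f n \<noteq> \<zero>\<^bsub>V\<^esub>} \<subseteq> {n. f n \<noteq> \<zero>\<^bsub>V\<^esub>} \<union> (\<lambda>n. n - 1) ` {n. f n \<noteq> \<zero>\<^bsub>V\<^esub>}"
  proof
    fix n assume n: "n \<in> {n. hatD V Y vac f n \<noteq> \<zero>\<^bsub>V\<^esub>}"
    have "f n \<noteq> \<zero>\<^bsub>V\<^esub> \<or> f (n + 1) \<noteq> \<zero>\<^bsub>V\<^esub>"
      using n deriv_zero by (auto simp: hatD_def)
    then show "n \<in> {n. f n \<noteq> \<zero>\<^bsub>V\<^esub>} \<union> (\<lambda>n. n - 1) ` {n. f n \<noteq> \<zero>\<^bsub>V\<^esub>}"
      by (auto intro: image_eqI[of _ _ "n + 1"])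
  qed
  moreover have "finite ({n. f n \<noteq> \<zero>\<^bsub>V\<^esub>} \<union> (\<lambda>n. n - 1) ` {n. f n \<noteq> \<zero>\<^bsub>V\<^esub>})"
    using f by (simp add: laurent_carrier)
  ultimately have "finite {n. hatD V Y vac f n \<noteq> \<zero>\<^bsub>V\<^esub>}" by (rule finite_subset)
  then show ?thesis unfolding laurent_carrier
    using laurent_closed[OF f] by (simp add: hatD_def Y_closed vac_closed)
qed

lemma hatD_mlinear: "mlinear LV LV (hatD V Y vac)"
  unfolding mlinear_def
proof (intro conjI ballI allI)
  fix f g assume f: "f \<in> carrier LV" and g: "g \<in> carrier LV"
  show "hatD V Y vac (f \<oplus>\<^bsub>LV\<^esub> g) = hatD V Y vac f \<oplus>\<^bsub>LV\<^esub> hatD V Y vac g"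
    using laurent_closed[OF f] laurent_closed[OF g]
    by (auto simp: hatD_def Y_add_left smult_r_distr vac_closed Y_closed M.a_ac)
next
  fix f c assume f: "f \<in> carrier LV"
  show "hatD V Y vac (c \<odot>\<^bsub>LV\<^esub> f) = c \<odot>\<^bsub>LV\<^esub> hatD V Y vac f"
    using laurent_closed[OF f]
    by (auto simp: hatD_def Y_smult_left smult_r_distr vac_closed Y_closed VM.smult_assoc'[symmetric] mult.commute)
qed (rule hatD_closed)

lemma HD_submodule: "submodule HD CC LV"
  unfolding hatD_image_def by (rule mlinear_image[OF LV_complex_module LV_complex_module hatD_mlinear LV.carrier_is_submodule])

lemma hatD_in_HD: "f \<in> carrier LV \<Longrightarrow> hatD V Y vac f \<in> HD"
  by (simp add: hatD_image_def)

sublocale Qg: quotient LV HD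
  by (intro quotient.intro quotient_axioms.intro LV_complex_module HD_submodule)

lemma GV_eq: "GV = quot_module LV HD"
  by (simp add: gV_def)

sublocale GV: complex_module GV
  unfolding GV_eq by (rule Qg.quot_complex_module)

lemma GV_carrier: "carrier GV = Qg.cl ` carrier LV"
  by (simp add: GV_eq Qg.quot_carrier)

lemma Qg_mlinear: "mlinear LV GV Qg.cl"
  unfolding GV_eq by (rule Qg.cl_mlinear)

lemma gm_cl: "gm a m = Qg.cl (laurent_term V a m)"
  by (simp add: gmode_def Qg.cl_def)

lemma gm_closed [simp]: "a \<in> carrier V \<Longrightarrow> gm a m \<in> carrier GV"
  unfolding gm_cl GV_carrier by (rule imageI) simp

lemma gm_add: "a \<in> carrier V \<Longrightarrow> b \<in> carrier V \<Longrightarrow> gm (a \<oplus>\<^bsub>V\<^esub> b) m = gm a m \<oplus>\<^bsub>GV\<^esub> gm b m"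
  unfolding gm_cl using mlinearD(2)[OF Qg_mlinear term_closed term_closed] by (simp only: term_add)

lemma gm_smult: "a \<in> carrier V \<Longrightarrow> gm (c \<odot>\<^bsub>V\<^esub> a) m = c \<odot>\<^bsub>GV\<^esub> gm a m"
  unfolding gm_cl using mlinearD(3)[OF Qg_mlinear term_closed] by (simp only: term_smult)

lemma gm_mlinear: "mlinear V GV (\<lambda>a. gm a m)"
  by (simp add: mlinear_def gm_add gm_smult)

lemma gm_zero: "gm \<zero>\<^bsub>V\<^esub> m = \<zero>\<^bsub>GV\<^esub>"
  by (rule mlinear_zero[OF VM.complex_module_axioms GV.complex_module_axioms gm_mlinear])

lemma hatD_term:
  "a \<in> carrier V \<Longrightarrow> hatD V Y vac (laurent_term V a m) =
     laurent_term V (deriv a) m \<oplus>\<^bsub>LV\<^esub> of_int m \<odot>\<^bsub>LV\<^esub> laurent_term V a (m - 1)"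
  using deriv_closed[of a] by (auto simp: hatD_def laurent_term_def deriv_zero fun_eq_iff)

lemma Qg_HD: "f \<in> HD \<Longrightarrow> Qg.cl f = \<zero>\<^bsub>GV\<^esub>"
  unfolding GV_eq Qg.quot_zero using LV.submodD(1)[OF HD_submodule]
    LV.submodD(6)[OF HD_submodule _ LV.submodD(2)[OF HD_submodule]]
  by (subst Qg.cl_eq_iff[OF _ LV.M.zero_closed]) blast+

lemma gm_deriv:
  assumes a: "a \<in> carrier V" shows "gm (deriv a) m = (- of_int m) \<odot>\<^bsub>GV\<^esub> gm a (m - 1)"
proof -
  have "gm (deriv a) m \<oplus>\<^bsub>GV\<^esub> of_int m \<odot>\<^bsub>GV\<^esub> gm a (m - 1) = Qg.cl (hatD V Y vac (laurent_term V a m))"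
    unfolding hatD_term[OF a] gm_cl
    by (simp only: mlinearD(2,3)[OF Qg_mlinear] term_closed deriv_closed a LV.smult_cl)
  also have "\<dots> = \<zero>\<^bsub>GV\<^esub>" by (rule Qg_HD[OF hatD_in_HD[OF term_closed[OF a]]])
  finally have "GV.coord (gm (deriv a) m \<oplus>\<^bsub>GV\<^esub> of_int m \<odot>\<^bsub>GV\<^esub> gm a (m - 1)) = 0" by simp
  then have "GV.coord (gm (deriv a) m) = GV.coord ((- of_int m) \<odot>\<^bsub>GV\<^esub> gm a (m - 1))"
    using a deriv_closed[OF a] by (simp add: GV.coord_add GV.coord_scale add_eq_0_iff2)
  then show ?thesis using a deriv_closed[OF a] by (subst (asm) GV.coord_eq_iff) auto
qed

text \<open>
  \<open>D vac = 0\<close>, so the relation \<open>gm_deriv\<close> at \<open>m + 1\<close> gives \<open>(m + 1) vac(m) = 0\<close>.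
\<close>

lemma gm_vac: assumes "m \<noteq> -1" shows "gm vac m = \<zero>\<^bsub>GV\<^esub>"
proof -
  have "\<zero>\<^bsub>GV\<^esub> = (- of_int (m + 1)) \<odot>\<^bsub>GV\<^esub> gm vac m"
    using gm_deriv[OF vac_closed, of "m + 1"] unfolding deriv_vac gm_zero by simp
  then have "GV.coord ((- of_int (m + 1)) \<odot>\<^bsub>GV\<^esub> gm vac m) = 0" by (metis GV.coord_zero)
  then have "pscale (- of_int (m + 1)) (GV.coord (gm vac m)) = 0" using GV.coord_scale[OF gm_closed[OF vac_closed]] by metis
  moreover have "(- of_int (m + 1) :: complex) \<noteq> 0" using assms
    unfolding neg_equal_0_iff_equal of_int_eq_0_iff by presburger
  ultimately have "GV.coord (gm vac m) = 0" using pm.scale_eq_0_iff by blast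
  then show ?thesis using vac_closed by (simp add: GV.coord_eq_0_iff)
qed

lemma GV_submodule_all:
  assumes H: "submodule H CC GV" and g: "\<And>a m. a \<in> carrier V \<Longrightarrow> gm a m \<in> H" and x: "x \<in> carrier GV"
  shows "x \<in> H"
proof -
  obtain f where f: "f \<in> carrier LV" "x = Qg.cl f" using x unfolding GV_carrier by blast
  have "f \<in> {f \<in> carrier LV. Qg.cl f \<in> H}"
    by (rule LV_submodule_all[OF mlinear_vimage[OF LV_complex_module GV.complex_module_axioms Qg_mlinear H] _ f(1)])
       (use g gm_cl term_closed in auto)
  then show ?thesis using f(2) by simp
qed

lemma coord_pre_bracket_terms:
  assumes "a \<in> carrier V" "b \<in> carrier V" "m + n = k + j"
  shows "VM.coord (pre_bracket V Y (laurent_term V a m) (laurent_term V b n) k) =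
    (if j \<ge> 0 then pscale (of_int m gchoose nat j) (VM.coord (Y a j b)) else 0)"
proof -
  have "m + n - k = j" using assms(3) by simp
  then show ?thesis using assms(1,2) by (simp add: pre_bracket_terms VM.coord_scale Y_closed)
qed

lemma coord_comb:
  assumes "f \<in> carrier LV" "g \<in> carrier LV"
  shows "VM.coord ((f \<oplus>\<^bsub>LV\<^esub> c \<odot>\<^bsub>LV\<^esub> g) k) = VM.coord (f k) + pscale c (VM.coord (g k))"
  using assms by (simp add: VM.coord_add VM.coord_scale laurent_closed)

text \<open>
  The bracket with an element of the form \<open>(D a)(m) + m a(m - 1)\<close> vanishes already before passing to the
  quotient: coefficientwise \<open>(D a)\<^sub>j = -j a\<^bsub>j-1\<^esub>\<close> and \<open>j (m choose j) = m (m - 1 choose j - 1)\<close>.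
\<close>

lemma pre_bracket_hatD_left:
  assumes a: "a \<in> carrier V" and b: "b \<in> carrier V"
  shows "pre_bracket V Y (hatD V Y vac (laurent_term V a m)) (laurent_term V b n) = \<zero>\<^bsub>LV\<^esub>"
proof -
  note tb = term_closed[OF b, of n]
  note ml = mlinearD(2,3)[OF pre_bracket_mlinear_left[OF tb]]
  let ?A = "pre_bracket V Y (laurent_term V (deriv a) m) (laurent_term V b n)"
  let ?B = "pre_bracket V Y (laurent_term V a (m - 1)) (laurent_term V b n)"
  have A: "?A \<in> carrier LV" and B: "?B \<in> carrier LV"
    by (intro pre_bracket_closed term_closed deriv_closed a b)+
  have "pre_bracket V Y (hatD V Y vac (laurent_term V a m)) (laurent_term V b n) = ?A \<oplus>\<^bsub>LV\<^esub> of_int m \<odot>\<^bsub>LV\<^esub> ?B"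
    unfolding hatD_term[OF a] by (simp only: ml term_closed deriv_closed a LV.smult_cl)
  also have "\<dots> = \<zero>\<^bsub>LV\<^esub>"
  proof (rule LV_eqI)
    fix k
    define j where "j = m + n - k"
    let ?X = "VM.coord (Y a (j - 1) b)"
    have 1: "VM.coord (?A k) = (if j \<ge> 0 then pscale (of_int m gchoose nat j) (VM.coord (Y (deriv a) j b)) else 0)"
      by (rule coord_pre_bracket_terms[OF deriv_closed[OF a] b]) (simp add: j_def)
    have 2: "VM.coord (?B k) = (if j - 1 \<ge> 0 then pscale (of_int (m - 1) gchoose nat (j - 1)) ?X else 0)"
      by (rule coord_pre_bracket_terms[OF a b]) (simp add: j_def)
    have 3: "VM.coord (Y (deriv a) j b) = pscale (- of_int j) ?X"
      using a b by (simp add: deriv_mode VM.coord_scale Y_closed)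
    have "VM.coord (?A k) + pscale (of_int m) (VM.coord (?B k)) = 0"
    proof (cases "j \<ge> 1")
      case True
      then obtain i where i: "j = 1 + int i" using zle_iff_zadd by blast
      have n: "nat j = Suc i" "nat (j - 1) = i" by (simp_all add: i)
      have ab: "of_nat (Suc i) * ((of_int m :: complex) gchoose Suc i) = of_int m * (of_int (m - 1) gchoose i)"
        using gbinomial_absorption[of i "of_int m :: complex"] by simp
      have c: "(of_int m gchoose Suc i) * (- of_int j) + of_int m * (of_int (m - 1) gchoose i) = (0::complex)"
        unfolding ab[symmetric] by (simp add: i algebra_simps)
      have "VM.coord (?A k) + pscale (of_int m) (VM.coord (?B k)) =
        pscale ((of_int m gchoose Suc i) * (- of_int j) + of_int m * (of_int (m - 1) gchoose i)) ?X"
        unfolding 1 2 3 n using True by (simp only: pm.scale_left_distrib pm.scale_scale) simp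
      then show ?thesis unfolding c by simp
    next
      case False
      then show ?thesis unfolding 1 2 3 by auto
    qed
    then show "VM.coord ((?A \<oplus>\<^bsub>LV\<^esub> of_int m \<odot>\<^bsub>LV\<^esub> ?B) k) = VM.coord (\<zero>\<^bsub>LV\<^esub> k)"
      unfolding coord_comb[OF A B] by simp
  qed (intro LV.M.add.m_closed LV.smult_cl A B, rule LV.M.zero_closed)
  finally show ?thesis .
qed

text \<open>
  In the second argument the operator passes through the bracket, because \<open>D\<close> is a derivation of the
  products and \<open>j (m choose j) = (m - j + 1) (m choose j - 1)\<close>.
\<close>

lemma pre_bracket_hatD_right:
  assumes a: "a \<in> carrier V" and b: "b \<in> carrier V"
  shows "pre_bracket V Y (laurent_term V a m) (hatD V Y vac (laurent_term V b n)) =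
     hatD V Y vac (pre_bracket V Y (laurent_term V a m) (laurent_term V b n))"
proof -
  note ta = term_closed[OF a, of m]
  note ml = mlinearD(2,3)[OF pre_bracket_mlinear_right[OF ta]]
  let ?A = "pre_bracket V Y (laurent_term V a m) (laurent_term V (deriv b) n)"
  let ?B = "pre_bracket V Y (laurent_term V a m) (laurent_term V b (n - 1))"
  let ?Q = "pre_bracket V Y (laurent_term V a m) (laurent_term V b n)"
  have A: "?A \<in> carrier LV" and B: "?B \<in> carrier LV" and Q: "?Q \<in> carrier LV"
    by (intro pre_bracket_closed term_closed deriv_closed a b)+
  have "pre_bracket V Y (laurent_term V a m) (hatD V Y vac (laurent_term V b n)) = ?A \<oplus>\<^bsub>LV\<^esub> of_int n \<odot>\<^bsub>LV\<^esub> ?B"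
    unfolding hatD_term[OF b] by (simp only: ml term_closed deriv_closed b LV.smult_cl)
  also have "\<dots> = hatD V Y vac ?Q"
  proof (rule LV_eqI)
    fix k
    define j where "j = m + n - k"
    let ?X = "VM.coord (Y a (j - 1) b)"
    have 1: "VM.coord (?A k) = (if j \<ge> 0 then pscale (of_int m gchoose nat j) (VM.coord (Y a j (deriv b))) else 0)"
      by (rule coord_pre_bracket_terms[OF a deriv_closed[OF b]]) (simp add: j_def)
    have 2: "VM.coord (?B k) = (if j - 1 \<ge> 0 then pscale (of_int m gchoose nat (j - 1)) ?X else 0)"
      by (rule coord_pre_bracket_terms[OF a b]) (simp add: j_def)
    have 3: "VM.coord (?Q (k + 1)) = (if j - 1 \<ge> 0 then pscale (of_int m gchoose nat (j - 1)) ?X else 0)"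
      by (rule coord_pre_bracket_terms[OF a b]) (simp add: j_def)
    have Qk: "?Q k = (if j \<ge> 0 then (of_int m gchoose nat j) \<odot>\<^bsub>V\<^esub> Y a j b else \<zero>\<^bsub>V\<^esub>)"
      using a b by (simp add: pre_bracket_terms j_def)
    have 4: "VM.coord (deriv (?Q k)) = (if j \<ge> 0 then pscale (of_int m gchoose nat j) (VM.coord (deriv (Y a j b))) else 0)"
      unfolding Qk using a b by (simp add: Y_smult_left vac_closed Y_closed VM.coord_scale)
    have h: "VM.coord (hatD V Y vac ?Q k) = VM.coord (deriv (?Q k)) + pscale (of_int (k + 1)) (VM.coord (?Q (k + 1)))"
      unfolding hatD_def using laurent_closed[OF Q] by (simp add: VM.coord_add VM.coord_scale deriv_closed)
    have "VM.coord (?A k) + pscale (of_int n) (VM.coord (?B k)) = VM.coord (deriv (?Q k)) + pscale (of_int (k + 1)) (VM.coord (?Q (k + 1)))"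
    proof (cases "j \<ge> 1")
      case True
      then obtain i where i: "j = 1 + int i" using zle_iff_zadd by blast
      have n: "nat j = Suc i" "nat (j - 1) = i" by (simp_all add: i)
      have ab: "of_nat (Suc i) * ((of_int m :: complex) gchoose Suc i) = (of_int m - of_nat i) * (of_int m gchoose i)"
        using gbinomial_mult_1[of "of_int m :: complex" i] by (simp add: algebra_simps)
      have kj: "of_int (k + 1) = (of_int m + of_int n - of_nat i :: complex)"
      proof -
        have "k + 1 = m + n - int i" using i by (simp add: j_def)
        then show ?thesis by simp
      qed
      have c: "of_int n * (of_int m gchoose i) = of_int (k + 1) * (of_int m gchoose i) - of_nat (Suc i) * ((of_int m :: complex) gchoose Suc i)"
        unfolding ab kj by (simp add: algebra_simps)
      have jj: "of_int j = (of_nat (Suc i) :: complex)" by (simp add: i)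
      have "pscale (of_int n) (VM.coord (?B k)) = pscale (of_int n * (of_int m gchoose i)) ?X"
        unfolding 2 n using True by simp
      also have "\<dots> = pscale (of_int (k + 1)) (VM.coord (?Q (k + 1))) - pscale (of_int m gchoose Suc i) (pscale (of_int j) ?X)"
        unfolding c 3 n jj pm.scale_left_diff_distrib pm.scale_scale using True by (simp add: mult.commute)
      finally show ?thesis
        unfolding 1 4 n deriv_derivation[OF a b] using True by (simp add: pm.scale_right_diff_distrib)
    next
      case False
      moreover have "VM.coord (deriv (Y a 0 b)) = VM.coord (Y a 0 (deriv b))" using deriv_derivation[OF a b, of 0] by simp
      ultimately show ?thesis unfolding 1 2 3 4 by (cases "j = 0") auto
    qed
    then show "VM.coord ((?A \<oplus>\<^bsub>LV\<^esub> of_int n \<odot>\<^bsub>LV\<^esub> ?B) k) = VM.coord (hatD V Y vac ?Q k)"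
      unfolding coord_comb[OF A B] h .
  qed (intro LV.M.add.m_closed LV.smult_cl A B, rule hatD_closed[OF Q])
  finally show ?thesis .
qed

lemma pre_bracket_HD_left:
  assumes f: "f \<in> HD" and g: "g \<in> carrier LV"
  shows "pre_bracket V Y f g \<in> HD"
proof -
  obtain h where h: "h \<in> carrier LV" "f = hatD V Y vac h" using f by (auto simp: hatD_image_def)
  have 1: "pre_bracket V Y (hatD V Y vac (laurent_term V a m)) g \<in> HD" if a: "a \<in> carrier V" for a m
  proof -
    have "g \<in> {g \<in> carrier LV. pre_bracket V Y (hatD V Y vac (laurent_term V a m)) g \<in> HD}"
      by (rule LV_submodule_all[OF mlinear_vimage[OF LV_complex_module LV_complex_module pre_bracket_mlinear_right[OF hatD_closed[OF term_closed[OF a]]] HD_submodule] _ g])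
         (use a pre_bracket_hatD_left LV.submodD(2)[OF HD_submodule] in auto)
    then show ?thesis by blast
  qed
  have "h \<in> {h \<in> carrier LV. pre_bracket V Y (hatD V Y vac h) g \<in> HD}"
    by (rule LV_submodule_all[OF mlinear_vimage[OF LV_complex_module LV_complex_module mlinear_compose[OF hatD_mlinear pre_bracket_mlinear_left[OF g]] HD_submodule] _ h(1)])
       (use 1 in auto)
  then show ?thesis using h(2) by blast
qed

lemma pre_bracket_HD_right:
  assumes f: "f \<in> HD" and g: "g \<in> carrier LV"
  shows "pre_bracket V Y g f \<in> HD"
proof -
  obtain h where h: "h \<in> carrier LV" "f = hatD V Y vac h" using f by (auto simp: hatD_image_def)
  have 1: "pre_bracket V Y g (hatD V Y vac (laurent_term V a m)) \<in> HD" if a: "a \<in> carrier V" for a m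
  proof -
    have "g \<in> {g \<in> carrier LV. pre_bracket V Y g (hatD V Y vac (laurent_term V a m)) \<in> HD}"
      by (rule LV_submodule_all[OF mlinear_vimage[OF LV_complex_module LV_complex_module pre_bracket_mlinear_left[OF hatD_closed[OF term_closed[OF a]]] HD_submodule] _ g])
         (use a in \<open>simp add: pre_bracket_hatD_right hatD_in_HD pre_bracket_closed\<close>)
    then show ?thesis by blast
  qed
  have "h \<in> {h \<in> carrier LV. pre_bracket V Y g (hatD V Y vac h) \<in> HD}"
    by (rule LV_submodule_all[OF mlinear_vimage[OF LV_complex_module LV_complex_module mlinear_compose[OF hatD_mlinear pre_bracket_mlinear_right[OF g]] HD_submodule] _ h(1)])
       (use 1 in auto)
  then show ?thesis using h(2) by blast
qed

text \<open>
  By the two preceding lemmas a change of representatives alters the bracket only by an element of the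
  image of the derivation, so the union in the definition of the bracket is a single coset.
\<close>

lemma gbr_cl:
  assumes f: "f \<in> carrier LV" and g: "g \<in> carrier LV"
  shows "gbr (Qg.cl f) (Qg.cl g) = Qg.cl (pre_bracket V Y f g)"
proof -
  have eq: "Qg.cl (pre_bracket V Y f' g') = Qg.cl (pre_bracket V Y f g)"
    if f': "f' \<in> Qg.cl f" and g': "g' \<in> Qg.cl g" for f' g'
  proof -
    have c: "f' \<in> carrier LV" "g' \<in> carrier LV" "f' \<ominus>\<^bsub>LV\<^esub> f \<in> HD" "g' \<ominus>\<^bsub>LV\<^esub> g \<in> HD"
      using Qg.cl_in[OF f f'] Qg.cl_in[OF g g'] Qg.cl_eq_iff f g by blast+
    have "pre_bracket V Y f' g' \<ominus>\<^bsub>LV\<^esub> pre_bracket V Y f g' \<in> HD"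
      using pre_bracket_HD_left[OF c(3,2)] mlinear_minus[OF LV_complex_module LV_complex_module pre_bracket_mlinear_left[OF c(2)] c(1) f] by simp
    then have "Qg.cl (pre_bracket V Y f' g') = Qg.cl (pre_bracket V Y f g')"
      by (subst Qg.cl_eq_iff) (use c f in \<open>simp_all add: pre_bracket_closed\<close>)
    moreover have "pre_bracket V Y f g' \<ominus>\<^bsub>LV\<^esub> pre_bracket V Y f g \<in> HD"
      using pre_bracket_HD_right[OF c(4) f] mlinear_minus[OF LV_complex_module LV_complex_module pre_bracket_mlinear_right[OF f] c(2) g] by simp
    then have "Qg.cl (pre_bracket V Y f g') = Qg.cl (pre_bracket V Y f g)"
      by (subst Qg.cl_eq_iff) (use c f g in \<open>simp_all add: pre_bracket_closed\<close>)
    ultimately show ?thesis by simp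
  qed
  have self: "f \<in> Qg.cl f" "g \<in> Qg.cl g" using Qg.a_rcos_self f g by (simp_all add: Qg.cl_def)
  have "gbr (Qg.cl f) (Qg.cl g) = (\<Union>f'\<in>Qg.cl f. \<Union>g'\<in>Qg.cl g. Qg.cl (pre_bracket V Y f' g'))"
    by (simp add: gV_bracket_def Qg.cl_def)
  also have "\<dots> = (\<Union>f'\<in>Qg.cl f. \<Union>g'\<in>Qg.cl g. Qg.cl (pre_bracket V Y f g))"
    using eq by (intro SUP_cong refl)
  also have "\<dots> = Qg.cl (pre_bracket V Y f g)" using self by blast
  finally show ?thesis .
qed

lemma gbr_closed: "x \<in> carrier GV \<Longrightarrow> y \<in> carrier GV \<Longrightarrow> gbr x y \<in> carrier GV"
  unfolding GV_carrier using gbr_cl pre_bracket_closed by auto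

text \<open>
  Centrality of \<open>vac(-1)\<close>: the bracket involves only the products \<open>a\<^sub>i vac\<close> with \<open>i \<ge> 0\<close>, and these vanish.
\<close>

lemma gbr_vac: assumes x: "x \<in> carrier GV" shows "gbr x (gm vac (-1)) = \<zero>\<^bsub>GV\<^esub>"
proof -
  obtain f where f: "f \<in> carrier LV" "x = Qg.cl f" using x unfolding GV_carrier by blast
  have "bracket_term f (laurent_term V vac (-1)) t = \<zero>\<^bsub>LV\<^esub>" for t
    using laurent_closed[OF f(1)] vac_closed
    by (cases t) (auto simp: bracket_term_def laurent_term_def creation fun_eq_iff)
  then have "{t. bracket_term f (laurent_term V vac (-1)) t \<noteq> \<zero>\<^bsub>LV\<^esub>} = {}" by blast
  then have "pre_bracket V Y f (laurent_term V vac (-1)) = \<zero>\<^bsub>LV\<^esub>"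
    unfolding pre_bracket_eq fsum_def by (metis LV.M.finsum_empty)
  then have "gbr x (gm vac (-1)) = Qg.cl \<zero>\<^bsub>LV\<^esub>"
    using f vac_closed by (simp add: gm_cl gbr_cl)
  then show ?thesis unfolding GV_eq Qg.quot_zero .
qed

lemma gbr_mlinear_left: assumes y: "y \<in> carrier GV" shows "mlinear GV GV (\<lambda>x. gbr x y)"
proof -
  obtain g where g: "g \<in> carrier LV" "y = Qg.cl g" using y unfolding GV_carrier by blast
  show ?thesis
    by (rule mlinear_descend[OF LV_complex_module Qg_mlinear GV_carrier mlinear_compose[OF pre_bracket_mlinear_left[OF g(1)] Qg_mlinear]])
       (simp add: gbr_cl g)
qed

lemma gbr_mlinear_right: assumes y: "y \<in> carrier GV" shows "mlinear GV GV (\<lambda>x. gbr y x)"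
proof -
  obtain g where g: "g \<in> carrier LV" "y = Qg.cl g" using y unfolding GV_carrier by blast
  show ?thesis
    by (rule mlinear_descend[OF LV_complex_module Qg_mlinear GV_carrier mlinear_compose[OF pre_bracket_mlinear_right[OF g(1)] Qg_mlinear]])
       (simp add: gbr_cl g)
qed

text \<open>
  The bracket formula is transported along an arbitrary linear map \<open>h\<close> and expressed in coordinates. The
  maps of interest are \<open>x \<mapsto> x w\<close> for a vector \<open>w\<close> of a module.
\<close>

lemma gbr_modes:
  assumes a: "a \<in> carrier V" and b: "b \<in> carrier V" and M: "complex_module M" and h: "mlinear GV M h"
  shows "complex_module.coord M (h (gbr (gm a m) (gm b n))) =
     pm.binsum m (\<lambda>i. complex_module.coord M (h (gm (Y a (int i) b) (m + n - int i))))"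
proof -
  interpret M: complex_module M by (rule M)
  have hq: "mlinear LV M (\<lambda>f. h (Qg.cl f))" by (rule mlinear_compose[OF Qg_mlinear h])
  have "M.coord (h (gbr (gm a m) (gm b n))) = M.coord (h (Qg.cl (fsum LV
     (\<lambda>i::nat. laurent_term V ((of_int m gchoose i) \<odot>\<^bsub>V\<^esub> Y a (int i) b) (m + n - int i)))))"
    unfolding gm_cl by (simp only: gbr_cl term_closed a b pre_bracket_fsum(1))
  also have "\<dots> = Sum_any (\<lambda>i::nat. M.coord (h (Qg.cl (laurent_term V ((of_int m gchoose i) \<odot>\<^bsub>V\<^esub> Y a (int i) b) (m + n - int i)))))"
    by (rule LV.additive_fsum[OF pre_bracket_fsum(3)[OF a b] pre_bracket_fsum(2)[OF a b]])
       (simp_all only: mlinear_zero[OF LV_complex_module M hq] M.coord_zero mlinearD(2)[OF hq] mlinearD(1)[OF hq] M.coord_add)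
  also have "\<dots> = pm.binsum m (\<lambda>i. M.coord (h (gm (Y a (int i) b) (m + n - int i))))"
  proof -
    have "M.coord (h (Qg.cl (laurent_term V (c \<odot>\<^bsub>V\<^esub> u) k))) = pscale c (M.coord (h (gm u k)))" if "u \<in> carrier V" for c u k
      using that mlinearD(3)[OF h gm_closed[OF that]] mlinearD(1)[OF h gm_closed[OF that]]
      by (simp add: gm_cl[symmetric] gm_smult M.coord_scale)
    then show ?thesis unfolding pm.binsum_def using Y_closed[OF a b] by simp
  qed
  finally show ?thesis .
qed

end

context vertex_operator_algebra
begin

abbreviation gplus where "gplus \<equiv> gV_plus V Y vac"

lemma gplus_gens: "{gm a n | a n. a \<in> carrier V \<and> n \<ge> 0} \<subseteq> carrier GV"
  by auto

lemma gplus_submodule: "submodule gplus CC GV"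
  unfolding gV_plus_def by (rule GV.lin_span_submodule[OF gplus_gens])

lemma gm_gplus: "a \<in> carrier V \<Longrightarrow> n \<ge> 0 \<Longrightarrow> gm a n \<in> gplus"
  unfolding gV_plus_def by (rule subsetD[OF lin_span_superset]) blast

lemma gplus_subset: "gplus \<subseteq> carrier GV"
  by (rule GV.submodD(1)[OF gplus_submodule])

text \<open>
  For \<open>m, n \<ge> 0\<close> the coefficient \<open>(m choose i)\<close> vanishes for \<open>i > m\<close>, and for \<open>i \<le> m\<close> the index \<open>m + n - i\<close> is
  not negative.
\<close>

lemma gplus_modes_br:
  assumes a: "a \<in> carrier V" and b: "b \<in> carrier V" and m: "m \<ge> 0" and n: "n \<ge> 0"
  shows "gbr (gm a m) (gm b n) \<in> gplus"
proof -
  let ?F = "\<lambda>i::nat. laurent_term V ((of_int m gchoose i) \<odot>\<^bsub>V\<^esub> Y a (int i) b) (m + n - int i)"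
  let ?H = "{f \<in> carrier LV. Qg.cl f \<in> gplus}"
  have H: "submodule ?H CC LV"
    by (rule mlinear_vimage[OF LV_complex_module GV.complex_module_axioms Qg_mlinear gplus_submodule])
  have "?F i \<in> ?H" for i
  proof (cases "int i \<le> m")
    case True
    then show ?thesis
      using gm_gplus[of "(of_int m gchoose i) \<odot>\<^bsub>V\<^esub> Y a (int i) b" "m + n - int i"] a b n pre_bracket_fsum(3)[OF a b]
      by (simp add: gm_cl Y_closed)
  next
    case False
    have "(of_int m :: complex) = of_nat (nat m)" using m by simp
    then have "(of_int m gchoose i :: complex) = 0"
      using False m by (simp only: binomial_gbinomial[symmetric]) (simp add: binomial_eq_0)
    then have "?F i = \<zero>\<^bsub>LV\<^esub>" using a b by (simp add: Y_closed term_zero del: laurent_simps)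
    then show ?thesis using LV.submodD(2)[OF H] by (simp only:)
  qed
  then have "fsum LV ?F \<in> ?H" by (rule LV.submod_fsum[OF H])
  then show ?thesis
    unfolding gm_cl by (simp add: gbr_cl a b pre_bracket_fsum(1))
qed

lemma gplus_br: assumes x: "x \<in> gplus" and y: "y \<in> gplus" shows "gbr x y \<in> gplus"
proof -
  have 1: "gbr (gm a m) y \<in> gplus" if a: "a \<in> carrier V" "m \<ge> 0" for a m
  proof (rule mlinear_span[OF GV.complex_module_axioms GV.complex_module_axioms gbr_mlinear_right[OF gm_closed[OF a(1)]] gplus_submodule gplus_gens _ y[unfolded gV_plus_def]])
    fix z assume "z \<in> {gm a n | a n. a \<in> carrier V \<and> n \<ge> 0}"
    then show "gbr (gm a m) z \<in> gplus" using gplus_modes_br[OF a(1) _ a(2)] by blast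
  qed
  have yG: "y \<in> carrier GV" using y gplus_subset by blast
  show ?thesis
  proof (rule mlinear_span[OF GV.complex_module_axioms GV.complex_module_axioms gbr_mlinear_left[OF yG] gplus_submodule gplus_gens _ x[unfolded gV_plus_def]])
    fix z assume "z \<in> {gm a n | a n. a \<in> carrier V \<and> n \<ge> 0}"
    then show "gbr z y \<in> gplus" using 1 by blast
  qed
qed

sublocale I: induced GV gbr gplus
  by (intro induced.intro induced_axioms.intro bracket_space.intro bracket_space_axioms.intro
      GV.complex_module_axioms gbr_closed gplus_submodule gplus_br)

lemma IV_eq: "IV V Y vac = I.IV" by (simp add: IV_def)

lemma IV_act_eq: "IV_act V Y vac = ind_act GV gbr gplus" by (simp add: IV_act_def)

section \<open>The level quotient\<close>

definition level_shift where "level_shift l = (\<lambda>w. ind_act GV gbr gplus (gm vac (-1)) w \<ominus>\<^bsub>I.IV\<^esub> l \<odot>\<^bsub>I.IV\<^esub> w)"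

lemma K_closed: "gm vac (-1) \<in> carrier GV"
  by (rule gm_closed[OF vac_closed])

lemma level_shift_mlinear: "mlinear I.IV I.IV (level_shift l)"
  unfolding level_shift_def
  by (rule mlinear_diff[OF I.IV.complex_module_axioms I.act_mlinear[OF K_closed] mlinear_smult[OF I.IV.complex_module_axioms id_mlinear]])

lemma level_rels_eq: "level_rels V Y vac l = level_shift l ` carrier I.IV"
  by (simp add: level_rels_def level_shift_def IV_eq IV_act_eq)

lemma level_rels_submodule: "submodule (level_rels V Y vac l) CC I.IV"
  unfolding level_rels_eq
  by (rule mlinear_image[OF I.IV.complex_module_axioms I.IV.complex_module_axioms level_shift_mlinear I.IV.carrier_is_submodule])

lemma level_quotient: "quotient I.IV (level_rels V Y vac l)"
  by (intro quotient.intro quotient_axioms.intro I.IV.complex_module_axioms level_rels_submodule)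

lemma Vlevel_eq: "Vlevel V Y vac l = quot_module I.IV (level_rels V Y vac l)"
  by (simp add: Vlevel_def IV_eq)

lemma act_zero: "w \<in> carrier I.IV \<Longrightarrow> ind_act GV gbr gplus \<zero>\<^bsub>GV\<^esub> w = \<zero>\<^bsub>I.IV\<^esub>"
  using I.act_smult[of "\<zero>\<^bsub>GV\<^esub>" w 0] I.act_closed[of "\<zero>\<^bsub>GV\<^esub>" w] by simp

text \<open>
  \<open>vac(-1)\<close> is central, so it commutes with the action of every \<open>x\<close>. Hence the image of \<open>vac(-1) - \<ell>\<close> is
  stable under \<open>g(V)\<close>.
\<close>

lemma act_level_shift:
  assumes x: "x \<in> carrier GV" and w: "w \<in> carrier I.IV"
  shows "ind_act GV gbr gplus x (level_shift l w) = level_shift l (ind_act GV gbr gplus x w)"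
proof -
  let ?a = "ind_act GV gbr gplus"
  let ?K = "gm vac (-1)"
  note Kw = I.act_closed[OF K_closed w] and xw = I.act_closed[OF x w]
  note xKw = I.act_closed[OF x Kw] and Kxw = I.act_closed[OF K_closed xw]
  have "?a x (?a ?K w) \<ominus>\<^bsub>I.IV\<^esub> ?a ?K (?a x w) = \<zero>\<^bsub>I.IV\<^esub>"
    using I.act_bracket[OF x K_closed w] by (simp add: gbr_vac x act_zero w)
  then have "I.IV.coord (?a x (?a ?K w)) - I.IV.coord (?a ?K (?a x w)) = 0"
    using I.IV.coord_minus[OF xKw Kxw] by simp
  then have "?a x (?a ?K w) = ?a ?K (?a x w)" using I.IV.coord_eq_iff[OF xKw Kxw] by simp
  then show ?thesis
    unfolding level_shift_def
    using mlinear_minus[OF I.IV.complex_module_axioms I.IV.complex_module_axioms I.act_mlinear[OF x] Kw I.IV.smult_cl[OF w]]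
      mlinearD(3)[OF I.act_mlinear[OF x] w] by simp
qed

lemma act_level_rels: "x \<in> carrier GV \<Longrightarrow> z \<in> level_rels V Y vac l \<Longrightarrow> ind_act GV gbr gplus x z \<in> level_rels V Y vac l"
  unfolding level_rels_eq using act_level_shift I.act_closed by auto

end

text \<open>
  A \<open>g(V)\<close>-module of level \<open>\<ell>\<close> that is generated by one vector killed by \<open>g(V)\<^sup>+\<close>. Everything about the
  vertex operator algebra structure is derived from these properties. The carrier is a set over an
  arbitrary type \<open>'w\<close>, so that the nested function types of the induced module stay out of sight.
\<close>

locale vacuum_module = vertex_operator_algebra V Y vac gr \<omega> r + W: complex_module W
  for V :: "(complex, 'v) module" and Y :: "'v \<Rightarrow> int \<Rightarrow> 'v \<Rightarrow> 'v" and vac :: 'v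
    and gr :: "int \<Rightarrow> 'v set" and \<omega> :: 'v and r :: complex and W :: "(complex, 'w) module" +
  fixes ac :: "(int \<Rightarrow> 'v) set \<Rightarrow> 'w \<Rightarrow> 'w" and \<Omega> :: 'w and l :: complex
  assumes ac_right: "x \<in> carrier GV \<Longrightarrow> mlinear W W (ac x)"
    and ac_left: "w \<in> carrier W \<Longrightarrow> mlinear GV W (\<lambda>x. ac x w)"
    and ac_bracket: "x \<in> carrier GV \<Longrightarrow> y \<in> carrier GV \<Longrightarrow> w \<in> carrier W \<Longrightarrow>
        ac x (ac y w) \<ominus>\<^bsub>W\<^esub> ac y (ac x w) = ac (gbr x y) w"
    and vac_W: "\<Omega> \<in> carrier W"
    and ac_plus: "x \<in> gplus \<Longrightarrow> ac x \<Omega> = \<zero>\<^bsub>W\<^esub>"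
    and ac_level: "w \<in> carrier W \<Longrightarrow> ac (gm vac (-1)) w = l \<odot>\<^bsub>W\<^esub> w"
    and ac_cyclic: "submodule H CC W \<Longrightarrow> \<Omega> \<in> H \<Longrightarrow> (\<And>x w. x \<in> carrier GV \<Longrightarrow> w \<in> H \<Longrightarrow> ac x w \<in> H) \<Longrightarrow>
        w \<in> carrier W \<Longrightarrow> w \<in> H"

theorem (in vertex_operator_algebra) Vlevel_vacuum_module:
  "vacuum_module V Y vac gr \<omega> r (Vlevel V Y vac l) (Vlevel_act V Y vac l) (Vlevel_vac V Y vac l) l"
proof -
  interpret R: quotient I.IV "level_rels V Y vac l" by (rule level_quotient)
  let ?W = "Vlevel V Y vac l" and ?ac = "Vlevel_act V Y vac l" and ?a = "ind_act GV gbr gplus"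
  interpret W: complex_module ?W unfolding Vlevel_eq by (rule R.quot_complex_module)
  have Wc: "carrier ?W = R.cl ` carrier I.IV" by (simp add: Vlevel_eq R.quot_carrier)
  have cl: "mlinear I.IV ?W R.cl" unfolding Vlevel_eq by (rule R.cl_mlinear)
  have ac_def: "?ac x = coset_map I.IV (level_rels V Y vac l) (?a x)" for x
    by (simp add: Vlevel_act_def IV_eq IV_act_eq)
  have acr: "mlinear ?W ?W (?ac x)" if x: "x \<in> carrier GV" for x
    unfolding ac_def Vlevel_eq
    by (rule coset_map_mlinear(1)[OF R.quotient_axioms R.quotient_axioms I.act_mlinear[OF x]]) (rule act_level_rels[OF x])
  have accl: "?ac x (R.cl w) = R.cl (?a x w)" if x: "x \<in> carrier GV" and w: "w \<in> carrier I.IV" for x w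
    unfolding ac_def
    by (rule coset_map_mlinear(2)[OF R.quotient_axioms R.quotient_axioms I.act_mlinear[OF x] _ w]) (rule act_level_rels[OF x])
  have vac: "Vlevel_vac V Y vac l = R.cl (ind_gen GV gbr gplus)"
    by (simp add: Vlevel_vac_def R.cl_def IV_eq)
  show ?thesis
  proof (intro vacuum_module.intro vacuum_module_axioms.intro vertex_operator_algebra_axioms W.complex_module_axioms)
    show "mlinear ?W ?W (?ac x)" if "x \<in> carrier GV" for x by (rule acr[OF that])
  next
    fix w assume "w \<in> carrier ?W"
    then obtain u where u: "u \<in> carrier I.IV" "w = R.cl u" unfolding Wc by blast
    have "mlinear GV I.IV (\<lambda>x. ?a x u)"
      using u(1) by (simp add: mlinear_def I.act_closed I.act_add I.act_smult)
    from mlinear_compose[OF this cl] show "mlinear GV ?W (\<lambda>x. ?ac x w)"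
      unfolding u(2) by (simp add: mlinear_def accl u(1))
  next
    fix x y w assume x: "x \<in> carrier GV" and y: "y \<in> carrier GV" and "w \<in> carrier ?W"
    then obtain u where u: "u \<in> carrier I.IV" "w = R.cl u" unfolding Wc by blast
    note xu = I.act_closed[OF x u(1)] and yu = I.act_closed[OF y u(1)]
    show "?ac x (?ac y w) \<ominus>\<^bsub>?W\<^esub> ?ac y (?ac x w) = ?ac (gbr x y) w"
      unfolding u(2) accl[OF x u(1)] accl[OF y u(1)] accl[OF x yu] accl[OF y xu] accl[OF gbr_closed[OF x y] u(1)]
        mlinear_minus[OF I.IV.complex_module_axioms W.complex_module_axioms cl I.act_closed[OF x yu] I.act_closed[OF y xu], symmetric]
        I.act_bracket[OF x y u(1)] ..
  next
    show "Vlevel_vac V Y vac l \<in> carrier ?W" unfolding vac using mlinearD(1)[OF cl I.gen_closed] .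
  next
    fix x assume x: "x \<in> gplus"
    then have xG: "x \<in> carrier GV" using gplus_subset by blast
    show "?ac x (Vlevel_vac V Y vac l) = \<zero>\<^bsub>?W\<^esub>"
      unfolding vac accl[OF xG I.gen_closed] I.act_gen[OF x] by (rule mlinear_zero[OF I.IV.complex_module_axioms W.complex_module_axioms cl])
  next
    fix w assume "w \<in> carrier ?W"
    then obtain u where u: "u \<in> carrier I.IV" "w = R.cl u" unfolding Wc by blast
    have "?a (gm vac (-1)) u \<ominus>\<^bsub>I.IV\<^esub> l \<odot>\<^bsub>I.IV\<^esub> u \<in> level_rels V Y vac l"
      unfolding level_rels_eq level_shift_def using u(1) by blast
    then have "R.cl (?a (gm vac (-1)) u) = R.cl (l \<odot>\<^bsub>I.IV\<^esub> u)"
      by (subst R.cl_eq_iff[OF I.act_closed[OF K_closed u(1)] I.IV.smult_cl[OF u(1)]])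
    then show "?ac (gm vac (-1)) w = l \<odot>\<^bsub>?W\<^esub> w"
      unfolding u(2) accl[OF K_closed u(1)] mlinearD(3)[OF cl u(1)] .
  next
    fix H w assume H: "submodule H CC ?W" and v: "Vlevel_vac V Y vac l \<in> H"
      and cyc: "\<And>x w. x \<in> carrier GV \<Longrightarrow> w \<in> H \<Longrightarrow> ?ac x w \<in> H" and "w \<in> carrier ?W"
    then obtain u where u: "u \<in> carrier I.IV" "w = R.cl u" unfolding Wc by blast
    have "u \<in> {u \<in> carrier I.IV. R.cl u \<in> H}"
    proof (rule I.cyclic[OF mlinear_vimage[OF I.IV.complex_module_axioms W.complex_module_axioms cl H] _ _ u(1)])
      show "ind_gen GV gbr gplus \<in> {u \<in> carrier I.IV. R.cl u \<in> H}"
        using v I.gen_closed unfolding vac by blast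
      fix x u' assume x: "x \<in> carrier GV" and u': "u' \<in> {u \<in> carrier I.IV. R.cl u \<in> H}"
      then have "R.cl (?a x u') \<in> H" using cyc[OF x, of "R.cl u'"] accl[OF x, of u'] by simp
      then show "?a x u' \<in> {u \<in> carrier I.IV. R.cl u \<in> H}" using I.act_closed[OF x] u' by blast
    qed
    then show "w \<in> H" using u(2) by blast
  qed
qed

section \<open>Fields on a vacuum module\<close>

context vacuum_module
begin

lemma ac_closed: "x \<in> carrier GV \<Longrightarrow> w \<in> carrier W \<Longrightarrow> ac x w \<in> carrier W"
  using mlinearD(1)[OF ac_right] .

lemma gplus_GV: "x \<in> gplus \<Longrightarrow> x \<in> carrier GV"
  using gplus_subset by blast

abbreviation modeW where "modeW a n w \<equiv> ac (gm a n) w"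

lemma modeW_closed: "a \<in> carrier V \<Longrightarrow> w \<in> carrier W \<Longrightarrow> modeW a n w \<in> carrier W"
  by (rule ac_closed[OF gm_closed])

lemma modeW_mlinear: "w \<in> carrier W \<Longrightarrow> mlinear V W (\<lambda>a. modeW a n w)"
  using mlinear_compose[OF gm_mlinear ac_left] .

lemma modeW_zero: "w \<in> carrier W \<Longrightarrow> modeW \<zero>\<^bsub>V\<^esub> n w = \<zero>\<^bsub>W\<^esub>"
  by (rule mlinear_zero[OF VM.complex_module_axioms W.complex_module_axioms modeW_mlinear])

lemma modeW_vac: "a \<in> carrier V \<Longrightarrow> n \<ge> 0 \<Longrightarrow> modeW a n \<Omega> = \<zero>\<^bsub>W\<^esub>"
  by (rule ac_plus[OF gm_gplus])

text \<open>
  The commutator formula of the modes, in a form to which the field calculus applies.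
\<close>

lemma modeW_commutator:
  assumes a: "a \<in> carrier V" and b: "b \<in> carrier V" and w: "w \<in> carrier W"
  shows "W.coord (modeW a m (modeW b n w)) - W.coord (modeW b n (modeW a m w)) =
    pm.binsum m (\<lambda>i. W.coord (modeW (Y a (int i) b) (m + n - int i) w))"
proof -
  have "W.coord (modeW a m (modeW b n w)) - W.coord (modeW b n (modeW a m w)) = W.coord (ac (gbr (gm a m) (gm b n)) w)"
    unfolding ac_bracket[OF gm_closed[OF a] gm_closed[OF b] w, symmetric]
    by (rule W.coord_minus[symmetric]) (intro modeW_closed a b w)+
  also have "\<dots> = pm.binsum m (\<lambda>i. W.coord (modeW (Y a (int i) b) (m + n - int i) w))"
    by (rule gbr_modes[OF a b W.complex_module_axioms ac_left[OF w]])
  finally show ?thesis .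
qed

lemma product_evzero:
  assumes "a \<in> carrier V" "b \<in> carrier V"
  shows "\<exists>I. \<forall>i\<ge>I. Y a (int i) b = \<zero>\<^bsub>V\<^esub>"
proof -
  obtain N where "\<forall>k\<ge>N. Y a k b = \<zero>\<^bsub>V\<^esub>" using truncation[OF assms] by blast
  then show ?thesis by (intro exI[of _ "nat N"]) auto
qed

lemma W_induct:
  assumes H: "submodule H CC W" and v: "\<Omega> \<in> H"
    and step: "\<And>a n w. a \<in> carrier V \<Longrightarrow> w \<in> H \<Longrightarrow> modeW a n w \<in> H" and w: "w \<in> carrier W"
  shows "w \<in> H"
proof (rule ac_cyclic[OF H v _ w])
  fix x u assume x: "x \<in> carrier GV" and u: "u \<in> H"
  have uW: "u \<in> carrier W" using u W.submodD(1)[OF H] by blast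
  have "x \<in> {x \<in> carrier GV. ac x u \<in> H}"
    by (rule GV_submodule_all[OF mlinear_vimage[OF GV.complex_module_axioms W.complex_module_axioms ac_left[OF uW] H] _ x])
       (use step u in auto)
  then show "ac x u \<in> H" by blast
qed

text \<open>
  The vectors on which every \<open>a(z)\<close> has only finitely many negative powers of \<open>z\<close>.
\<close>

definition restricted where
  "restricted = {w \<in> carrier W. \<forall>a\<in>carrier V. \<exists>N. \<forall>n\<ge>N. modeW a n w = \<zero>\<^bsub>W\<^esub>}"

lemma restricted_submodule: "submodule restricted CC W"
proof (rule W.submodI)
  show "restricted \<subseteq> carrier W" by (auto simp: restricted_def)
  have z: "modeW a n \<zero>\<^bsub>W\<^esub> = \<zero>\<^bsub>W\<^esub>" if "a \<in> carrier V" for a n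
    by (rule mlinear_zero[OF W.complex_module_axioms W.complex_module_axioms ac_right[OF gm_closed[OF that]]])
  then show "\<zero>\<^bsub>W\<^esub> \<in> restricted" by (simp add: restricted_def)
next
  fix u v assume u: "u \<in> restricted" and v: "v \<in> restricted"
  have uv: "u \<in> carrier W" "v \<in> carrier W" using u v by (auto simp: restricted_def)
  have "\<exists>N. \<forall>n\<ge>N. modeW a n (u \<oplus>\<^bsub>W\<^esub> v) = \<zero>\<^bsub>W\<^esub>" if a: "a \<in> carrier V" for a
  proof -
    obtain N M where "\<forall>n\<ge>N. modeW a n u = \<zero>\<^bsub>W\<^esub>" "\<forall>n\<ge>M. modeW a n v = \<zero>\<^bsub>W\<^esub>"
      using u v a unfolding restricted_def by blast
    then have "\<forall>n\<ge>max N M. modeW a n (u \<oplus>\<^bsub>W\<^esub> v) = \<zero>\<^bsub>W\<^esub>"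
      by (simp add: mlinearD(2)[OF ac_right[OF gm_closed[OF a]] uv])
    then show ?thesis by blast
  qed
  then show "u \<oplus>\<^bsub>W\<^esub> v \<in> restricted" using uv by (simp add: restricted_def)
next
  fix c u assume u: "u \<in> restricted"
  have uW: "u \<in> carrier W" using u by (auto simp: restricted_def)
  have "\<exists>N. \<forall>n\<ge>N. modeW a n (c \<odot>\<^bsub>W\<^esub> u) = \<zero>\<^bsub>W\<^esub>" if a: "a \<in> carrier V" for a
  proof -
    obtain N where "\<forall>n\<ge>N. modeW a n u = \<zero>\<^bsub>W\<^esub>" using u a unfolding restricted_def by blast
    then have "\<forall>n\<ge>N. modeW a n (c \<odot>\<^bsub>W\<^esub> u) = \<zero>\<^bsub>W\<^esub>"
      using mlinearD(3)[OF ac_right[OF gm_closed[OF a]] uW] by simp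
    then show ?thesis by blast
  qed
  then show "c \<odot>\<^bsub>W\<^esub> u \<in> restricted" using uW by (simp add: restricted_def)
qed

text \<open>
  The condition holds for \<open>\<Omega>\<close>. If it holds for \<open>w\<close>, then \<open>a(n) b(k) w = b(k) a(n) w + \<Sum>i. (n choose i) (a\<^sub>i b)(n + k - i) w\<close>
  vanishes for large \<open>n\<close>, since only finitely many \<open>a\<^sub>i b\<close> are nonzero.
\<close>

lemma all_restricted: assumes "w \<in> carrier W" shows "w \<in> restricted"
proof (rule W_induct[OF restricted_submodule _ _ assms])
  show "\<Omega> \<in> restricted" using vac_W modeW_vac by (auto simp: restricted_def)
next
  fix b k w assume b: "b \<in> carrier V" and w: "w \<in> restricted"
  have wW: "w \<in> carrier W" using w by (simp add: restricted_def)
  have "\<exists>N. \<forall>n\<ge>N. modeW a n (modeW b k w) = \<zero>\<^bsub>W\<^esub>" if a: "a \<in> carrier V" for a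
  proof -
    obtain I where I: "\<forall>i\<ge>I. Y a (int i) b = \<zero>\<^bsub>V\<^esub>" using product_evzero[OF a b] by blast
    have "\<exists>M. \<forall>i<J. \<forall>n\<ge>M. modeW (Y a (int i) b) n w = \<zero>\<^bsub>W\<^esub>" for J
    proof (induction J)
      case 0 show ?case by simp
    next
      case (Suc J)
      then obtain M where M: "\<forall>i<J. \<forall>n\<ge>M. modeW (Y a (int i) b) n w = \<zero>\<^bsub>W\<^esub>" by blast
      obtain M' where M': "\<forall>n\<ge>M'. modeW (Y a (int J) b) n w = \<zero>\<^bsub>W\<^esub>"
        using w Y_closed[OF a b] unfolding restricted_def by blast
      show ?case by (rule exI[of _ "max M M'"]) (use M M' in \<open>auto simp: less_Suc_eq\<close>)
    qed
    then obtain M where M: "\<forall>i<I. \<forall>n\<ge>M. modeW (Y a (int i) b) n w = \<zero>\<^bsub>W\<^esub>" by blast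
    obtain N0 where N0: "\<forall>n\<ge>N0. modeW a n w = \<zero>\<^bsub>W\<^esub>" using w a unfolding restricted_def by blast
    have "modeW a n (modeW b k w) = \<zero>\<^bsub>W\<^esub>" if n: "n \<ge> max N0 (M + int I - k)" for n
    proof -
      have "modeW (Y a (int i) b) (n + k - int i) w = \<zero>\<^bsub>W\<^esub>" for i
      proof (cases "i < I")
        case True then show ?thesis using M n by auto
      next
        case False then show ?thesis using I modeW_zero[OF wW] by simp
      qed
      then have "W.coord (modeW a n (modeW b k w)) - W.coord (modeW b k (modeW a n w)) = 0"
        unfolding modeW_commutator[OF a b wW] by simp
      moreover have "modeW b k (modeW a n w) = \<zero>\<^bsub>W\<^esub>"
        using N0 n mlinear_zero[OF W.complex_module_axioms W.complex_module_axioms ac_right[OF gm_closed[OF b]]] by simp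
      ultimately have "W.coord (modeW a n (modeW b k w)) = 0" by simp
      then show ?thesis using W.coord_eq_0_iff[OF modeW_closed[OF a modeW_closed[OF b wW]]] by simp
    qed
    then show ?thesis by blast
  qed
  then show "modeW b k w \<in> restricted" using modeW_closed[OF b wW] by (simp add: restricted_def)
qed

definition lift_op :: "('w \<Rightarrow> 'w) \<Rightarrow> ('w \<Rightarrow>\<^sub>0 complex) \<Rightarrow> ('w \<Rightarrow>\<^sub>0 complex)" where
  "lift_op f p = W.coord (f (W.uncoord p))"

lemma lift_op_lin: assumes "mlinear W W f" shows "pm.lin (lift_op f)"
  by (simp add: pm.lin_def lift_op_def W.uncoord_add W.uncoord_scale mlinearD[OF assms] W.coord_add W.coord_scale)

text \<open>
  The field of \<open>a\<close>, transported to the coordinate space, which is a vector space on its whole type.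
\<close>

definition mode_field :: "'v \<Rightarrow> int \<Rightarrow> ('w \<Rightarrow>\<^sub>0 complex) \<Rightarrow> ('w \<Rightarrow>\<^sub>0 complex)" where
  "mode_field a n = lift_op (modeW a n)"

lemma mode_field_coord: "w \<in> carrier W \<Longrightarrow> mode_field a n (W.coord w) = W.coord (modeW a n w)"
  by (simp add: mode_field_def lift_op_def)

lemma mode_field_qf: assumes a: "a \<in> carrier V" shows "pm.quantum_field (mode_field a)"
  unfolding pm.quantum_field_def
proof (intro conjI allI)
  show "pm.lin (mode_field a n)" for n unfolding mode_field_def by (rule lift_op_lin[OF ac_right[OF gm_closed[OF a]]])
  show "\<exists>N. \<forall>n\<ge>N. mode_field a n p = 0" for p
  proof -
    obtain N where "\<forall>n\<ge>N. modeW a n (W.uncoord p) = \<zero>\<^bsub>W\<^esub>"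
      using all_restricted[of "W.uncoord p"] a unfolding restricted_def by auto
    then show ?thesis by (intro exI[of _ N]) (simp add: mode_field_def lift_op_def)
  qed
qed

lemma mode_field_commutator:
  assumes a: "a \<in> carrier V" and b: "b \<in> carrier V"
  shows "mode_field a m (mode_field b n p) - mode_field b n (mode_field a m p) = pm.binsum m (\<lambda>i. mode_field (Y a (int i) b) (m + n - int i) p)"
  using modeW_commutator[OF a b W.uncoord_closed, of m n p]
  by (simp add: mode_field_def lift_op_def modeW_closed a b)

lemma mode_field_zero: "mode_field \<zero>\<^bsub>V\<^esub> n p = 0"
  by (simp add: mode_field_def lift_op_def modeW_zero)

text \<open>
  The commutator is \<open>\<Sum>i. (m choose i) (a\<^sub>i b)(m + n - i)\<close>. Multiplication by \<open>x - y\<close> replaces the coefficient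
  \<open>(m choose i)\<close> by \<open>(m + 1 choose i) - (m choose i) = (m choose i - 1)\<close>, so \<open>I\<close> factors remove all terms
  with \<open>i < I\<close>; the other products \<open>a\<^sub>i b\<close> are zero.
\<close>

lemma mode_field_local: assumes a: "a \<in> carrier V" and b: "b \<in> carrier V" shows "pm.mutually_local (mode_field a) (mode_field b)"
proof -
  obtain I where I: "\<forall>i\<ge>I. Y a (int i) b = \<zero>\<^bsub>V\<^esub>" using product_evzero[OF a b] by blast
  have "pm.borcherds (mode_field a) (mode_field b) (int I) m n p = 0" for m n p
  proof -
    define EE where "EE i k = mode_field (Y a (int i) b) k p" for i k
    have EE0: "EE i k = 0" if "i \<ge> I" for i k using I that by (simp add: EE_def mode_field_zero)
    have ev: "evzero (\<lambda>i. EE (j + i) (k - int i))" for j k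
      unfolding evzero_def by (rule exI[of _ I]) (use EE0 in auto)
    have base: "(\<lambda>m n. pm.borcherds (mode_field a) (mode_field b) 0 m n p) = (\<lambda>m n. pm.binsum m (\<lambda>i. EE (0 + i) (m + n - int i)))"
      by (simp add: pm.borcherds_0 mode_field_commutator[OF a b] EE_def)
    have step: "pm.shift_diff (\<lambda>m n. pm.binsum m (\<lambda>i. EE (j + i) (m + n - int i)))
       = (\<lambda>m n. pm.binsum m (\<lambda>i. EE (Suc j + i) (m + n - int i)))" for j
    proof (intro ext)
      fix m n
      have "pm.binsum (m + 1) (\<lambda>i. EE (j + i) (m + 1 + n - int i)) =
        pm.binsum m (\<lambda>i. EE (j + i) (m + 1 + n - int i)) + pm.binsum m (\<lambda>i. EE (j + Suc i) (m + 1 + n - int (Suc i)))"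
        by (rule pm.binsum_Suc[OF ev])
      then show "pm.shift_diff (\<lambda>m n. pm.binsum m (\<lambda>i. EE (j + i) (m + n - int i))) m n = pm.binsum m (\<lambda>i. EE (Suc j + i) (m + n - int i))"
        by (simp add: pm.shift_diff_def add_ac)
    qed
    have "(pm.shift_diff ^^ k) (\<lambda>m n. pm.borcherds (mode_field a) (mode_field b) 0 m n p) = (\<lambda>m n. pm.binsum m (\<lambda>i. EE (k + i) (m + n - int i)))" for k
    proof (induction k)
      case 0 show ?case unfolding funpow.simps id_apply by (rule base)
    next
      case (Suc k) then show ?case by (simp only: funpow.simps o_apply step)
    qed
    from this[of I] have "(\<lambda>m n. pm.borcherds (mode_field a) (mode_field b) (int I) m n p) = (\<lambda>m n. pm.binsum m (\<lambda>i. EE (I + i) (m + n - int i)))"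
      unfolding pm.borcherds_pow[OF mode_field_qf[OF a] mode_field_qf[OF b]] .
    also have "\<dots> = (\<lambda>m n. 0)" by (simp add: EE0)
    finally show ?thesis by (rule fun_cong[OF fun_cong])
  qed
  then show ?thesis by (auto simp: pm.mutually_local_def)
qed

definition translation_op where "translation_op = mode_field \<omega> 0"

sublocale GF: generating_fields pscale "mode_field ` carrier V" "W.coord \<Omega>" translation_op
proof (intro generating_fields.intro generating_fields_axioms.intro pm.complex_space_axioms)
  fix A assume "A \<in> mode_field ` carrier V"
  then obtain a where a: "a \<in> carrier V" "A = mode_field a" by blast
  show "pm.quantum_field A" unfolding a(2) by (rule mode_field_qf[OF a(1)])
  show "pm.translation_covariant translation_op A"
    unfolding pm.translation_covariant_def
  proof (intro allI)
    fix n p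
    have "translation_op (A n p) - A n (translation_op p) = mode_field (Y \<omega> 0 a) n p"
      using mode_field_commutator[OF conformal_closed a(1), of 0 n p] by (simp add: translation_op_def a(2))
    also have "\<dots> = W.coord (ac ((- of_int n) \<odot>\<^bsub>GV\<^esub> gm a (n - 1)) (W.uncoord p))"
      unfolding mode_field_def lift_op_def deriv_omega[OF a(1), symmetric] gm_deriv[OF a(1)] ..
    also have "\<dots> = pscale (- of_int n) (A (n - 1) p)"
      unfolding mlinearD(3)[OF ac_left[OF W.uncoord_closed] gm_closed[OF a(1)]]
      by (simp add: W.coord_scale modeW_closed a mode_field_def lift_op_def)
    finally show "translation_op (A n p) - A n (translation_op p) = pscale (- of_int n) (A (n - 1) p)" .
  qed
  show "A n (W.coord \<Omega>) = 0" if "n \<ge> 0" for n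
    using modeW_vac[OF a(1) that] by (simp add: a(2) mode_field_coord vac_W)
  fix B assume "B \<in> mode_field ` carrier V"
  then obtain b where b: "b \<in> carrier V" "B = mode_field b" by blast
  show "pm.mutually_local A B" unfolding a(2) b(2) by (rule mode_field_local[OF a(1) b(1)])
next
  show "pm.lin translation_op" unfolding translation_op_def by (rule pm.qf_lin[OF mode_field_qf[OF conformal_closed]])
  show "translation_op (W.coord \<Omega>) = 0" by (simp add: translation_op_def mode_field_coord vac_W modeW_vac conformal_closed)
qed

text \<open>
  The coordinate image of \<open>W\<close> and the space of states are both spanned from \<open>\<Omega>\<close> by the modes. This lemma
  and the next one identify them.
\<close>

lemma coord_state: assumes w: "w \<in> carrier W" shows "W.coord w \<in> GF.states"
proof -
  note S = GF.states_subspace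
  have "w \<in> {w \<in> carrier W. W.coord w \<in> GF.states}"
  proof (rule W_induct[OF _ _ _ w])
    show "submodule {w \<in> carrier W. W.coord w \<in> GF.states} CC W"
      by (rule W.submodI) (auto simp: pm.subspace_0[OF S] W.coord_add pm.subspace_add[OF S] W.coord_scale pm.subspace_scale[OF S])
    show "\<Omega> \<in> {w \<in> carrier W. W.coord w \<in> GF.states}" using vac_W GF.vac_state by simp
    fix a n u assume a: "a \<in> carrier V" and u: "u \<in> {w \<in> carrier W. W.coord w \<in> GF.states}"
    have "mode_field a n (W.coord u) \<in> GF.states" using GF.G_states[of "mode_field a" "W.coord u" n] a u by blast
    then show "modeW a n u \<in> {w \<in> carrier W. W.coord w \<in> GF.states}" using u modeW_closed[OF a] by (simp add: mode_field_coord)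
  qed
  then show ?thesis by blast
qed

lemma state_coord: assumes "p \<in> GF.states" shows "W.coord (W.uncoord p) = p"
proof -
  have "p \<in> {p. W.coord (W.uncoord p) = p}"
  proof (rule GF.states_induct[OF assms])
    show "W.coord \<Omega> \<in> {p. W.coord (W.uncoord p) = p}" by (simp add: vac_W)
    have u0: "W.uncoord 0 = \<zero>\<^bsub>W\<^esub>" using W.uncoord_scale[of 0 0] by simp
    show "pm.subspace {p. W.coord (W.uncoord p) = p}"
      by (rule pm.subspaceI) (auto simp: u0 W.uncoord_add W.uncoord_scale W.coord_add W.coord_scale)
    show "A n b \<in> {p. W.coord (W.uncoord p) = p}" if "A \<in> mode_field ` carrier V" for A n b
      using that by (auto simp: mode_field_def lift_op_def modeW_closed)
  qed
  then show ?thesis by blast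
qed

definition YW :: "'w \<Rightarrow> int \<Rightarrow> 'w \<Rightarrow> 'w" where
  "YW u n w = W.uncoord (GF.state_field (W.coord u) n (W.coord w))"

lemma YW_closed: "YW u n w \<in> carrier W"
  by (simp add: YW_def)

lemma coord_YW: "u \<in> carrier W \<Longrightarrow> w \<in> carrier W \<Longrightarrow> W.coord (YW u n w) = GF.state_field (W.coord u) n (W.coord w)"
  unfolding YW_def by (rule state_coord[OF GF.state_field_closed[OF coord_state coord_state]])

lemma YW_eqI: "u \<in> carrier W \<Longrightarrow> v \<in> carrier W \<Longrightarrow> W.coord u = W.coord v \<Longrightarrow> u = v"
  by (simp add: W.coord_eq_iff)

text \<open>
  The field of the vector \<open>a(-1)\<Omega>\<close> is the given field of \<open>a\<close>: this is the condition that
  characterises the natural structure.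
\<close>

lemma YW_generator:
  assumes a: "a \<in> carrier V" and w: "w \<in> carrier W"
  shows "YW (modeW a (-1) \<Omega>) n w = modeW a n w"
proof (rule YW_eqI[OF YW_closed modeW_closed[OF a w]])
  have "W.coord (YW (modeW a (-1) \<Omega>) n w) = GF.state_field (mode_field a (-1) (W.coord \<Omega>)) n (W.coord w)"
    by (simp add: coord_YW modeW_closed a w vac_W mode_field_coord)
  also have "\<dots> = mode_field a n (W.coord w)"
    by (rule GF.state_field_G[OF _ coord_state[OF w]]) (use a in blast)
  also have "\<dots> = W.coord (modeW a n w)" by (rule mode_field_coord[OF w])
  finally show "W.coord (YW (modeW a (-1) \<Omega>) n w) = W.coord (modeW a n w)" .
qed

lemma finite_nz: assumes "evzero g" shows "finite {i. pscale (c i) (g i) \<noteq> 0}"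
proof -
  obtain I where "\<forall>i\<ge>I. g i = 0" using evzD[OF assms] by blast
  then have "{i. pscale (c i) (g i) \<noteq> 0} \<subseteq> {..<I}" by (auto simp: not_le[symmetric])
  then show ?thesis by (rule finite_subset) simp
qed

lemma coord_fsum_binsum:
  assumes g: "\<And>i. g i \<in> carrier W" and ev: "evzero (\<lambda>i. W.coord (g i))"
  shows "W.coord (fsum W (\<lambda>i::nat. (of_int m gchoose i) \<odot>\<^bsub>W\<^esub> g i)) = pm.binsum m (\<lambda>i. W.coord (g i))"
proof -
  have "W.coord (fsum W (\<lambda>i::nat. (of_int m gchoose i) \<odot>\<^bsub>W\<^esub> g i)) = Sum_any (\<lambda>i. W.coord ((of_int m gchoose i) \<odot>\<^bsub>W\<^esub> g i))"
  proof (rule W.coord_fsum)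
    have "{i. (of_int m gchoose i) \<odot>\<^bsub>W\<^esub> g i \<noteq> \<zero>\<^bsub>W\<^esub>} \<subseteq> {i. pscale (of_int m gchoose i) (W.coord (g i)) \<noteq> 0}"
      using g by (auto simp: W.coord_scale[symmetric] W.coord_eq_0_iff simp del: pm.scale_eq_0_iff)
    then show "finite {i. (of_int m gchoose i) \<odot>\<^bsub>W\<^esub> g i \<noteq> \<zero>\<^bsub>W\<^esub>}"
      by (rule finite_subset) (rule finite_nz[OF ev])
  qed (use g in simp)
  also have "\<dots> = pm.binsum m (\<lambda>i. W.coord (g i))"
    unfolding pm.binsum_def using g by (simp add: W.coord_scale)
  finally show ?thesis .
qed

lemma YW_jacobi:
  assumes a: "a \<in> carrier W" and b: "b \<in> carrier W" and c: "c \<in> carrier W"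
  shows "fsum W (\<lambda>i::nat. (of_int m gchoose i) \<odot>\<^bsub>W\<^esub> YW (YW a (k + int i) b) (m + n - int i) c) =
          fsum W (\<lambda>i::nat. ((-1) ^ i * (of_int k gchoose i)) \<odot>\<^bsub>W\<^esub>
            (YW a (m + k - int i) (YW b (n + int i) c) \<ominus>\<^bsub>W\<^esub>
             ((-1) powi k) \<odot>\<^bsub>W\<^esub> YW b (n + k - int i) (YW a (m + int i) c)))" (is "?L = ?R")
proof -
  let ?A = "GF.state_field (W.coord a)" and ?B = "GF.state_field (W.coord b)" and ?c = "W.coord c"
  note s = coord_state[OF a] coord_state[OF b] coord_state[OF c]
  note q = GF.state_field_qf[OF s(1)] GF.state_field_qf[OF s(2)]
  have evL: "evzero (\<lambda>i. W.coord (YW (YW a (k + int i) b) (m + n - int i) c))"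
  proof -
    obtain N where N: "\<forall>j\<ge>N. ?A j (W.coord b) = 0" using pm.qf_trunc[OF q(1)] by blast
    show ?thesis
      unfolding evzero_def
      by (rule exI[of _ "nat (N - k)"]) (use N in \<open>auto simp: coord_YW YW_closed a b c GF.state_field_zero s\<close>)
  qed
  have "W.coord ?L = pm.binsum m (\<lambda>i. W.coord (YW (YW a (k + int i) b) (m + n - int i) c))"
    by (rule coord_fsum_binsum[OF YW_closed evL])
  also have "\<dots> = pm.borcherds ?A ?B k m n ?c"
    using GF.state_field_Borcherds[OF s, of m k n] by (simp add: coord_YW YW_closed a b c)
  finally have L: "W.coord ?L = pm.borcherds ?A ?B k m n ?c" .
  let ?t = "\<lambda>i::nat. YW a (m + k - int i) (YW b (n + int i) c) \<ominus>\<^bsub>W\<^esub> ((-1) powi k) \<odot>\<^bsub>W\<^esub> YW b (n + k - int i) (YW a (m + int i) c)"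
  let ?g = "\<lambda>i::nat. (-1) ^ i \<odot>\<^bsub>W\<^esub> ?t i"
  have t: "?t i \<in> carrier W" for i by (simp add: YW_closed)
  have ct: "W.coord (?g i) = pscale ((-1) ^ i) (?A (m + k - int i) (?B (n + int i) ?c))
     - pscale ((-1) powi k) (pscale ((-1) ^ i) (?B (n + k - int i) (?A (m + int i) ?c)))" for i
    by (simp add: W.coord_scale W.coord_minus YW_closed coord_YW a b c pm.scale_right_diff_distrib mult.commute)
  note e1 = pm.borcherds_evzero[OF q(1,2), of "m + k" n ?c] and e2 = pm.borcherds_evzero[OF q(2,1), of "n + k" m ?c]
  have e2': "evzero (\<lambda>i. pscale ((-1) powi k) (pscale ((-1) ^ i) (?B (n + k - int i) (?A (m + int i) ?c))))"
    using e2 by (auto simp: evzero_def)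
  have evR: "evzero (\<lambda>i. W.coord (?g i))" unfolding ct by (rule evzero_diff[OF e1 e2'])
  have "?R = fsum W (\<lambda>i::nat. (of_int k gchoose i) \<odot>\<^bsub>W\<^esub> ?g i)"
    using t by (intro arg_cong[where f = "fsum W"] ext) (simp add: W.smult_assoc'[symmetric] mult.commute)
  then have "W.coord ?R = pm.binsum k (\<lambda>i. W.coord (?g i))"
    using coord_fsum_binsum[OF _ evR, of k] t by simp
  also have "\<dots> = pm.borcherds ?A ?B k m n ?c"
    unfolding ct pm.borcherds_def pm.binsum_diff[OF e1 e2'] pm.binsum_scale[OF e2] ..
  finally have "W.coord ?L = W.coord ?R" using L by simp
  then show ?thesis
    by (rule YW_eqI[rotated 2]) (auto intro!: W.fsum_closed simp: YW_closed)
qed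

text \<open>
  Each axiom is the coordinate image of a property of the state fields.
\<close>

theorem YW_vertex_algebra: "vertex_algebra W YW \<Omega>"
proof (intro vertex_algebra.intro vertex_algebra_axioms.intro)
  show "module CC W" using W.complex_module_axioms by (simp add: complex_module_def)
next
  fix a b n assume "a \<in> carrier W" "b \<in> carrier W"
  show "YW a n b \<in> carrier W" by (rule YW_closed)
next
  fix a a' b n assume a: "a \<in> carrier W" "a' \<in> carrier W" and b: "b \<in> carrier W"
  show "YW (a \<oplus>\<^bsub>W\<^esub> a') n b = YW a n b \<oplus>\<^bsub>W\<^esub> YW a' n b"
    by (rule YW_eqI) (simp_all add: YW_closed coord_YW W.coord_add a b GF.state_field_add_left coord_state)
next
  fix a b k n assume a: "a \<in> carrier W" and b: "b \<in> carrier W"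
  show "YW (k \<odot>\<^bsub>W\<^esub> a) n b = k \<odot>\<^bsub>W\<^esub> YW a n b"
    by (rule YW_eqI) (simp_all add: YW_closed coord_YW W.coord_scale a b GF.state_field_scale_left coord_state)
next
  fix a b b' n assume a: "a \<in> carrier W" and b: "b \<in> carrier W" "b' \<in> carrier W"
  show "YW a n (b \<oplus>\<^bsub>W\<^esub> b') = YW a n b \<oplus>\<^bsub>W\<^esub> YW a n b'"
    by (rule YW_eqI) (simp_all add: YW_closed coord_YW W.coord_add a b pm.lin_add[OF pm.qf_lin[OF GF.state_field_qf]] coord_state)
next
  fix a b k n assume a: "a \<in> carrier W" and b: "b \<in> carrier W"
  show "YW a n (k \<odot>\<^bsub>W\<^esub> b) = k \<odot>\<^bsub>W\<^esub> YW a n b"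
    by (rule YW_eqI) (simp_all add: YW_closed coord_YW W.coord_scale a b pm.lin_scale[OF pm.qf_lin[OF GF.state_field_qf]] coord_state)
next
  fix a b assume a: "a \<in> carrier W" and b: "b \<in> carrier W"
  obtain N where "\<forall>n\<ge>N. GF.state_field (W.coord a) n (W.coord b) = 0"
    using pm.qf_trunc[OF GF.state_field_qf[OF coord_state[OF a]]] by blast
  then have "\<forall>n\<ge>N. YW a n b = \<zero>\<^bsub>W\<^esub>"
    by (simp add: W.coord_eq_0_iff[symmetric] YW_closed coord_YW a b)
  then show "\<exists>N. \<forall>n\<ge>N. YW a n b = \<zero>\<^bsub>W\<^esub>" by blast
next
  show "\<Omega> \<in> carrier W" by (rule vac_W)
next
  fix b n assume b: "b \<in> carrier W"
  show "YW \<Omega> n b = (if n = - 1 then b else \<zero>\<^bsub>W\<^esub>)"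
    by (rule YW_eqI) (simp_all add: YW_closed coord_YW b vac_W GF.state_field_vacuum coord_state)
next
  fix a and n :: int assume a: "a \<in> carrier W" and n: "n \<ge> 0"
  show "YW a n \<Omega> = \<zero>\<^bsub>W\<^esub>"
    by (rule YW_eqI) (simp_all add: YW_closed coord_YW a vac_W GF.state_field_creation n coord_state)
next
  fix a assume a: "a \<in> carrier W"
  show "YW a (- 1) \<Omega> = a"
    by (rule YW_eqI) (simp_all add: YW_closed coord_YW a vac_W GF.state_field(2) coord_state)
next
  fix a b c m k n assume "a \<in> carrier W" "b \<in> carrier W" "c \<in> carrier W"
  then show "fsum W (\<lambda>i::nat. (of_int m gchoose i) \<odot>\<^bsub>W\<^esub> YW (YW a (k + int i) b) (m + n - int i) c) =
          fsum W (\<lambda>i::nat. ((-1) ^ i * (of_int k gchoose i)) \<odot>\<^bsub>W\<^esub>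
            (YW a (m + k - int i) (YW b (n + int i) c) \<ominus>\<^bsub>W\<^esub>
             ((-1) powi k) \<odot>\<^bsub>W\<^esub> YW b (n + k - int i) (YW a (m + int i) c)))"
    by (rule YW_jacobi)
qed

lemma YW_translation:
  assumes a: "a \<in> carrier W" and b: "b \<in> carrier W"
  shows "modeW \<omega> 0 (YW a n b) \<ominus>\<^bsub>W\<^esub> YW a n (modeW \<omega> 0 b) = (- of_int n) \<odot>\<^bsub>W\<^esub> YW a (n - 1) b"
proof -
  have t: "W.coord (modeW \<omega> 0 w) = translation_op (W.coord w)" if "w \<in> carrier W" for w
    using that by (simp add: translation_op_def mode_field_coord)
  note d = modeW_closed[OF conformal_closed]
  show ?thesis
    by (rule YW_eqI)
       (use GF.state_field_translation[OF coord_state[OF a], of n "W.coord b"] in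
         \<open>simp_all add: YW_closed d a b W.coord_minus W.coord_scale t coord_YW\<close>)
qed

end

section \<open>Weights and the conformal vector\<close>

text \<open>
  Applying \<open>L - m\<close> to the relation removes the summand of weight \<open>m\<close> and multiplies every other one by a
  nonzero scalar.
\<close>

lemma (in complex_space) eigenvectors_independent:
  assumes L: "lin L" and "finite A" "\<And>n. n \<in> A \<Longrightarrow> L (v n) = of_int n *s v n" "(\<Sum>n\<in>A. v n) = 0"
  shows "\<forall>n\<in>A. v n = 0"
  using assms(2-)
proof (induction A arbitrary: v rule: finite_induct)
  case empty then show ?case by simp
next
  case (insert m A)
  have "(\<Sum>n\<in>insert m A. of_int n *s v n) = L (\<Sum>n\<in>insert m A. v n)"
    unfolding lin_sum[OF L] by (rule sum.cong) (use insert.prems in auto)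
  then have 1: "(\<Sum>n\<in>insert m A. of_int n *s v n) = 0"
    unfolding insert.prems(2) lin_0[OF L] .
  have "(\<Sum>n\<in>A. (of_int n - of_int m) *s v n) =
     (\<Sum>n\<in>insert m A. of_int n *s v n) - of_int m *s (\<Sum>n\<in>insert m A. v n)"
    using insert.hyps
    by (simp add: scale_left_diff_distrib sum_subtractf scale_sum_right scale_right_distrib)
  then have s: "(\<Sum>n\<in>A. (of_int n - of_int m) *s v n) = 0" unfolding 1 insert.prems(2) by simp
  have "\<forall>n\<in>A. (of_int n - of_int m) *s v n = 0"
    by (rule insert.IH[OF _ s]) (use insert.prems(1) in \<open>auto simp: lin_scale[OF L] mult.commute\<close>)
  then have A0: "v n = 0" if "n \<in> A" for n
  proof -
    have "n \<noteq> m" using that insert.hyps by blast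
    then have "(of_int n - of_int m :: complex) \<noteq> 0" by simp
    then show ?thesis using \<open>\<forall>n\<in>A. _\<close> that scale_eq_0_iff by blast
  qed
  then have "(\<Sum>n\<in>insert m A. v n) = v m" using insert.hyps by simp
  then show ?case using A0 insert.prems(2) by auto
qed

context vertex_operator_algebra
begin

text \<open>
  The Virasoro relation for \<open>m\<close> and \<open>n = -2\<close>, applied to the vacuum: \<open>L(-2) vac = \<omega>\<close>, and \<open>L(m) vac = 0\<close>
  for \<open>m \<ge> -1\<close>.
\<close>

lemma omega_products:
  "Y \<omega> 1 \<omega> = 2 \<odot>\<^bsub>V\<^esub> \<omega>" "Y \<omega> 2 \<omega> = \<zero>\<^bsub>V\<^esub>" "Y \<omega> 3 \<omega> = (r / 2) \<odot>\<^bsub>V\<^esub> vac"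
  "m \<ge> 3 \<Longrightarrow> Y \<omega> (m + 1) \<omega> = \<zero>\<^bsub>V\<^esub>"
proof -
  have *: "Y \<omega> (m + 1) \<omega> = of_int (m + 2) \<odot>\<^bsub>V\<^esub> Y \<omega> (m - 1) vac \<oplus>\<^bsub>V\<^esub>
     (if m = 2 then (of_int (m ^ 3 - m) / 12 * r) \<odot>\<^bsub>V\<^esub> vac else \<zero>\<^bsub>V\<^esub>)" if "m \<ge> -1" for m
  proof -
    have 1: "Y \<omega> (m + 1) vac = \<zero>\<^bsub>V\<^esub>" using creation[OF conformal_closed, of "m + 1"] that by simp
    have 2: "Y \<omega> (- 2 + 1) vac = \<omega>" using creation'[OF conformal_closed] by simp
    have "Y \<omega> (m + 1) (Y \<omega> (- 2 + 1) vac) \<ominus>\<^bsub>V\<^esub> Y \<omega> (- 2 + 1) (Y \<omega> (m + 1) vac) = Y \<omega> (m + 1) \<omega>"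
      unfolding 1 2 by (simp add: conformal_closed Y_closed a_minus_def)
    then show ?thesis using virasoro[OF vac_closed, of m "-2"] by (simp add: algebra_simps)
  qed
  show "Y \<omega> 1 \<omega> = 2 \<odot>\<^bsub>V\<^esub> \<omega>"
    using *[of 0] creation'[OF conformal_closed] by (simp add: conformal_closed)
  show "Y \<omega> 2 \<omega> = \<zero>\<^bsub>V\<^esub>" using *[of 1] creation[OF conformal_closed, of 0] by simp
  show "Y \<omega> 3 \<omega> = (r / 2) \<odot>\<^bsub>V\<^esub> vac" using *[of 2] creation[OF conformal_closed, of 1] by (simp add: vac_closed)
  show "m \<ge> 3 \<Longrightarrow> Y \<omega> (m + 1) \<omega> = \<zero>\<^bsub>V\<^esub>" using *[of m] creation[OF conformal_closed, of "m - 1"] by simp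
qed

end

lemma gchoose_3: "(a::complex) gchoose 3 = a * (a - 1) * (a - 2) / 6"
  by (simp add: gbinomial_prod_rev numeral_3_eq_3 fact_numeral)

locale cft_vacuum_module = vacuum_module V Y vac gr \<omega> r W ac \<Omega> l + voa_cft_type V Y vac gr \<omega> r
  for V :: "(complex, 'v) module" and Y :: "'v \<Rightarrow> int \<Rightarrow> 'v \<Rightarrow> 'v" and vac :: 'v
    and gr :: "int \<Rightarrow> 'v set" and \<omega> :: 'v and r :: complex and W :: "(complex, 'w) module"
    and ac :: "(int \<Rightarrow> 'v) set \<Rightarrow> 'w \<Rightarrow> 'w" and \<Omega> :: 'w and l :: complex
begin

lemma gr_subset: "gr n \<subseteq> carrier V"
  by (rule VM.submodD(1)[OF gr_subspace])

lemma gr_closed: "a \<in> gr n \<Longrightarrow> a \<in> carrier V"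
  using gr_subset by blast

text \<open>
  The grading of \<open>W\<close> is defined by the eigenvalues of \<open>L(0)\<close>, which makes the homogeneous parts
  independent of any choice of spanning words.
\<close>

definition wt :: "int \<Rightarrow> 'w set" where
  "wt n = {w \<in> carrier W. modeW \<omega> 1 w = of_int n \<odot>\<^bsub>W\<^esub> w}"

lemma wt_submodule: "submodule (wt n) CC W"
  unfolding wt_def
  by (rule mlinear_equalizer[OF W.complex_module_axioms W.complex_module_axioms ac_right[OF gm_closed[OF conformal_closed]]
        mlinear_smult[OF W.complex_module_axioms id_mlinear]])

lemma wt_closed: "w \<in> wt n \<Longrightarrow> w \<in> carrier W"
  by (simp add: wt_def)

text \<open>
  In \<open>[\<omega>(1), a(n)] = (\<omega>\<^sub>0 a)(n + 1) + (\<omega>\<^sub>1 a)(n)\<close> the first term is \<open>-(n + 1) a(n)\<close> and the second is \<open>p a(n)\<close>.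
\<close>

lemma L0_mode:
  assumes a: "a \<in> gr p" and w: "w \<in> carrier W"
  shows "W.coord (modeW \<omega> 1 (modeW a n w)) = W.coord (modeW a n (modeW \<omega> 1 w)) + pscale (of_int (p - n - 1)) (W.coord (modeW a n w))"
proof -
  note aV = gr_closed[OF a]
  let ?g = "\<lambda>i::nat. W.coord (modeW (Y \<omega> (int i) a) (1 + n - int i) w)"
  have ev: "evzero ?g"
    using product_evzero[OF conformal_closed aV] modeW_zero[OF w] unfolding evzero_def by (metis W.coord_zero)
  have g0: "?g 0 = pscale (- of_int (1 + n)) (W.coord (modeW a n w))"
    using mlinearD(3)[OF ac_left[OF w] gm_closed[OF aV], of "- of_int (1 + n)" n] modeW_closed[OF aV w]
    by (simp add: deriv_omega[OF aV, symmetric] gm_deriv[OF aV] W.coord_scale)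
  have g1: "?g 1 = pscale (of_int p) (W.coord (modeW a n w))"
    using mlinearD(3)[OF modeW_mlinear[OF w] aV, of "of_int p" n] modeW_closed[OF aV w]
    by (simp add: L0_grading[OF a] W.coord_scale)
  have "W.coord (modeW \<omega> 1 (modeW a n w)) - W.coord (modeW a n (modeW \<omega> 1 w)) = ?g 0 + ?g 1"
    unfolding modeW_commutator[OF conformal_closed aV w] by (rule pm.binsum_1[OF ev])
  also have "\<dots> = pscale (of_int (p - n - 1)) (W.coord (modeW a n w))"
    unfolding g0 g1 pm.scale_left_distrib[symmetric] by (simp add: algebra_simps)
  finally show ?thesis by (simp add: algebra_simps)
qed

lemma modeW_wt:
  assumes a: "a \<in> gr p" and w: "w \<in> wt q"
  shows "modeW a n w \<in> wt (q + p - n - 1)"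
proof -
  note aV = gr_closed[OF a] and wW = wt_closed[OF w]
  have "modeW a n (modeW \<omega> 1 w) = of_int q \<odot>\<^bsub>W\<^esub> modeW a n w"
    using w mlinearD(3)[OF ac_right[OF gm_closed[OF aV]] wW] by (simp add: wt_def)
  then have "W.coord (modeW \<omega> 1 (modeW a n w)) = W.coord (of_int (q + p - n - 1) \<odot>\<^bsub>W\<^esub> modeW a n w)"
  proof -
    assume *: "modeW a n (modeW \<omega> 1 w) = of_int q \<odot>\<^bsub>W\<^esub> modeW a n w"
    have "W.coord (modeW \<omega> 1 (modeW a n w)) = pscale (of_int q + of_int (p - n - 1)) (W.coord (modeW a n w))"
      unfolding L0_mode[OF a wW] * W.coord_scale[OF modeW_closed[OF aV wW]] pm.scale_left_distrib ..
    also have "of_int q + of_int (p - n - 1) = (of_int (q + p - n - 1) :: complex)" by simp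
    finally show ?thesis by (simp only: W.coord_scale[OF modeW_closed[OF aV wW]])
  qed
  then show ?thesis
    using modeW_closed[OF aV wW] modeW_closed[OF conformal_closed modeW_closed[OF aV wW]]
    by (subst (asm) W.coord_eq_iff) (auto simp: wt_def)
qed

lemma vac_wt: "\<Omega> \<in> wt 0"
  by (simp add: wt_def vac_W modeW_vac conformal_closed)

definition gr_basis :: "int \<Rightarrow> 'v set" where
  "gr_basis n = (SOME B. finite B \<and> B \<subseteq> gr n \<and> gr n = lin_span V B)"

lemma gr_basis: "finite (gr_basis n)" "gr_basis n \<subseteq> gr n" "gr n = lin_span V (gr_basis n)"
  using someI_ex[OF gr_finite_dim[of n]] unfolding gr_basis_def by auto

lemma gr_basis_closed: "a \<in> gr_basis n \<Longrightarrow> a \<in> carrier V"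
  using gr_basis(2) gr_subset by blast

text \<open>
  This is where CFT type enters: homogeneous vectors of negative weight are zero and those of weight
  \<open>0\<close> are multiples of the vacuum, whose modes other than \<open>vac(-1)\<close> vanish.
\<close>

lemma GV_generated:
  assumes H: "submodule H CC GV" and plus: "gplus \<subseteq> H" and K: "gm vac (-1) \<in> H"
    and neg: "\<And>p a k. p \<ge> 1 \<Longrightarrow> a \<in> gr_basis (int p) \<Longrightarrow> gm a (- 1 - int k) \<in> H"
    and x: "x \<in> carrier GV"
  shows "x \<in> H"
proof (rule GV_submodule_all[OF H _ x])
  fix a m assume a: "a \<in> carrier V"
  show "gm a m \<in> H"
  proof (cases "m \<ge> 0")
    case True then show ?thesis using gm_gplus[OF a] plus by blast
  next
    case False
    then have m: "m = - 1 - int (nat (- 1 - m))" by simp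
    let ?K = "{a \<in> carrier V. gm a m \<in> H}"
    have sub: "submodule ?K CC V"
      by (rule mlinear_vimage[OF VM.complex_module_axioms GV.complex_module_axioms gm_mlinear H])
    have gvac: "gm vac m \<in> H" using K gm_vac[of m] GV.submodD(2)[OF H] by (cases "m = -1") auto
    have grK: "gr n \<subseteq> ?K" for n
    proof (cases "n \<ge> 1")
      case True
      then have n: "n = int (nat n)" "nat n \<ge> 1" by auto
      have "gr_basis n \<subseteq> ?K" using neg[OF n(2), of _ "nat (- 1 - m)"] n(1) m gr_basis_closed by auto
      then have "lin_span V (gr_basis n) \<subseteq> ?K" by (rule lin_span_minimal[OF sub])
      then show ?thesis using gr_basis(3)[of n] by simp
    next
      case False
      show ?thesis
      proof (cases "n = 0")
        case True
        then show ?thesis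
          using gvac VM.submodD(4)[OF sub, of vac] vac_closed gr_zero by auto
      next
        case False
        then have "gr n = {\<zero>\<^bsub>V\<^esub>}" using \<open>\<not> n \<ge> 1\<close> gr_negative[of n] by simp
        then show ?thesis using VM.submodD(2)[OF sub] by simp
      qed
    qed
    obtain f where f: "\<forall>n. f n \<in> gr n" "a = fsum V f" using gr_direct_sum[OF a] by blast
    have "fsum V f \<in> ?K" by (rule VM.submod_fsum[OF sub]) (use f(1) grK in blast)
    then show ?thesis using f(2) by blast
  qed
qed

text \<open>
  \<open>word j n w\<close> states that \<open>w\<close> arises from \<open>\<Omega>\<close> by \<open>j\<close> modes \<open>a(-1 - k)\<close>, with \<open>a\<close> taken from finite spanning
  sets of the positive weight spaces of \<open>V\<close>, and that the weights add up to \<open>n\<close>.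
\<close>

inductive word :: "nat \<Rightarrow> nat \<Rightarrow> 'w \<Rightarrow> bool" where
  word_vac: "word 0 0 \<Omega>"
| word_step: "word j n w \<Longrightarrow> p \<ge> 1 \<Longrightarrow> a \<in> gr_basis (int p) \<Longrightarrow> word (Suc j) (n + p + k) (modeW a (- 1 - int k) w)"

lemma word_wt: "word j n w \<Longrightarrow> w \<in> wt (int n)"
proof (induction rule: word.induct)
  case word_vac show ?case using vac_wt by simp
next
  case (word_step j n w p a k)
  have "modeW a (- 1 - int k) w \<in> wt (int n + int p - (- 1 - int k) - 1)"
    by (rule modeW_wt) (use word_step gr_basis(2) in auto)
  then show ?case by (simp add: algebra_simps)
qed

lemma word_closed: "word j n w \<Longrightarrow> w \<in> carrier W"
  using word_wt wt_closed by blast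

text \<open>
  The outermost letter \<open>a(-1 - k)\<close> has \<open>a\<close> of weight between \<open>1\<close> and \<open>n\<close> in a finite set and \<open>k \<le> n\<close>; the remaining word has
  smaller weight.
\<close>

lemma words_finite: "finite {w. \<exists>j. word j n w}"
proof (induction n rule: less_induct)
  case (less n)
  let ?T = "\<Union>p\<in>{1..n}. \<Union>k\<in>{..n}. \<Union>a\<in>gr_basis (int p). (\<lambda>w. modeW a (- 1 - int k) w) ` (if p + k \<le> n then {w. \<exists>j. word j (n - p - k) w} else {})"
  have "{w. \<exists>j. word j n w} \<subseteq> insert \<Omega> ?T"
  proof
    fix w assume "w \<in> {w. \<exists>j. word j n w}"
    then obtain j where "word j n w" by blast
    then show "w \<in> insert \<Omega> ?T"
    proof (cases rule: word.cases)
      case word_vac then show ?thesis by blast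
    next
      case (word_step j' n' w' p a k)
      then have "w' \<in> {w. \<exists>j. word j (n - p - k) w}" by auto
      then have "w \<in> (\<lambda>w. modeW a (- 1 - int k) w) ` (if p + k \<le> n then {w. \<exists>j. word j (n - p - k) w} else {})"
        using word_step by auto
      moreover have "p \<in> {1..n}" "k \<in> {..n}" using word_step by auto
      ultimately show ?thesis using word_step by blast
    qed
  qed
  moreover have "finite (if p + k \<le> n then {w. \<exists>j. word j (n - p - k) w} else {})" if "p \<in> {1..n}" for p k
    using less[of "n - p - k"] that by auto
  then have "finite ?T" using gr_basis(1) by (intro finite_UN_I finite_imageI) auto
  ultimately show ?case by (rule finite_subset[OF _ finite.insertI])
qed

text \<open>
  The filtration by length. Weight alone is not suitable for straightening, since a commutator keeps the
  weight but shortens the word.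
\<close>

definition words_upto :: "nat \<Rightarrow> 'w set" where
  "words_upto j = lin_span W {w. \<exists>i\<le>j. \<exists>n. word i n w}"

lemma words_upto_gens: "{w. \<exists>i\<le>j. \<exists>n. word i n w} \<subseteq> carrier W"
  using word_closed by blast

lemma words_upto_submodule: "submodule (words_upto j) CC W"
  unfolding words_upto_def by (rule W.lin_span_submodule[OF words_upto_gens])

lemma words_upto_word: "word i n w \<Longrightarrow> i \<le> j \<Longrightarrow> w \<in> words_upto j"
  unfolding words_upto_def by (rule subsetD[OF lin_span_superset]) blast

lemma words_upto_mono: "i \<le> j \<Longrightarrow> words_upto i \<subseteq> words_upto j"
  unfolding words_upto_def by (rule W.lin_span_mono) (auto intro: order_trans)

lemma words_upto_closed: "w \<in> words_upto j \<Longrightarrow> w \<in> carrier W"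
  using W.submodD(1)[OF words_upto_submodule] by blast

text \<open>
  If non-negative modes preserve the span of words of length at most \<open>j\<close>, then every element of \<open>g(V)\<close>
  lengthens words by at most one: by \<open>GV_generated\<close> it suffices to look at \<open>g(V)\<^sup>+\<close>, at \<open>vac(-1)\<close>, which is
  a scalar, and at letters.
\<close>

lemma words_upto_raise:
  assumes plus: "\<And>x w. x \<in> gplus \<Longrightarrow> w \<in> words_upto j \<Longrightarrow> ac x w \<in> words_upto j"
    and x: "x \<in> carrier GV" and w: "w \<in> words_upto j"
  shows "ac x w \<in> words_upto (Suc j)"
proof -
  note wW = words_upto_closed[OF w]
  have mono: "words_upto j \<subseteq> words_upto (Suc j)" by (rule words_upto_mono) simp
  have "x \<in> {x \<in> carrier GV. ac x w \<in> words_upto (Suc j)}"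
  proof (rule GV_generated[OF mlinear_vimage[OF GV.complex_module_axioms W.complex_module_axioms ac_left[OF wW] words_upto_submodule] _ _ _ x])
    show "gplus \<subseteq> {x \<in> carrier GV. ac x w \<in> words_upto (Suc j)}"
      using plus[OF _ w] mono gplus_subset by blast
    have "l \<odot>\<^bsub>W\<^esub> w \<in> words_upto (Suc j)" using W.submodD(4)[OF words_upto_submodule] w mono by blast
    then show "gm vac (-1) \<in> {x \<in> carrier GV. ac x w \<in> words_upto (Suc j)}"
      using ac_level[OF wW] K_closed by simp
    fix p a k assume p: "p \<ge> (1::nat)" and a: "a \<in> gr_basis (int p)"
    have aG: "gm a (- 1 - int k) \<in> carrier GV" by (rule gm_closed[OF gr_basis_closed[OF a]])
    have "ac (gm a (- 1 - int k)) w \<in> words_upto (Suc j)"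
    proof (rule mlinear_span[OF W.complex_module_axioms W.complex_module_axioms ac_right[OF aG] words_upto_submodule words_upto_gens _ w[unfolded words_upto_def]])
      fix v assume "v \<in> {w. \<exists>i\<le>j. \<exists>n. word i n w}"
      then obtain i n where i: "i \<le> j" "word i n v" by blast
      show "ac (gm a (- 1 - int k)) v \<in> words_upto (Suc j)"
        by (rule words_upto_word[OF word_step[OF i(2) p a]]) (use i in simp)
    qed
    then show "gm a (- 1 - int k) \<in> {x \<in> carrier GV. ac x w \<in> words_upto (Suc j)}" using aG by blast
  qed
  then show ?thesis by blast
qed

lemma ac_exchange:
  assumes x: "x \<in> carrier GV" and y: "y \<in> carrier GV" and w: "w \<in> carrier W"
  shows "ac x (ac y w) = ac (gbr x y) w \<oplus>\<^bsub>W\<^esub> ac y (ac x w)"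
proof -
  note c = ac_closed[OF x ac_closed[OF y w]] ac_closed[OF y ac_closed[OF x w]]
  show ?thesis
    unfolding ac_bracket[OF x y w, symmetric] using c by (simp add: a_minus_def W.M.a_assoc W.M.l_neg)
qed

text \<open>
  Induction on the length. A non-negative mode \<open>x\<close> is moved past the outermost letter \<open>y\<close> by
  \<open>x y u = [x, y] u + y x u\<close>. In both terms the induction hypothesis for the shorter word \<open>u\<close> applies,
  through \<open>words_upto_raise\<close>.
\<close>

lemma words_upto_plus: "x \<in> gplus \<Longrightarrow> w \<in> words_upto j \<Longrightarrow> ac x w \<in> words_upto j"
proof (induction j arbitrary: x w)
  case 0
  have xG: "x \<in> carrier GV" by (rule gplus_GV[OF 0(1)])
  show ?case
  proof (rule mlinear_span[OF W.complex_module_axioms W.complex_module_axioms ac_right[OF xG] words_upto_submodule words_upto_gens _ 0(2)[unfolded words_upto_def]])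
    fix v assume "v \<in> {w. \<exists>i\<le>0. \<exists>n. word i n w}"
    then obtain n where "word 0 n v" by blast
    then have "v = \<Omega>" by (cases rule: word.cases) auto
    then show "ac x v \<in> words_upto 0" using ac_plus[OF 0(1)] W.submodD(2)[OF words_upto_submodule] by simp
  qed
next
  case (Suc j)
  have xG: "x \<in> carrier GV" by (rule gplus_GV[OF Suc.prems(1)])
  have raise: "ac y v \<in> words_upto (Suc j)" if "y \<in> carrier GV" "v \<in> words_upto j" for y v
    by (rule words_upto_raise[OF Suc.IH that])
  show ?case
  proof (rule mlinear_span[OF W.complex_module_axioms W.complex_module_axioms ac_right[OF xG] words_upto_submodule words_upto_gens _ Suc.prems(2)[unfolded words_upto_def]])
    fix v assume "v \<in> {w. \<exists>i\<le>Suc j. \<exists>n. word i n w}"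
    then obtain i n where i: "i \<le> Suc j" "word i n v" by blast
    show "ac x v \<in> words_upto (Suc j)"
    proof (cases "i \<le> j")
      case True
      then have "v \<in> words_upto j" using words_upto_word i by blast
      then show ?thesis using Suc.IH[OF Suc.prems(1)] words_upto_mono[of j "Suc j"] by auto
    next
      case False
      then have "word (Suc j) n v" using i by (simp add: le_Suc_eq)
      then show ?thesis
      proof (cases rule: word.cases)
        case (word_step n' u p a k)
        let ?y = "gm a (- 1 - int k)"
        have u: "u \<in> words_upto j" by (rule words_upto_word[OF word_step(3)]) simp
        have y: "?y \<in> carrier GV" by (rule gm_closed[OF gr_basis_closed[OF word_step(5)]])
        have "ac x (ac ?y u) = ac (gbr x ?y) u \<oplus>\<^bsub>W\<^esub> ac ?y (ac x u)"
          by (rule ac_exchange[OF xG y words_upto_closed[OF u]])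
        moreover have "ac (gbr x ?y) u \<in> words_upto (Suc j)" by (rule raise[OF gbr_closed[OF xG y] u])
        moreover have "ac ?y (ac x u) \<in> words_upto (Suc j)" by (rule raise[OF y Suc.IH[OF Suc.prems(1) u]])
        ultimately show ?thesis using W.submodD(3)[OF words_upto_submodule] word_step(2) by simp
      qed
    qed
  qed
qed

definition word_part :: "int \<Rightarrow> 'w set" where
  "word_part n = lin_span W (if n \<ge> 0 then {w. \<exists>j. word j (nat n) w} else {})"

lemma word_part_gens: "(if n \<ge> 0 then {w. \<exists>j. word j (nat n) w} else {}) \<subseteq> carrier W"
  using word_closed by auto

lemma word_part_submodule: "submodule (word_part n) CC W"
  unfolding word_part_def by (rule W.lin_span_submodule[OF word_part_gens])

lemma word_part_wt: "word_part n \<subseteq> wt n"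
  unfolding word_part_def
proof (rule lin_span_minimal[OF wt_submodule])
  show "(if n \<ge> 0 then {w. \<exists>j. word j (nat n) w} else {}) \<subseteq> wt n"
    using word_wt[of _ "nat n"] by auto
qed

lemma word_part_word: "word j n w \<Longrightarrow> w \<in> word_part (int n)"
  unfolding word_part_def by (rule subsetD[OF lin_span_superset]) auto

text \<open>
  The span of all words contains \<open>\<Omega>\<close> and is invariant under \<open>g(V)\<close>, since every element maps words of length
  \<open>j\<close> into the span of words of length at most \<open>j + 1\<close>.
\<close>

lemma W_spanned: assumes w: "w \<in> carrier W" shows "w \<in> lin_span W (\<Union>n. word_part n)"
proof -
  let ?S = "lin_span W (\<Union>n. word_part n)"
  have U: "(\<Union>n. word_part n) \<subseteq> carrier W" using W.submodD(1)[OF word_part_submodule] by blast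
  have S: "submodule ?S CC W" by (rule W.lin_span_submodule[OF U])
  have word_S: "v \<in> ?S" if "word j n v" for j n v
    by (rule subsetD[OF lin_span_superset]) (use word_part_word[OF that] in blast)
  have words_upto_S: "words_upto j \<subseteq> ?S" for j
    unfolding words_upto_def by (rule lin_span_minimal[OF S]) (use word_S in blast)
  have "ac x v \<in> ?S" if x: "x \<in> carrier GV" and v: "v \<in> ?S" for x v
  proof (rule mlinear_span[OF W.complex_module_axioms W.complex_module_axioms ac_right[OF x] S U _ v])
    fix u assume "u \<in> (\<Union>n. word_part n)"
    then obtain n where u: "u \<in> word_part n" by blast
    show "ac x u \<in> ?S"
    proof (rule mlinear_span[OF W.complex_module_axioms W.complex_module_axioms ac_right[OF x] S word_part_gens _ u[unfolded word_part_def]])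
      fix z assume "z \<in> (if n \<ge> 0 then {w. \<exists>j. word j (nat n) w} else {})"
      then obtain j where "word j (nat n) z" by (auto split: if_splits)
      then have "ac x z \<in> words_upto (Suc j)" using words_upto_raise[OF words_upto_plus x words_upto_word[OF _ order_refl]] by blast
      then show "ac x z \<in> ?S" using words_upto_S by blast
    qed
  qed
  then show ?thesis using ac_cyclic[OF S word_S[OF word_vac] _ w] by blast
qed

lemma wt_independent:
  assumes h: "\<And>n. h n \<in> wt n" and fin: "finite {n. h n \<noteq> \<zero>\<^bsub>W\<^esub>}" and sum: "fsum W h = \<zero>\<^bsub>W\<^esub>"
  shows "h n = \<zero>\<^bsub>W\<^esub>"
proof -
  let ?A = "{n. h n \<noteq> \<zero>\<^bsub>W\<^esub>}"
  note hW = wt_closed[OF h]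
  have "Sum_any (\<lambda>n. W.coord (h n)) = 0" using W.coord_fsum[OF hW fin] sum by simp
  then have s: "(\<Sum>n\<in>?A. W.coord (h n)) = 0"
    using Sum_any.expand_superset[OF fin, of "\<lambda>n. W.coord (h n)"] by (auto simp: W.coord_eq_0_iff hW)
  have "\<forall>n\<in>?A. W.coord (h n) = 0"
  proof (rule pm.eigenvectors_independent[OF _ fin _ s])
    show "pm.lin (mode_field \<omega> 1)" by (rule pm.qf_lin[OF mode_field_qf[OF conformal_closed]])
    show "mode_field \<omega> 1 (W.coord (h n)) = pscale (of_int n) (W.coord (h n))" for n
      using h[of n] hW[of n] by (simp add: mode_field_coord wt_def W.coord_scale)
  qed
  then show ?thesis using W.coord_eq_0_iff[OF hW[of n]] by blast
qed

lemma wt_unique: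
  assumes f: "\<And>n. f n \<in> wt n" "finite {n. f n \<noteq> \<zero>\<^bsub>W\<^esub>}" and g: "\<And>n. g n \<in> wt n" "finite {n. g n \<noteq> \<zero>\<^bsub>W\<^esub>}"
    and eq: "fsum W f = fsum W g"
  shows "f = g"
proof
  fix n
  note fW = wt_closed[OF f(1)] and gW = wt_closed[OF g(1)]
  note sg = W.fsum_smult[OF gW g(2), of "-1"]
  have gc: "fsum W g \<in> carrier W" by (rule W.fsum_closed) (rule gW)
  have gm: "(-1) \<odot>\<^bsub>W\<^esub> g i \<in> carrier W" for i using gW by simp
  note fg = W.fsum_add[OF fW f(2) gm sg(2)]
  have "fsum W (\<lambda>i. f i \<oplus>\<^bsub>W\<^esub> (-1) \<odot>\<^bsub>W\<^esub> g i) = \<zero>\<^bsub>W\<^esub>"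
    unfolding fg(1) sg(1) eq W.smult_minus1[OF gc] by (rule W.M.r_neg[OF gc])
  moreover have "f i \<oplus>\<^bsub>W\<^esub> (-1) \<odot>\<^bsub>W\<^esub> g i \<in> wt i" for i
    by (rule W.submodD(3)[OF wt_submodule f(1) W.submodD(4)[OF wt_submodule g(1)]])
  ultimately have "f n \<oplus>\<^bsub>W\<^esub> (-1) \<odot>\<^bsub>W\<^esub> g n = \<zero>\<^bsub>W\<^esub>"
    using wt_independent[of "\<lambda>i. f i \<oplus>\<^bsub>W\<^esub> (-1) \<odot>\<^bsub>W\<^esub> g i"] fg(2) by blast
  then have "W.coord (f n) - W.coord (g n) = 0"
    using fW[of n] gW[of n] by (metis W.coord_minus W.coord_zero W.smult_minus1 a_minus_def)
  then show "f n = g n" using W.coord_eq_iff[OF fW gW] by simp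
qed

lemma wt_decomposition:
  assumes w: "w \<in> carrier W"
  obtains f where "\<And>n. f n \<in> word_part n" "finite {n. f n \<noteq> \<zero>\<^bsub>W\<^esub>}" "w = fsum W f"
  using W.lin_span_family[OF word_part_submodule W_spanned[OF w]] by blast

text \<open>
  An eigenvector decomposes into homogeneous combinations of words, and since eigenvectors for different
  eigenvalues are independent, only the part of its own weight occurs. Finite dimensionality and the
  lower bound on the weights are read off from the words.
\<close>

lemma wt_eq_word_part: "wt n = word_part n"
proof
  show "wt n \<subseteq> word_part n"
  proof
    fix w assume w: "w \<in> wt n"
    note wW = wt_closed[OF w]
    obtain f where f: "\<And>n. f n \<in> word_part n" "finite {n. f n \<noteq> \<zero>\<^bsub>W\<^esub>}" "w = fsum W f"
      using wt_decomposition[OF wW] by blast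
    have "f = (\<lambda>k. if k = n then w else \<zero>\<^bsub>W\<^esub>)"
    proof (rule wt_unique)
      show "f n \<in> wt n" for n using f(1) word_part_wt by blast
      show "(if k = n then w else \<zero>\<^bsub>W\<^esub>) \<in> wt k" for k using w W.submodD(2)[OF wt_submodule] by simp
    qed (use f W.fsum_delta[OF wW, of n] in auto)
    then have "f n = w" by simp
    then show "w \<in> word_part n" using f(1)[of n] by simp
  qed
qed (rule word_part_wt)

definition conformalW where "conformalW = modeW \<omega> (-1) \<Omega>"

lemma conformalW_closed: "conformalW \<in> carrier W"
  unfolding conformalW_def by (rule modeW_closed[OF conformal_closed vac_W])

lemma YW_conf: "w \<in> carrier W \<Longrightarrow> YW conformalW n w = modeW \<omega> n w"
  unfolding conformalW_def by (rule YW_generator[OF conformal_closed])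

text \<open>
  In the commutator formula for \<open>\<omega>(m + 1)\<close> and \<open>\<omega>(n + 1)\<close> only the products \<open>\<omega>\<^sub>i \<omega>\<close> with \<open>i = 0, 1, 3\<close> contribute.
  The first two combine to \<open>(-(m + n + 2) + 2 (m + 1)) L(m + n)\<close>. The third is
  \<open>(m + 1 choose 3) (r/2) vac(m + n - 1)\<close>, which vanishes unless \<open>m + n = 0\<close> and then is the scalar
  \<open>(m\<^sup>3 - m)/12 r \<ell>\<close>.
\<close>

lemma W_virasoro:
  assumes v: "v \<in> carrier W"
  shows "modeW \<omega> (m + 1) (modeW \<omega> (n + 1) v) \<ominus>\<^bsub>W\<^esub> modeW \<omega> (n + 1) (modeW \<omega> (m + 1) v) =
          of_int (m - n) \<odot>\<^bsub>W\<^esub> modeW \<omega> (m + n + 1) v \<oplus>\<^bsub>W\<^esub>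
          (if m + n = 0 then (of_int (m ^ 3 - m) / 12 * (r * l)) \<odot>\<^bsub>W\<^esub> v else \<zero>\<^bsub>W\<^esub>)" (is "?L = ?R")
proof -
  note d = modeW_closed[OF conformal_closed]
  note dv = d[OF v]
  let ?x = "W.coord (modeW \<omega> (m + n + 1) v)"
  let ?g = "\<lambda>i::nat. W.coord (modeW (Y \<omega> (int i) \<omega>) (m + 1 + (n + 1) - int i) v)"
  have large: "\<forall>i\<ge>4. ?g i = 0"
  proof (intro allI impI)
    fix i :: nat assume i: "i \<ge> 4"
    have "Y \<omega> (int i - 1 + 1) \<omega> = \<zero>\<^bsub>V\<^esub>" by (rule omega_products(4)) (use i in simp)
    then show "?g i = 0" using modeW_zero[OF v] by simp
  qed
  have g0: "?g 0 = pscale (- of_int (m + n + 2)) ?x"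
  proof -
    have "modeW (deriv \<omega>) (m + n + 2) v = (- of_int (m + n + 2)) \<odot>\<^bsub>W\<^esub> modeW \<omega> (m + n + 2 - 1) v"
      unfolding gm_deriv[OF conformal_closed] by (rule mlinearD(3)[OF ac_left[OF v] gm_closed[OF conformal_closed]])
    then show ?thesis
      using dv W.coord_scale[OF dv, of "- of_int (m + n + 2)" "m + n + 1"]
      by (simp add: deriv_omega[OF conformal_closed] add_ac)
  qed
  have g1: "?g 1 = pscale 2 ?x"
    using mlinearD(3)[OF modeW_mlinear[OF v] conformal_closed, of 2] dv
    by (simp add: omega_products(1) W.coord_scale add_ac)
  have g2: "?g 2 = 0" using modeW_zero[OF v] by (simp add: omega_products(2))
  have g3: "?g 3 = (if m + n = 0 then pscale (r / 2 * l) (W.coord v) else 0)"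
  proof -
    have "m + 1 + (n + 1) - int 3 = m + n - 1" by simp
    then have "modeW (Y \<omega> (int 3) \<omega>) (m + 1 + (n + 1) - int 3) v = (r / 2) \<odot>\<^bsub>W\<^esub> modeW vac (m + n - 1) v"
      using mlinearD(3)[OF modeW_mlinear[OF v] vac_closed, of "r / 2"] by (simp add: omega_products(3))
    moreover have "modeW vac (m + n - 1) v = (if m + n = 0 then l \<odot>\<^bsub>W\<^esub> v else \<zero>\<^bsub>W\<^esub>)"
    proof (cases "m + n = 0")
      case True then show ?thesis using ac_level[OF v] by simp
    next
      case False
      then have "gm vac (m + n - 1) = \<zero>\<^bsub>GV\<^esub>" by (intro gm_vac) simp
      then show ?thesis using False mlinear_zero[OF GV.complex_module_axioms W.complex_module_axioms ac_left[OF v]] by simp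
    qed
    ultimately show ?thesis using v by (simp add: W.coord_scale)
  qed
  have c3: "(of_int (m + 1) gchoose 3) * (r / 2 * l) = of_int (m ^ 3 - m) / 12 * (r * l)"
    unfolding gchoose_3 by (simp add: algebra_simps power3_eq_cube)
  have "W.coord ?L = pm.binsum (m + 1) ?g"
    using modeW_commutator[OF conformal_closed conformal_closed v, of "m + 1" "n + 1"] d v by (simp add: W.coord_minus)
  also have "\<dots> = (\<Sum>i<4. pscale (of_int (m + 1) gchoose i) (?g i))" by (rule pm.binsum_eq_sum[OF large])
  also have "\<dots> = pscale (of_int (m + 1) gchoose 0) (?g 0) + pscale (of_int (m + 1) gchoose 1) (?g 1)
     + pscale (of_int (m + 1) gchoose 2) (?g 2) + pscale (of_int (m + 1) gchoose 3) (?g 3)"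
  proof -
    have "{..<4::nat} = {0, 1, 2, 3}" by auto
    then show ?thesis by (simp only:) (simp add: add_ac)
  qed
  also have "\<dots> = pscale (of_int (m - n)) ?x + (if m + n = 0 then pscale (of_int (m ^ 3 - m) / 12 * (r * l)) (W.coord v) else 0)"
  proof -
    have "pscale (of_int (m + 1) gchoose 0) (?g 0) + pscale (of_int (m + 1) gchoose 1) (?g 1) = pscale (of_int (m - n)) ?x"
      unfolding g0 g1 pm.scale_scale pm.scale_left_distrib[symmetric] by (simp add: algebra_simps)
    moreover have "pscale (of_int (m + 1) gchoose 3) (?g 3) = (if m + n = 0 then pscale (of_int (m ^ 3 - m) / 12 * (r * l)) (W.coord v) else 0)"
      unfolding g3 c3[symmetric] by simp
    ultimately show ?thesis unfolding g2 by simp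
  qed
  also have "\<dots> = W.coord ?R" using v dv by (simp add: W.coord_add W.coord_scale)
  finally show ?thesis
    by (rule YW_eqI[rotated 2]) (use v d in auto)
qed

text \<open>
  Once \<open>\<omega>(-1)\<Omega>\<close> is known to have the modes \<open>\<omega>(n)\<close>, the derivative property follows by comparing the
  commutator formula with translation covariance, and the behaviour of weights under products follows from
  the commutator formula for \<open>\<omega>(1)\<close>.
\<close>

theorem W_voa: "vertex_operator_algebra W YW \<Omega> wt conformalW (r * l)"
proof -
  interpret VA: vertex_algebra W YW \<Omega> by (rule YW_vertex_algebra)
  have deriv: "YW (modeW \<omega> 0 a) n b = (- of_int n) \<odot>\<^bsub>W\<^esub> YW a (n - 1) b" if a: "a \<in> carrier W" and b: "b \<in> carrier W" for a b n
    using VA.commutator_0[OF conformalW_closed a b, of n] YW_translation[OF a b, of n] a b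
    by (simp add: YW_conf YW_closed)
  have gr_Y: "YW a n b \<in> wt (p + q - n - 1)" if a: "a \<in> wt p" and b: "b \<in> wt q" for a b p q n
  proof -
    note aW = wt_closed[OF a] and bW = wt_closed[OF b]
    let ?g = "\<lambda>i::nat. YW (YW conformalW (int i) a) (1 + n - int i) b"
    have ev: "evzero (\<lambda>i. W.coord (?g i))"
    proof -
      obtain N where N: "\<forall>k\<ge>N. YW conformalW k a = \<zero>\<^bsub>W\<^esub>" using VA.truncation[OF conformalW_closed aW] by blast
      show ?thesis unfolding evzero_def by (rule exI[of _ "nat N"]) (use N bW in auto)
    qed
    have "W.coord (modeW \<omega> 1 (YW a n b) \<ominus>\<^bsub>W\<^esub> YW a n (modeW \<omega> 1 b)) = pm.binsum 1 (\<lambda>i. W.coord (?g i))"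
      using VA.commutator[OF conformalW_closed aW bW, of 1 n] coord_fsum_binsum[OF YW_closed ev, of 1]
      by (simp add: YW_conf aW bW YW_closed)
    also have "\<dots> = W.coord (?g 0) + W.coord (?g 1)" by (rule pm.binsum_1[OF ev])
    also have "?g 0 = (- of_int (1 + n)) \<odot>\<^bsub>W\<^esub> YW a n b" using deriv[OF aW bW, of "1 + n"] by (simp add: YW_conf aW)
    also have "?g 1 = of_int p \<odot>\<^bsub>W\<^esub> YW a n b"
      using a VA.Y_smult_left[OF aW bW, of "of_int p" n] by (simp add: YW_conf aW wt_def)
    finally have 1: "W.coord (modeW \<omega> 1 (YW a n b)) - W.coord (YW a n (modeW \<omega> 1 b))
       = pscale (- of_int (1 + n)) (W.coord (YW a n b)) + pscale (of_int p) (W.coord (YW a n b))"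
      by (simp add: W.coord_minus W.coord_scale YW_closed modeW_closed conformal_closed)
    have 2: "W.coord (YW a n (modeW \<omega> 1 b)) = pscale (of_int q) (W.coord (YW a n b))"
      using b VA.Y_smult_right[OF aW bW, of n "of_int q"] by (simp add: wt_def W.coord_scale YW_closed)
    have "W.coord (modeW \<omega> 1 (YW a n b)) = pscale (- of_int (1 + n)) (W.coord (YW a n b)) + pscale (of_int p) (W.coord (YW a n b))
       + pscale (of_int q) (W.coord (YW a n b))"
      using 1 unfolding 2 by (simp add: diff_eq_eq)
    also have "\<dots> = pscale (of_int (p + q - n - 1)) (W.coord (YW a n b))"
      unfolding pm.scale_left_distrib[symmetric] by (simp add: algebra_simps)
    finally have "W.coord (modeW \<omega> 1 (YW a n b)) = W.coord (of_int (p + q - n - 1) \<odot>\<^bsub>W\<^esub> YW a n b)"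
      by (simp add: W.coord_scale YW_closed)
    then have "modeW \<omega> 1 (YW a n b) = of_int (p + q - n - 1) \<odot>\<^bsub>W\<^esub> YW a n b"
      by (rule YW_eqI[rotated 2]) (simp_all add: YW_closed modeW_closed conformal_closed)
    then show ?thesis by (simp add: wt_def YW_closed)
  qed
  show ?thesis
  proof (intro vertex_operator_algebra.intro vertex_operator_algebra_axioms.intro YW_vertex_algebra)
    show "submodule (wt n) CC W" for n by (rule wt_submodule)
  next
    fix v assume v: "v \<in> carrier W"
    obtain f where f: "\<And>n. f n \<in> word_part n" "finite {n. f n \<noteq> \<zero>\<^bsub>W\<^esub>}" "v = fsum W f"
      using wt_decomposition[OF v] by blast
    show "\<exists>!f. (\<forall>n. f n \<in> wt n) \<and> finite {n. f n \<noteq> \<zero>\<^bsub>W\<^esub>} \<and> v = fsum W f"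
    proof (rule ex1I[of _ f])
      show "(\<forall>n. f n \<in> wt n) \<and> finite {n. f n \<noteq> \<zero>\<^bsub>W\<^esub>} \<and> v = fsum W f" using f wt_eq_word_part by auto
      fix g assume "(\<forall>n. g n \<in> wt n) \<and> finite {n. g n \<noteq> \<zero>\<^bsub>W\<^esub>} \<and> v = fsum W g"
      then show "g = f" using f wt_eq_word_part by (intro wt_unique) auto
    qed
  next
    fix n
    let ?B = "if n \<ge> 0 then {w. \<exists>j. word j (nat n) w} else {}"
    have "finite ?B" using words_finite[of "nat n"] by simp
    moreover have "?B \<subseteq> wt n" using lin_span_superset[of ?B W] unfolding wt_eq_word_part word_part_def .
    moreover have "wt n = lin_span W ?B" unfolding wt_eq_word_part word_part_def ..
    ultimately show "\<exists>B. finite B \<and> B \<subseteq> wt n \<and> wt n = lin_span W B" by blast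
  next
    have "wt n = {\<zero>\<^bsub>W\<^esub>}" if "n < 0" for n
    proof
      have "submodule {\<zero>\<^bsub>W\<^esub>} CC W" by (rule W.submodI) auto
      then show "wt n \<subseteq> {\<zero>\<^bsub>W\<^esub>}"
        unfolding wt_eq_word_part word_part_def using that by (intro lin_span_minimal) auto
    qed (use W.submodD(2)[OF wt_submodule] in auto)
    then show "\<exists>N. \<forall>n<N. wt n = {\<zero>\<^bsub>W\<^esub>}" by blast
  next
    show "\<Omega> \<in> wt 0" by (rule vac_wt)
  next
    fix a b p q n assume "a \<in> wt p" "b \<in> wt q"
    then show "YW a n b \<in> wt (p + q - n - 1)" by (rule gr_Y)
  next
    show "conformalW \<in> carrier W" by (rule conformalW_closed)
  next
    fix v m n assume v: "v \<in> carrier W"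
    show "YW conformalW (m + 1) (YW conformalW (n + 1) v) \<ominus>\<^bsub>W\<^esub> YW conformalW (n + 1) (YW conformalW (m + 1) v) =
          of_int (m - n) \<odot>\<^bsub>W\<^esub> YW conformalW (m + n + 1) v \<oplus>\<^bsub>W\<^esub>
          (if m + n = 0 then (of_int (m ^ 3 - m) / 12 * (r * l)) \<odot>\<^bsub>W\<^esub> v else \<zero>\<^bsub>W\<^esub>)"
      unfolding YW_conf[OF v] YW_conf[OF modeW_closed[OF conformal_closed v]] by (rule W_virasoro[OF v])
  next
    fix v n assume "v \<in> wt n"
    then show "YW conformalW 1 v = of_int n \<odot>\<^bsub>W\<^esub> v" by (simp add: wt_def YW_conf)
  next
    fix a b n assume a: "a \<in> carrier W" and b: "b \<in> carrier W"
    show "YW (YW conformalW 0 a) n b = (- of_int n) \<odot>\<^bsub>W\<^esub> YW a (n - 1) b"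
      unfolding YW_conf[OF a] by (rule deriv[OF a b])
  qed
qed

end

text \<open>
  The fields \<open>YW\<close> of the vacuum module \<open>V\<^bsup>[\<ell>]\<^esup>\<close> are the natural structure; conformal vector and grading are
  \<open>\<omega>(-1)\<Omega>\<close> and the eigenspaces of \<open>\<omega>(1)\<close>.
\<close>

theorem corollary5p5:
  fixes V :: "(complex, 'v) module" and Y :: "'v \<Rightarrow> int \<Rightarrow> 'v \<Rightarrow> 'v" and vac :: 'v
    and gr :: "int \<Rightarrow> 'v set" and \<omega> :: 'v and r l :: complex
  assumes "voa_cft_type V Y vac gr \<omega> r"
  shows "\<exists>Z. natural_structure V Y vac l Z \<and>
           (\<exists>gr' \<omega>'. vertex_operator_algebra (Vlevel V Y vac l) Z (Vlevel_vac V Y vac l)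
                        gr' \<omega>' (r * l))"
proof -
  interpret cft: voa_cft_type V Y vac gr \<omega> r by (rule assms)
  interpret VL: cft_vacuum_module V Y vac gr \<omega> r "Vlevel V Y vac l" "Vlevel_act V Y vac l" "Vlevel_vac V Y vac l" l
    by (intro cft_vacuum_module.intro cft.Vlevel_vacuum_module assms)
  have "natural_structure V Y vac l VL.YW"
    unfolding natural_structure_def using VL.YW_vertex_algebra VL.YW_generator by blast
  then show ?thesis using VL.W_voa by blast
qed

end
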